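(* Consider the massive MIMO systems described in the context with $M$-ary PAM, PSK or square QAM constellations, the zero-forcing detector, $N_r=\beta N_t$ with $\beta>1$ fixed, fixed SNR $\eta>0$, and the uniform precoder $\hat{\mathbf F}=\frac1{\sqrt{N_t}}\mathbf I$. If the channel covariance matrix $\mathbf\Sigma$ is the $N_t\times N_t$ Kac-Murdock-Szegő (KMS) matrix with parameter $\rho\in\mathbb C$, $0<|\rho|<1$, i.e. $[\mathbf\Sigma]_{mn}=\rho^{\,n-m}$ for $m\le n$ and $[\mathbf\Sigma]_{mn}=[\mathbf\Sigma]_{nm}^*$ for $m>n$, then the limit of the average SEP, $\lim_{N_t\to\infty}\mathrm P(\hat{\mathbf F})=\widehat{\mathrm P}_{\mathrm U}$, exists and $$\widehat{\mathrm P}_{\mathrm{U,PAM}}=\frac{2(M-1)}MQ\left(\sqrt{\frac{6\eta(\beta-1)(1-|\rho|^2)}{(M^2-1)(1+|\rho|^2)}}\right),$$ $$\widehat{\mathrm P}_{\mathrm{U,PSK}}=\frac1\pi\int_0^{(M-1)\pi/M}\exp\left(-\frac{\eta(\beta-1)(1-|\rho|^2)\sin^2(\pi/M)}{(1+|\rho|^2)\sin^2\theta}\right)d\theta,$$ $$\widehat{\mathrm P}_{\mathrm{U,QAM}}=\frac{4(\sqrt M-1)}{\sqrt M}Q\left(\sqrt{\frac{3\eta(\beta-1)(1-|\rho|^2)}{(M-1)(1+|\rho|^2)}}\right)-\frac{4(\sqrt M-1)^2}{M}Q^2\left(\sqrt{\frac{3\eta(\beta-1)(1-|\rho|^2)}{(M-1)(1+|\rho|^2)}}\right)$$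 for PAM, PSK and square QAM respectively.
   Context: System model. The received vector is $\mathbf r=\mathbf H\mathbf F\mathbf s+\boldsymbol\xi\in\mathbb C^{N_r}$, where: $\mathbf H$ is an $N_r\times N_t$ random matrix whose rows $\mathbf h_1^T,\dots,\mathbf h_{N_r}^T$ are i.i.d. zero-mean circularly-symmetric complex Gaussian with $\mathbb E[(\mathbf h_m^T)^H\mathbf h_m^T]=\mathbf\Sigma$; $\mathbf F$ is an $N_t\times N_t$ nonsingular deterministic precoding matrix; $\boldsymbol\xi$ is circularly-symmetric complex Gaussian noise with covariance $\sigma^2\mathbf I$; $\mathbf s=[s_1,\dots,s_{N_t}]^T$ has i.i.d. entries, each uniform on a constellation $\mathcal S\subset\mathbb C$ of size $M$ with unit average energy; $\mathbf H,\mathbf s,\boldsymbol\xi$ are independent. The system SNR is $\eta=1/\sigma^2$. Constellations. $M$-PAM ($M\ge2$): $\{\delta(2i-1-M):i=1,\dots,M\}\subset\mathbb R$ with $\delta=\sqrt{3/(M^2-1)}$. $M$-PSK ($M\ge2$): $\{e^{2\pi j i/M}:i=0,\dots,M-1\}$ (with $j=\sqrt{-1}$). Square $M$-QAM ($\sqrt M\ge 2$ an integer): $\{a+jb\}$ with $a,b$ ranging over $\{\delta(2i-1-\sqrt M):i=1,\dots,\sqrt M\}$, $\delta=\sqrt{3/(2(M-1))}$. Zero-forcing detection. With $(\mathbf H\mathbf F)^+=(\mathbf F^H\mathbf H^H\mathbf H\mathbf F)^{-1}\mathbf F^H\mathbf H^H$, the receiver forms $\mathbf r'=(\mathbf H\mathbf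 F)^+\mathbf r$ and decides $\hat s_k=\arg\min_{s\in\mathcal S}|r'_k-s|^2$ for each $k$. Average SEP. $\mathrm P(\mathbf F)=\frac1{N_t}\sum_{k=1}^{N_t}\Pr(\hat s_k\ne s_k)$, the probability being over $\mathbf H$, $\mathbf s$ and $\boldsymbol\xi$. Conventions. The limit is over $N_t$ with $N_r=\beta N_t$ (an integer). $Q(x)=\frac1{\sqrt{2\pi}}\int_x^\infty e^{-t^2/2}dt$, and $Q^2(x)=(Q(x))^2$. *)

theory Defs
  imports "HOL-Probability.Probability" "Jordan_Normal_Form.Schur_Decomposition"
    "Jordan_Normal_Form.Gauss_Jordan_Elimination"
begin

unbundle no vec_syntax
unbundle no inner_syntax

text \<open>Indices of vectors and matrices, and hence of antennas and streams, start at 0.\<close>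

definition vec_borel :: "nat \<Rightarrow> complex vec measure" where
  "vec_borel n = vimage_algebra (carrier_vec n)
     (\<lambda>v. \<lambda>i\<in>{..<n}. v $ i) (\<Pi>\<^sub>M i\<in>{..<n}. borel)"

definition mat_borel :: "nat \<Rightarrow> nat \<Rightarrow> complex mat measure" where
  "mat_borel nr nc = vimage_algebra (carrier_mat nr nc)
     (\<lambda>A. \<lambda>ij\<in>{..<nr} \<times> {..<nc}. A $$ ij) (\<Pi>\<^sub>M ij\<in>{..<nr} \<times> {..<nc}. borel)"

text \<open>Real Gaussian random variables, including the degenerate (almost surely constant) ones.\<close>

definition real_gaussian :: "'w measure \<Rightarrow> ('w \<Rightarrow> real) \<Rightarrow> bool" where
  "real_gaussian \<Omega> X \<longleftrightarrow>
     (\<exists>\<mu> \<tau>. 0 < \<tau> \<and> distributed \<Omega> lborel X (normal_density \<mu> \<tau>)) \<or>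
     (\<exists>c. AE \<omega> in \<Omega>. X \<omega> = c)"

text \<open>
  Zero-mean circularly-symmetric complex Gaussian vectors. As \<open>a\<close> ranges over all complex vectors,
  the real part of \<open>a\<^sup>T X\<close> ranges over all real linear combinations of the real and imaginary parts
  of the entries of \<open>X\<close>, so the second conjunct is joint Gaussianity of these parts. The law is
  then determined by the covariance matrix.
\<close>

definition circular_gaussian :: "'w measure \<Rightarrow> nat \<Rightarrow> ('w \<Rightarrow> complex vec) \<Rightarrow> bool" where
  "circular_gaussian \<Omega> n X \<longleftrightarrow>
     X \<in> measurable \<Omega> (vec_borel n) \<and>
     (\<forall>a\<in>carrier_vec n. real_gaussian \<Omega> (\<lambda>\<omega>. Re (a \<bullet> X \<omega>))) \<and>
     (\<forall>i<n. (\<integral>\<omega>. X \<omega> $ i \<partial>\<Omega>) = 0) \<and>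
     (\<forall>\<phi>. distr \<Omega> (vec_borel n) (\<lambda>\<omega>. cis \<phi> \<cdot>\<^sub>v X \<omega>) = distr \<Omega> (vec_borel n) X)"

definition pam :: "nat \<Rightarrow> complex set" where
  "pam M = {complex_of_real (sqrt (3 / (real M ^ 2 - 1)) * (2 * real i - 1 - real M)) | i. i \<in> {1..M}}"

definition psk :: "nat \<Rightarrow> complex set" where
  "psk M = {cis (2 * pi * real i / real M) | i. i \<in> {0..<M}}"

text \<open>Only meaningful when \<open>M\<close> is the square of a natural number.\<close>

definition qam :: "nat \<Rightarrow> complex set" where
  "qam M = (let L = sqrt (real M);
                A = {sqrt (3 / (2 * (real M - 1))) * (2 * real i - 1 - L) | i. 1 \<le> i \<and> real i \<le> L}
            in {Complex a b | a b. a \<in> A \<and> b \<in> A})"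

text \<open>
  The rows of \<open>H\<close> are identically distributed because they are circularly-symmetric Gaussian with
  the same covariance. In \<open>row_covariance\<close> the conjugate is on the first factor, since
  \<open>\<Sigma> = E[(h\<^sup>T)\<^sup>H h\<^sup>T]\<close> for a row \<open>h\<^sup>T\<close> of \<open>H\<close>. The last assumption is the mutual independence of \<open>H\<close>,
  \<open>s\<close> and \<open>\<xi>\<close>.
\<close>

locale mimo_system = prob_space \<Omega> for \<Omega> :: "'w measure" +
  fixes Nt Nr :: nat and \<Sigma> :: "complex mat" and \<sigma> :: real and S :: "complex set"
    and H :: "'w \<Rightarrow> complex mat" and s \<xi> :: "'w \<Rightarrow> complex vec"
  assumes channel_measurable: "random_variable (mat_borel Nr Nt) H"
    and row_gaussian: "m < Nr \<Longrightarrow> circular_gaussian \<Omega> Nt (\<lambda>\<omega>. row (H \<omega>) m)"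
    and row_covariance: "m < Nr \<Longrightarrow>
      mat Nt Nt (\<lambda>(i, j). expectation (\<lambda>\<omega>. cnj (row (H \<omega>) m $ i) * row (H \<omega>) m $ j)) = \<Sigma>"
    and rows_indep: "indep_vars (\<lambda>_. vec_borel Nt) (\<lambda>m \<omega>. row (H \<omega>) m) {..<Nr}"
    and noise_gaussian: "circular_gaussian \<Omega> Nr \<xi>"
    and noise_covariance:
      "mat Nr Nr (\<lambda>(i, j). expectation (\<lambda>\<omega>. \<xi> \<omega> $ i * cnj (\<xi> \<omega> $ j))) =
       complex_of_real (\<sigma>\<^sup>2) \<cdot>\<^sub>m 1\<^sub>m Nr"
    and symbols_measurable: "random_variable (vec_borel Nt) s"
    and symbols_uniform: "k < Nt \<Longrightarrow>
      distr \<Omega> borel (\<lambda>\<omega>. s \<omega> $ k) = distr (measure_pmf (pmf_of_set S)) borel (\<lambda>c. c)"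
    and symbols_indep: "indep_vars (\<lambda>_. borel) (\<lambda>k \<omega>. s \<omega> $ k) {..<Nt}"
    and independence:
      "distr \<Omega> (mat_borel Nr Nt \<Otimes>\<^sub>M (vec_borel Nt \<Otimes>\<^sub>M vec_borel Nr)) (\<lambda>\<omega>. (H \<omega>, s \<omega>, \<xi> \<omega>)) =
       distr \<Omega> (mat_borel Nr Nt) H \<Otimes>\<^sub>M (distr \<Omega> (vec_borel Nt) s \<Otimes>\<^sub>M distr \<Omega> (vec_borel Nr) \<xi>)"

text \<open>
  The value in the singular case is irrelevant: for the systems above and nonsingular \<open>\<Sigma>\<close> and
  \<open>F\<close> it occurs with probability zero when there are at least as many receive as transmit antennas.
\<close>

definition zf_pinv :: "complex mat \<Rightarrow> complex mat" where
  "zf_pinv A = (case mat_inverse (mat_adjoint A * A) of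
      Some B \<Rightarrow> B * mat_adjoint A
    | None \<Rightarrow> 0\<^sub>m (dim_col A) (dim_row A))"

definition zf_output :: "complex mat \<Rightarrow> complex mat \<Rightarrow> complex vec \<Rightarrow> complex vec \<Rightarrow> complex vec" where
  "zf_output F H s \<xi> = (let r = (H * F) *\<^sub>v s + \<xi> in zf_pinv (H * F) *\<^sub>v r)"

text \<open>Ties have probability zero; the library choice operator resolves them.\<close>

definition nearest_symbol :: "complex set \<Rightarrow> complex \<Rightarrow> complex" where
  "nearest_symbol S z = arg_min_on (\<lambda>c. (cmod (z - c))\<^sup>2) S"

definition average_sep :: "'w measure \<Rightarrow> nat \<Rightarrow> complex set \<Rightarrow> complex mat \<Rightarrow>
    ('w \<Rightarrow> complex mat) \<Rightarrow> ('w \<Rightarrow> complex vec) \<Rightarrow> ('w \<Rightarrow> complex vec) \<Rightarrow> real" where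
  "average_sep \<Omega> Nt S F H s \<xi> = (1 / real Nt) *
     (\<Sum>k<Nt. measure \<Omega>
        {\<omega> \<in> space \<Omega>. nearest_symbol S (zf_output F (H \<omega>) (s \<omega>) (\<xi> \<omega>) $ k) \<noteq> s \<omega> $ k})"

definition uniform_precoder :: "nat \<Rightarrow> complex mat" where
  "uniform_precoder Nt = complex_of_real (1 / sqrt (real Nt)) \<cdot>\<^sub>m 1\<^sub>m Nt"

definition kms_matrix :: "nat \<Rightarrow> complex \<Rightarrow> complex mat" where
  "kms_matrix N \<rho> = mat N N (\<lambda>(m, n). if m \<le> n then \<rho> ^ (n - m) else cnj (\<rho> ^ (m - n)))"

definition gaussian_Q :: "real \<Rightarrow> real" where
  "gaussian_Q x = 1 / sqrt (2 * pi) * (LBINT t:{x..}. exp (- (t\<^sup>2) / 2))"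

text \<open>\<open>Nt\<close> tends to infinity along the values for which \<open>\<beta> * Nt\<close> is an integer. The filter is
  nontrivial exactly for rational \<open>\<beta> \<ge> 0\<close>.\<close>

definition integral_ratio_at_top :: "real \<Rightarrow> nat filter" where
  "integral_ratio_at_top \<beta> = inf sequentially (principal {Nt. \<beta> * real Nt \<in> \<nat>})"

end

theory Submission
  imports Defs
begin

text \<open>
  Given the channel, stream \<open>k\<close> sees its symbol plus complex Gaussian noise whose variance is
  \<open>\<sigma>\<^sup>2 Nt / R\<close>, where \<open>R\<close> is the squared distance of column \<open>k\<close> of \<open>H\<close> from the span of the other
  columns. For a KMS covariance an interior column is its best linear prediction from its two
  neighbours plus an innovation with independent entries of variance
  \<open>\<tau> = (1 - |\<rho>|\<^sup>2) / (1 + |\<rho>|\<^sup>2)\<close>, and the innovation is independent of all other columns. Hence \<open>R\<close>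
  is the squared norm of a projection of the innovation onto a space of dimension \<open>Nr - Nt + 1\<close>, and
  fourth moments and Chebyshev's inequality give \<open>R / Nt \<rightarrow> (\<beta> - 1) \<tau>\<close> in probability, uniformly over
  the interior streams. The two boundary streams do not affect the average, so the limit is the
  error probability of the constellation in complex Gaussian noise of variance
  \<open>\<sigma>\<^sup>2 / ((\<beta> - 1) \<tau>)\<close>.
\<close>

section \<open>Uniqueness of joint characteristic functions\<close>

text \<open>Joint Gaussianity is given only through real linear combinations, so statements about
  laws and independence go through joint characteristic functions, and uniqueness on the line has to
  be lifted to finite families. The main obstacle is that the projection behind \<open>R\<close> is
  built from columns correlated with column \<open>k\<close>. Replacing the column by its innovation
  leaves the residual unchanged and removes the correlation, after which the other columns can be
  frozen. The constant \<open>\<tau>\<close> is the reciprocal of an interior diagonal entry of the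
  inverse of the KMS matrix, which is tridiagonal; at the two ends that reciprocal is
  \<open>1 - |\<rho>|^2\<close>, hence the separation of the boundary streams. The law of
  \<open>R\<close> is not computed: the conditional error probability is bounded by 1 and continuous
  in the noise variance at the limit, so convergence of \<open>R / Nt\<close> in probability passes
  to expectations and no moment of \<open>1 / R\<close> has to be controlled. All estimates are made
  for each \<open>Nt\<close> separately, since the probability spaces for different
  \<open>Nt\<close> are unrelated.\<close>

lemma char_eq_imp_eq_finite:
  fixes \<mu> \<nu> :: "real measure"
  assumes "finite_measure \<mu>" "finite_measure \<nu>" "sets \<mu> = sets borel" "sets \<nu> = sets borel"
    and ch: "\<And>t. (CLINT x|\<mu>. iexp (t * x)) = (CLINT x|\<nu>. iexp (t * x))"
  shows "\<mu> = \<nu>"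
proof -
  interpret M: finite_measure \<mu> by fact
  interpret N: finite_measure \<nu> by fact
  have sp: "space \<mu> = UNIV" "space \<nu> = UNIV"
    using sets_eq_imp_space_eq[OF assms(3)] sets_eq_imp_space_eq[OF assms(4)] by auto
  \<comment> \<open>At \<open>t = 0\<close> the transform is the total mass, so one constant
    normalises both measures.\<close>
  have tot: "measure \<mu> UNIV = measure \<nu> UNIV"
    using ch[of 0] by (simp add: sp)
  show ?thesis
  proof (cases "measure \<mu> UNIV = 0")
    case True
    then have z: "emeasure \<mu> UNIV = 0" "emeasure \<nu> UNIV = 0"
      using tot by (simp_all add: M.emeasure_eq_measure N.emeasure_eq_measure)
    show ?thesis
    proof (rule measure_eqI)
      fix A assume "A \<in> sets \<mu>"
      have "emeasure \<mu> A = 0" "emeasure \<nu> A = 0"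
        using z sp emeasure_mono[of A UNIV \<mu>] emeasure_mono[of A UNIV \<nu>] sets.top[of \<mu>] sets.top[of \<nu>]
        by auto
      then show "emeasure \<mu> A = emeasure \<nu> A" by simp
    qed (use assms in simp)
  next
    case False
    define c where "c = 1 / measure \<mu> UNIV"
    have c: "c > 0" using False by (simp add: c_def zero_less_measure_iff)
    have tot1: "emeasure \<mu> UNIV = ennreal (1/c)" "emeasure \<nu> UNIV = ennreal (1/c)"
      using tot by (simp_all add: c_def M.emeasure_eq_measure N.emeasure_eq_measure)
    have c1: "ennreal c * ennreal (1/c) = 1" 
      using c by (simp add: ennreal_mult[symmetric] divide_nonneg_nonneg) 
    define \<mu>' where "\<mu>' = density \<mu> (\<lambda>_. ennreal c)"
    define \<nu>' where "\<nu>' = density \<nu> (\<lambda>_. ennreal c)"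
    have rd: "real_distribution \<mu>'" "real_distribution \<nu>'"
      unfolding real_distribution_def real_distribution_axioms_def \<mu>'_def \<nu>'_def
      using assms(3,4) sp tot1 c1
      by (auto intro!: prob_spaceI simp: emeasure_density)
    have "char \<mu>' = char \<nu>'"
    proof
      fix t
      have "char \<mu>' t = (CLINT x|\<mu>. c *\<^sub>R iexp (t * x))"
        unfolding char_def \<mu>'_def using c by (subst integral_density) (simp_all add: measurable_cong_sets[OF assms(3) refl])
      also have "\<dots> = c *\<^sub>R (CLINT x|\<mu>. iexp (t * x))" by (rule integral_scaleR_right)
      also have "\<dots> = c *\<^sub>R (CLINT x|\<nu>. iexp (t * x))" by (simp only: ch)
      also have "\<dots> = (CLINT x|\<nu>. c *\<^sub>R iexp (t * x))" by (rule integral_scaleR_right[symmetric])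
      also have "\<dots> = char \<nu>' t"
        unfolding char_def \<nu>'_def using c by (subst integral_density) (simp_all add: measurable_cong_sets[OF assms(4) refl])
      finally show "char \<mu>' t = char \<nu>' t" .
    qed
    then have eq: "\<mu>' = \<nu>'" by (intro Levy_uniqueness rd)
    show ?thesis
    proof (rule measure_eqI)
      fix A assume A: "A \<in> sets \<mu>"
      then have A': "A \<in> sets \<nu>" using assms by simp
      have "emeasure \<mu>' A = emeasure \<nu>' A" by (simp add: eq)
      then have "ennreal c * emeasure \<mu> A = ennreal c * emeasure \<nu> A"
        using A A' by (simp add: \<mu>'_def \<nu>'_def emeasure_density nn_integral_cmult_indicator)
      then have "ennreal (1/c) * (ennreal c * emeasure \<mu> A) = ennreal (1/c) * (ennreal c * emeasure \<nu> A)" by simp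
      then show "emeasure \<mu> A = emeasure \<nu> A"
        unfolding mult.assoc[symmetric] mult.commute[of "ennreal (1/c)" "ennreal c"] c1 by simp
    qed (use assms in simp)
  qed
qed

lemma iexp_times_cos: "iexp t * complex_of_real (cos z) = (iexp (t + z) + iexp (t - z)) / 2"
  by (simp add: complex_eq_iff Re_exp Im_exp cos_add sin_add cos_diff sin_diff)

lemma iexp_times_sin: "iexp t * complex_of_real (sin z) = (iexp (t + z) - iexp (t - z)) / (2 * \<i>)"
  by (simp add: complex_eq_iff Re_exp Im_exp cos_add sin_add cos_diff sin_diff Re_divide Im_divide)

lemma (in finite_measure) integrable_iexp_comp [simp]:
  assumes "X \<in> borel_measurable M" shows "integrable M (\<lambda>x. iexp (X x))"
  using assms by (intro integrable_const_bound[where B=1]) auto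

text \<open>One coordinate of the uniqueness theorem is treated by changing the measure with the positive
  density \<open>2 + cos\<close> (or \<open>2 + sin\<close>) of the remaining coordinates.\<close>

lemma joint_char_indicator_eq:
  fixes X Z :: "'a \<Rightarrow> real" and X' Z' :: "'b \<Rightarrow> real"
  assumes "finite_measure M" "finite_measure N"
    and [measurable]: "X \<in> borel_measurable M" "Z \<in> borel_measurable M"
      "X' \<in> borel_measurable N" "Z' \<in> borel_measurable N" "B \<in> sets borel"
    and ch: "\<And>t u. (CLINT x|M. iexp (t * X x + u * Z x)) = (CLINT x|N. iexp (t * X' x + u * Z' x))"
  shows "(CLINT x|M. indicator B (X x) * iexp (Z x)) = (CLINT x|N. indicator B (X' x) * iexp (Z' x))"
proof -
  interpret M: finite_measure M by fact
  interpret N: finite_measure N by fact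
  \<comment> \<open>Since \<open>|f| \<le> 1\<close>, the weight \<open>2 + f\<close> is positive
    and bounded. Weighting by it and projecting to the first coordinate gives finite measures on the
    line with equal transforms; their total mass is not 1 in general.\<close>
  have tilt: "(LINT x|M. indicator B (X x) * (2 + f (Z x))) = (LINT x|N. indicator B (X' x) * (2 + f (Z' x)))"
    if f: "f \<in> borel_measurable borel" "\<And>z. \<bar>f z\<bar> \<le> 1"
      and eq: "\<And>t. (CLINT x|M. iexp (t * X x) * complex_of_real (f (Z x))) = 
                    (CLINT x|N. iexp (t * X' x) * complex_of_real (f (Z' x)))" for f :: "real \<Rightarrow> real"
  proof -
    note [measurable] = f(1)
    have pos: "0 \<le> 2 + f z" for z using f(2)[of z] by linarith
    have le: "\<bar>2 + f z\<bar> \<le> 3" for z using f(2)[of z] by linarith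
    let ?\<mu> = "distr (density M (\<lambda>x. ennreal (2 + f (Z x)))) borel X"
    let ?\<nu> = "distr (density N (\<lambda>x. ennreal (2 + f (Z' x)))) borel X'"
    have iM: "integrable M (\<lambda>x. indicator B (X x) * (2 + f (Z x)))" if [measurable]: "B \<in> sets borel" for B
      by (rule M.integrable_const_bound[where B=3]) (auto simp: abs_mult indicator_def le[simplified])
    have iN: "integrable N (\<lambda>x. indicator B (X' x) * (2 + f (Z' x)))" if [measurable]: "B \<in> sets borel" for B
      by (rule N.integrable_const_bound[where B=3]) (auto simp: abs_mult indicator_def le[simplified])
    have eM: "emeasure ?\<mu> B = ennreal (LINT x|M. indicator B (X x) * (2 + f (Z x)))" if [measurable]: "B \<in> sets borel" for B
      by (auto simp: emeasure_distr emeasure_density nn_integral_eq_integral[OF iM[OF that], symmetric] pos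
          intro!: nn_integral_cong split: split_indicator)
    have eN: "emeasure ?\<nu> B = ennreal (LINT x|N. indicator B (X' x) * (2 + f (Z' x)))" if [measurable]: "B \<in> sets borel" for B
      by (auto simp: emeasure_distr emeasure_density nn_integral_eq_integral[OF iN[OF that], symmetric] pos
          intro!: nn_integral_cong split: split_indicator)
    have cM: "(CLINT x|?\<mu>. iexp (t * x)) = 2 * (CLINT x|M. iexp (t * X x)) + (CLINT x|M. iexp (t * X x) * complex_of_real (f (Z x)))" for t
    proof -
      have "(CLINT x|?\<mu>. iexp (t * x)) = (CLINT x|M. (2 + f (Z x)) *\<^sub>R iexp (t * X x))"
        by (subst integral_distr, simp, simp) (subst integral_density, auto simp: pos)
      also have "\<dots> = (CLINT x|M. 2 * iexp (t * X x) + iexp (t * X x) * complex_of_real (f (Z x)))"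
        by (intro Bochner_Integration.integral_cong) (auto simp: scaleR_conv_of_real algebra_simps)
      also have "\<dots> = 2 * (CLINT x|M. iexp (t * X x)) + (CLINT x|M. iexp (t * X x) * complex_of_real (f (Z x)))"
        using M.integrable_iexp_comp[of "\<lambda>x. t * X x"] M.integrable_const_bound[of "\<lambda>x. iexp (t * X x) * complex_of_real (f (Z x))" 1]
        by (subst Bochner_Integration.integral_add) (simp_all add: norm_mult f(2))
      finally show ?thesis .
    qed
    have cN: "(CLINT x|?\<nu>. iexp (t * x)) = 2 * (CLINT x|N. iexp (t * X' x)) + (CLINT x|N. iexp (t * X' x) * complex_of_real (f (Z' x)))" for t
    proof -
      have "(CLINT x|?\<nu>. iexp (t * x)) = (CLINT x|N. (2 + f (Z' x)) *\<^sub>R iexp (t * X' x))"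
        by (subst integral_distr, simp, simp) (subst integral_density, auto simp: pos)
      also have "\<dots> = (CLINT x|N. 2 * iexp (t * X' x) + iexp (t * X' x) * complex_of_real (f (Z' x)))"
        by (intro Bochner_Integration.integral_cong) (auto simp: scaleR_conv_of_real algebra_simps)
      also have "\<dots> = 2 * (CLINT x|N. iexp (t * X' x)) + (CLINT x|N. iexp (t * X' x) * complex_of_real (f (Z' x)))"
        using N.integrable_iexp_comp[of "\<lambda>x. t * X' x"] N.integrable_const_bound[of "\<lambda>x. iexp (t * X' x) * complex_of_real (f (Z' x))" 1]
        by (subst Bochner_Integration.integral_add) (simp_all add: norm_mult f(2))
      finally show ?thesis .
    qed
    have "?\<mu> = ?\<nu>"
    proof (rule char_eq_imp_eq_finite)
      show "finite_measure ?\<mu>" using eM[of UNIV] by (intro finite_measureI) simp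
      show "finite_measure ?\<nu>" using eN[of UNIV] by (intro finite_measureI) simp
      show "(CLINT x|?\<mu>. iexp (t * x)) = (CLINT x|?\<nu>. iexp (t * x))" for t
        unfolding cM cN eq using ch[of t 0] by simp
    qed simp_all
    then have "emeasure ?\<mu> B = emeasure ?\<nu> B" by simp
    then show ?thesis unfolding eM[OF assms(7)] eN[OF assms(7)]
      by (subst (asm) ennreal_inj) (auto intro!: integral_nonneg_AE simp: pos)
  qed
  have bnd: "integrable M (\<lambda>x. indicator B (X x) * f (Z x))" "integrable N (\<lambda>x. indicator B (X' x) * f (Z' x))"
    if "f \<in> borel_measurable borel" "\<And>z. \<bar>f z\<bar> \<le> 1" for f :: "real \<Rightarrow> real"
    using that(1) by (auto intro!: M.integrable_const_bound[where B=1] N.integrable_const_bound[where B=1] simp: that(2) abs_mult indicator_def)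
  \<comment> \<open>The case \<open>f = 0\<close> gives the unweighted probabilities; subtracting
    them leaves the weight \<open>f\<close> alone.\<close>
  have base: "(LINT x|M. indicator B (X x) * f (Z x)) = (LINT x|N. indicator B (X' x) * f (Z' x))"
    if f: "f \<in> borel_measurable borel" "\<And>z. \<bar>f z\<bar> \<le> 1"
      and eq: "\<And>t. (CLINT x|M. iexp (t * X x) * complex_of_real (f (Z x))) = 
                    (CLINT x|N. iexp (t * X' x) * complex_of_real (f (Z' x)))" for f :: "real \<Rightarrow> real"
  proof -
    have "(LINT x|M. indicator B (X x) * (2 + 0)) = (LINT x|N. indicator B (X' x) * (2 + (0::real)))"
      using tilt[of "\<lambda>_. 0"] by simp
    moreover have "(LINT x|M. indicator B (X x) * (2 + f (Z x))) = (LINT x|M. indicator B (X x) * (2 + 0)) + (LINT x|M. indicator B (X x) * f (Z x))"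
    proof -
      have i: "integrable M (\<lambda>x. indicator B (X x) * (2 + (0::real)))"
        by (rule M.integrable_const_bound[where B=2]) (auto simp: indicator_def)
      show ?thesis
        unfolding Bochner_Integration.integral_add[OF i bnd(1)[OF f], symmetric] by (simp add: distrib_left)
    qed
    moreover have "(LINT x|N. indicator B (X' x) * (2 + f (Z' x))) = (LINT x|N. indicator B (X' x) * (2 + 0)) + (LINT x|N. indicator B (X' x) * f (Z' x))"
    proof -
      have i: "integrable N (\<lambda>x. indicator B (X' x) * (2 + (0::real)))"
        by (rule N.integrable_const_bound[where B=2]) (auto simp: indicator_def)
      show ?thesis
        unfolding Bochner_Integration.integral_add[OF i bnd(2)[OF f], symmetric] by (simp add: distrib_left)
    qed
    ultimately show ?thesis using tilt[OF f eq] by linarith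
  qed
  \<comment> \<open>The product formula writes the transform weighted by \<open>cos (Z x)\<close> as
    the mean of two joint transforms, at \<open>u = 1\<close> and \<open>u = -1\<close>.\<close>
  have c: "(LINT x|M. indicator B (X x) * cos (Z x)) = (LINT x|N. indicator B (X' x) * cos (Z' x))"
  proof (rule base)
    fix t
    have "(CLINT x|M. iexp (t * X x) * complex_of_real (cos (Z x))) = ((CLINT x|M. iexp (t * X x + 1 * Z x)) + (CLINT x|M. iexp (t * X x + (-1) * Z x))) / 2"
      unfolding iexp_times_cos
      using M.integrable_iexp_comp[of "\<lambda>x. t * X x + Z x"] M.integrable_iexp_comp[of "\<lambda>x. t * X x - Z x"]
      by (subst integral_divide_zero, subst Bochner_Integration.integral_add) simp_all
    also have "\<dots> = ((CLINT x|N. iexp (t * X' x + 1 * Z' x)) + (CLINT x|N. iexp (t * X' x + (-1) * Z' x))) / 2"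
      unfolding ch ..
    also have "\<dots> = (CLINT x|N. iexp (t * X' x) * complex_of_real (cos (Z' x)))"
      unfolding iexp_times_cos
      using N.integrable_iexp_comp[of "\<lambda>x. t * X' x + Z' x"] N.integrable_iexp_comp[of "\<lambda>x. t * X' x - Z' x"]
      by (subst integral_divide_zero, subst Bochner_Integration.integral_add) simp_all
    finally show "(CLINT x|M. iexp (t * X x) * complex_of_real (cos (Z x))) = (CLINT x|N. iexp (t * X' x) * complex_of_real (cos (Z' x)))" .
  qed auto
  have s: "(LINT x|M. indicator B (X x) * sin (Z x)) = (LINT x|N. indicator B (X' x) * sin (Z' x))"
  proof (rule base)
    fix t
    have "(CLINT x|M. iexp (t * X x) * complex_of_real (sin (Z x))) = ((CLINT x|M. iexp (t * X x + 1 * Z x)) - (CLINT x|M. iexp (t * X x + (-1) * Z x))) / (2*\<i>)"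
      unfolding iexp_times_sin
      using M.integrable_iexp_comp[of "\<lambda>x. t * X x + Z x"] M.integrable_iexp_comp[of "\<lambda>x. t * X x - Z x"]
      by (subst integral_divide_zero, subst Bochner_Integration.integral_diff) simp_all
    also have "\<dots> = ((CLINT x|N. iexp (t * X' x + 1 * Z' x)) - (CLINT x|N. iexp (t * X' x + (-1) * Z' x))) / (2*\<i>)"
      unfolding ch ..
    also have "\<dots> = (CLINT x|N. iexp (t * X' x) * complex_of_real (sin (Z' x)))"
      unfolding iexp_times_sin
      using N.integrable_iexp_comp[of "\<lambda>x. t * X' x + Z' x"] N.integrable_iexp_comp[of "\<lambda>x. t * X' x - Z' x"]
      by (subst integral_divide_zero, subst Bochner_Integration.integral_diff) simp_all
    finally show "(CLINT x|M. iexp (t * X x) * complex_of_real (sin (Z x))) = (CLINT x|N. iexp (t * X' x) * complex_of_real (sin (Z' x)))" .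
  qed auto
  have i: "integrable M (\<lambda>x. indicator B (X x) * iexp (Z x))" "integrable N (\<lambda>x. indicator B (X' x) * iexp (Z' x))"
    by (auto intro!: M.integrable_const_bound[where B=1] N.integrable_const_bound[where B=1] simp: norm_mult indicator_def)
  have parts: "Re (indicator B y * iexp z) = indicator B y * cos z" "Im (indicator B y * iexp z) = indicator B y * sin z" for y z :: real
    by (auto simp: indicator_def Re_exp Im_exp)
  show ?thesis
    by (rule complex_eqI) (simp_all only: integral_Re[OF i(1), symmetric] integral_Re[OF i(2), symmetric]
         integral_Im[OF i(1), symmetric] integral_Im[OF i(2), symmetric] parts c s)
qed

text \<open>Induction over the coordinates: restricting to \<open>X j x \<in> B j\<close> by an
  indicator density leaves measures for which the remaining coordinates again have equal transforms.
  Restriction loses mass, hence the generality over finite measures \<open>M\<close> and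
  \<open>N\<close>.\<close>

lemma joint_char_box_eq:
  fixes X :: "'i \<Rightarrow> 'a \<Rightarrow> real" and X' :: "'i \<Rightarrow> 'b \<Rightarrow> real"
  assumes "finite I" "finite_measure M" "finite_measure N"
    and "\<And>i. i \<in> I \<Longrightarrow> X i \<in> borel_measurable M" "\<And>i. i \<in> I \<Longrightarrow> X' i \<in> borel_measurable N"
    and "\<And>a. (CLINT x|M. iexp (\<Sum>i\<in>I. a i * X i x)) = (CLINT x|N. iexp (\<Sum>i\<in>I. a i * X' i x))"
    and "\<And>i. i \<in> I \<Longrightarrow> B i \<in> sets borel"
  shows "measure M {x\<in>space M. \<forall>i\<in>I. X i x \<in> B i} = measure N {x\<in>space N. \<forall>i\<in>I. X' i x \<in> B i}"
  using assms
proof (induction I arbitrary: M N rule: finite_induct)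
  case empty
  then show ?case by simp
next
  case (insert j I)
  interpret M: finite_measure M by fact
  interpret N: finite_measure N by fact
  have [measurable]: "\<And>i. i \<in> I \<Longrightarrow> X i \<in> borel_measurable M" "\<And>i. i \<in> I \<Longrightarrow> X' i \<in> borel_measurable N"
    "\<And>i. i \<in> I \<Longrightarrow> B i \<in> sets borel" using insert.prems(3,4,6) by blast+
  have [measurable]: "X j \<in> borel_measurable M" "X' j \<in> borel_measurable N" "B j \<in> sets borel"
    using insert.prems(3,4,6) by blast+
  let ?M = "density M (indicator (X j -` B j \<inter> space M))"
  let ?N = "density N (indicator (X' j -` B j \<inter> space N))"
  have [measurable]: "X j -` B j \<inter> space M \<in> sets M" "X' j -` B j \<inter> space N \<in> sets N"
    by measurable
  have fin: "finite_measure ?M" "finite_measure ?N"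
    by (auto intro!: finite_measureI simp: emeasure_density emeasure_restrict_space)
  have box: "measure ?M {x\<in>space ?M. \<forall>i\<in>I. X i x \<in> B i} = measure ?N {x\<in>space ?N. \<forall>i\<in>I. X' i x \<in> B i}"
  proof (rule insert.IH[OF fin])
    fix a :: "'i \<Rightarrow> real"
    define Z where "Z = (\<lambda>x. \<Sum>i\<in>I. a i * X i x)"
    define Z' where "Z' = (\<lambda>x. \<Sum>i\<in>I. a i * X' i x)"
    have [measurable]: "Z \<in> borel_measurable M" "Z' \<in> borel_measurable N"
      by (auto simp: Z_def Z'_def)
    have "(CLINT x|M. indicator (B j) (X j x) * iexp (Z x)) = (CLINT x|N. indicator (B j) (X' j x) * iexp (Z' x))"
    proof (rule joint_char_indicator_eq)
      fix t u
      have *: "(\<Sum>i\<in>insert j I. (if i = j then t else u * a i) * Y i x) = t * Y j x + u * (\<Sum>i\<in>I. a i * Y i x)"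
        for Y :: "'i \<Rightarrow> 'c \<Rightarrow> real" and x
      proof -
        have "(\<Sum>i\<in>I. (if i = j then t else u * a i) * Y i x) = (\<Sum>i\<in>I. u * (a i * Y i x))"
          using insert.hyps(2) by (intro sum.cong) auto
        then show ?thesis using insert.hyps by (simp add: sum_distrib_left)
      qed
      show "(CLINT x|M. iexp (t * X j x + u * Z x)) = (CLINT x|N. iexp (t * X' j x + u * Z' x))"
        using insert.prems(5)[of "\<lambda>i. if i = j then t else u * a i"] unfolding * Z_def Z'_def .
    qed fact+
    moreover have "(CLINT x|?M. iexp (Z x)) = (CLINT x|M. indicator (B j) (X j x) * iexp (Z x))"
    proof -
      have eq: "?M = density M (\<lambda>x. ennreal (indicator (B j) (X j x)))"
        by (rule density_cong) (auto simp: indicator_def)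
      show ?thesis unfolding eq
        by (subst integral_density) (auto simp: indicator_def intro!: Bochner_Integration.integral_cong)
    qed
    moreover have "(CLINT x|?N. iexp (Z' x)) = (CLINT x|N. indicator (B j) (X' j x) * iexp (Z' x))"
    proof -
      have eq: "?N = density N (\<lambda>x. ennreal (indicator (B j) (X' j x)))"
        by (rule density_cong) (auto simp: indicator_def)
      show ?thesis unfolding eq
        by (subst integral_density) (auto simp: indicator_def intro!: Bochner_Integration.integral_cong)
    qed
    ultimately show "(CLINT x|?M. iexp (\<Sum>i\<in>I. a i * X i x)) = (CLINT x|?N. iexp (\<Sum>i\<in>I. a i * X' i x))"
      by (simp add: Z_def Z'_def)
  qed (use insert.prems(3,4,6) in simp_all)
  have [measurable]: "{x\<in>space M. \<forall>i\<in>I. X i x \<in> B i} \<in> sets M" "{x\<in>space N. \<forall>i\<in>I. X' i x \<in> B i} \<in> sets N"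
    using insert.hyps(1) by (auto intro!: sets.sets_Collect_finite_All)
  have *: "measure ?M {x\<in>space M. \<forall>i\<in>I. X i x \<in> B i} = measure M {x\<in>space M. \<forall>i\<in>insert j I. X i x \<in> B i}"
    unfolding measure_def by (subst emeasure_density, simp, simp, subst indicator_inter_arith[symmetric])
      (auto intro!: arg_cong[where f=enn2real] arg_cong[where f="emeasure M"])
  have **: "measure ?N {x\<in>space N. \<forall>i\<in>I. X' i x \<in> B i} = measure N {x\<in>space N. \<forall>i\<in>insert j I. X' i x \<in> B i}"
    unfolding measure_def by (subst emeasure_density, simp, simp, subst indicator_inter_arith[symmetric])
      (auto intro!: arg_cong[where f=enn2real] arg_cong[where f="emeasure N"])
  show ?case using box * ** by simp
qed

lemma joint_char_law_eq:
  fixes X :: "'i \<Rightarrow> 'a \<Rightarrow> real" and X' :: "'i \<Rightarrow> 'b \<Rightarrow> real"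
  assumes I: "finite I" and fin: "finite_measure M" "finite_measure N"
    and [measurable]: "\<And>i. i \<in> I \<Longrightarrow> X i \<in> borel_measurable M" "\<And>i. i \<in> I \<Longrightarrow> X' i \<in> borel_measurable N"
    and ch: "\<And>a. (CLINT x|M. iexp (\<Sum>i\<in>I. a i * X i x)) = (CLINT x|N. iexp (\<Sum>i\<in>I. a i * X' i x))"
  shows "distr M (Pi\<^sub>M I (\<lambda>_. borel)) (\<lambda>x. \<lambda>i\<in>I. X i x) = distr N (Pi\<^sub>M I (\<lambda>_. borel)) (\<lambda>x. \<lambda>i\<in>I. X' i x)"
proof (rule measure_eqI_PiM_finite[OF I, where A="\<lambda>_. space (Pi\<^sub>M I (\<lambda>_. borel))"])
  interpret M: finite_measure M by fact
  interpret N: finite_measure N by fact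
  fix A :: "'i \<Rightarrow> real set" assume A: "\<And>i. i \<in> I \<Longrightarrow> A i \<in> sets borel"
  have "emeasure (distr M (Pi\<^sub>M I (\<lambda>_. borel)) (\<lambda>x. \<lambda>i\<in>I. X i x)) (Pi\<^sub>E I A) = measure M {x\<in>space M. \<forall>i\<in>I. X i x \<in> A i}"
    using I A by (subst emeasure_distr)
      (auto intro!: sets_PiM_I_finite simp: M.emeasure_eq_measure PiE_iff intro!: arg_cong[where f="measure M"])
  moreover have "emeasure (distr N (Pi\<^sub>M I (\<lambda>_. borel)) (\<lambda>x. \<lambda>i\<in>I. X' i x)) (Pi\<^sub>E I A) = measure N {x\<in>space N. \<forall>i\<in>I. X' i x \<in> A i}"
    using I A by (subst emeasure_distr)
      (auto intro!: sets_PiM_I_finite simp: N.emeasure_eq_measure PiE_iff intro!: arg_cong[where f="measure N"])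
  ultimately show "emeasure (distr M (Pi\<^sub>M I (\<lambda>_. borel)) (\<lambda>x. \<lambda>i\<in>I. X i x)) (Pi\<^sub>E I A) =
      emeasure (distr N (Pi\<^sub>M I (\<lambda>_. borel)) (\<lambda>x. \<lambda>i\<in>I. X' i x)) (Pi\<^sub>E I A)"
    using joint_char_box_eq[where B=A, OF I fin assms(4,5) ch A] by simp
next
  interpret M: finite_measure M by fact
  have "finite_measure (distr M (Pi\<^sub>M I (\<lambda>_. borel)) (\<lambda>x. \<lambda>i\<in>I. X i x))"
    by (rule M.finite_measure_distr) measurable
  then show "emeasure (distr M (Pi\<^sub>M I (\<lambda>_. borel)) (\<lambda>x. \<lambda>i\<in>I. X i x)) (space (Pi\<^sub>M I (\<lambda>_. borel))) \<noteq> \<infinity>"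
    by (simp add: finite_measure.emeasure_finite)
  show "range (\<lambda>_. space (Pi\<^sub>M I (\<lambda>_. borel))) \<subseteq> prod_algebra I (\<lambda>_. borel)"
    using I by (auto simp: space_PiM intro!: prod_algebraI_finite)
qed simp_all

text \<open>A real combination of real and imaginary parts with weights \<open>x\<close> and
  \<open>y\<close> is \<open>Re (Complex x (- y) * z)\<close>, so complex coefficients under a
  single real part test all real combinations of the parts, which are indexed by
  \<open>I \<times> UNIV\<close>.\<close>

lemma complex_char_law_eq:
  fixes Z :: "'i \<Rightarrow> 'a \<Rightarrow> complex" and Z' :: "'i \<Rightarrow> 'b \<Rightarrow> complex"
  assumes I: "finite I" and fin: "finite_measure M" "finite_measure N"
    and Z: "\<And>i. i \<in> I \<Longrightarrow> Z i \<in> borel_measurable M" and Z': "\<And>i. i \<in> I \<Longrightarrow> Z' i \<in> borel_measurable N"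
    and ch: "\<And>a. (CLINT x|M. iexp (Re (\<Sum>i\<in>I. a i * Z i x))) = (CLINT x|N. iexp (Re (\<Sum>i\<in>I. a i * Z' i x)))"
  shows "distr M (Pi\<^sub>M I (\<lambda>_. borel)) (\<lambda>x. \<lambda>i\<in>I. Z i x) = distr N (Pi\<^sub>M I (\<lambda>_. borel)) (\<lambda>x. \<lambda>i\<in>I. Z' i x)"
proof -
  define parts :: "complex \<Rightarrow> bool \<Rightarrow> real" where "parts = (\<lambda>z b. if b then Re z else Im z)"
  let ?J = "I \<times> (UNIV :: bool set)"
  let ?R = "\<lambda>x. \<lambda>p\<in>?J. parts (Z (fst p) x) (snd p)"
  let ?R' = "\<lambda>x. \<lambda>p\<in>?J. parts (Z' (fst p) x) (snd p)"
  let ?C = "\<lambda>f. \<lambda>i\<in>I. complex_of_real (f (i, True)) + \<i> * complex_of_real (f (i, False))"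
  have [measurable]: "(\<lambda>x. parts (Z (fst p) x) (snd p)) \<in> borel_measurable M"
       "(\<lambda>x. parts (Z' (fst p) x) (snd p)) \<in> borel_measurable N" if "p \<in> ?J" for p
    using Z[of "fst p"] Z'[of "fst p"] that by (auto simp: parts_def mem_Times_iff)
  have comb: "(\<Sum>p\<in>?J. a p * parts (z (fst p)) (snd p)) = Re (\<Sum>i\<in>I. Complex (a (i, True)) (- a (i, False)) * z i)"
    for a and z :: "'i \<Rightarrow> complex"
    by (simp add: sum.cartesian_product' UNIV_bool parts_def)
  have eq: "distr M (Pi\<^sub>M ?J (\<lambda>_. borel)) ?R = distr N (Pi\<^sub>M ?J (\<lambda>_. borel)) ?R'"
  proof (rule joint_char_law_eq)
    fix a :: "'i \<times> bool \<Rightarrow> real"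
    show "(CLINT x|M. iexp (\<Sum>p\<in>?J. a p * parts (Z (fst p) x) (snd p))) = (CLINT x|N. iexp (\<Sum>p\<in>?J. a p * parts (Z' (fst p) x) (snd p)))"
      using ch[of "\<lambda>i. Complex (a (i, True)) (- a (i, False))"] by (simp only: comb[of a "\<lambda>i. Z i x" for x] comb[of a "\<lambda>i. Z' i x" for x])
  qed (use I fin in simp_all)
  have R: "?R \<in> measurable M (Pi\<^sub>M ?J (\<lambda>_. borel))" "?R' \<in> measurable N (Pi\<^sub>M ?J (\<lambda>_. borel))"
    by measurable
  have C: "?C \<in> measurable (Pi\<^sub>M ?J (\<lambda>_. borel)) (Pi\<^sub>M I (\<lambda>_. borel))"
    by measurable
  have "distr M (Pi\<^sub>M I (\<lambda>_. borel)) (\<lambda>x. \<lambda>i\<in>I. Z i x) = distr (distr M (Pi\<^sub>M ?J (\<lambda>_. borel)) ?R) (Pi\<^sub>M I (\<lambda>_. borel)) ?C"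
    by (subst distr_distr[OF C R(1)]) (auto intro!: distr_cong simp: parts_def complex_eq[symmetric])
  moreover have "distr N (Pi\<^sub>M I (\<lambda>_. borel)) (\<lambda>x. \<lambda>i\<in>I. Z' i x) = distr (distr N (Pi\<^sub>M ?J (\<lambda>_. borel)) ?R') (Pi\<^sub>M I (\<lambda>_. borel)) ?C"
    by (subst distr_distr[OF C R(2)]) (auto intro!: distr_cong simp: parts_def complex_eq[symmetric])
  ultimately show ?thesis using eq by simp
qed

lemma complex_char_law_eq_single:
  fixes Z :: "'a \<Rightarrow> complex" and Z' :: "'b \<Rightarrow> complex"
  assumes fin: "finite_measure M" "finite_measure N"
    and Z [measurable]: "Z \<in> borel_measurable M" "Z' \<in> borel_measurable N"
    and ch: "\<And>a. (CLINT x|M. iexp (Re (a * Z x))) = (CLINT x|N. iexp (Re (a * Z' x)))"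
  shows "distr M borel Z = distr N borel Z'"
proof -
  have eq: "distr M (Pi\<^sub>M {()} (\<lambda>_. borel)) (\<lambda>x. \<lambda>i\<in>{()}. Z x) = distr N (Pi\<^sub>M {()} (\<lambda>_. borel)) (\<lambda>x. \<lambda>i\<in>{()}. Z' x)"
    by (rule complex_char_law_eq) (use fin Z ch in auto)
  have "distr M borel Z = distr (distr M (Pi\<^sub>M {()} (\<lambda>_. borel)) (\<lambda>x. \<lambda>i\<in>{()}. Z x)) borel (\<lambda>f. f ())"
    by (subst distr_distr) (auto intro!: distr_cong)
  also have "\<dots> = distr N borel Z'"
    unfolding eq by (subst distr_distr) (auto intro!: distr_cong)
  finally show ?thesis .
qed

section \<open>Circular complex Gaussian variables\<close>

lemma integral_pair_mult_bounded:
  fixes f :: "'a \<Rightarrow> complex" and g :: "'b \<Rightarrow> complex"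
  assumes "prob_space M" "prob_space N" and [measurable]: "f \<in> borel_measurable M" "g \<in> borel_measurable N"
    and "\<And>x. cmod (f x) \<le> 1" "\<And>y. cmod (g y) \<le> 1"
  shows "(CLINT z|(M \<Otimes>\<^sub>M N). f (fst z) * g (snd z)) = (CLINT x|M. f x) * (CLINT y|N. g y)"
proof -
  interpret M: prob_space M by fact
  interpret N: prob_space N by fact
  interpret P: pair_prob_space M N ..
  have "integrable (M \<Otimes>\<^sub>M N) (\<lambda>z. f (fst z) * g (snd z))"
    using assms(5,6) by (intro P.integrable_const_bound[where B=1]) (auto simp: norm_mult intro!: mult_le_one)
  from P.integral_fst'[OF this] show ?thesis by simp
qed

text \<open>The exponent is normalised so that \<open>V\<close> is the variance \<open>E |Z|\<^sup>2\<close>: each of \<open>Re Z\<close> and \<open>Im Z\<close>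
  has variance \<open>V / 2\<close>.\<close>

definition cgauss :: "'a measure \<Rightarrow> ('a \<Rightarrow> complex) \<Rightarrow> real \<Rightarrow> bool" where
  "cgauss M Z V \<longleftrightarrow> Z \<in> borel_measurable M \<and> 0 \<le> V \<and>
     (\<forall>a. (CLINT x|M. iexp (Re (a * Z x))) = complex_of_real (exp (- (V * (cmod a)\<^sup>2 / 4))))"

definition cgauss_measure :: "real \<Rightarrow> complex measure" where
  "cgauss_measure V = distr (std_normal_distribution \<Otimes>\<^sub>M std_normal_distribution) borel
     (\<lambda>p. complex_of_real (sqrt (V / 2)) * (complex_of_real (fst p) + \<i> * complex_of_real (snd p)))"

lemma prob_space_std_normal: "prob_space std_normal_distribution"
  using real_dist_normal_dist by (simp add: real_distribution_def)

lemma prob_space_cgauss_measure: "prob_space (cgauss_measure V)"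
proof -
  interpret N: prob_space std_normal_distribution by (rule prob_space_std_normal)
  interpret P: pair_prob_space std_normal_distribution std_normal_distribution ..
  show ?thesis unfolding cgauss_measure_def by (rule P.prob_space_distr) measurable
qed

lemma sets_cgauss_measure [measurable_cong, simp]: "sets (cgauss_measure V) = sets borel"
  by (simp add: cgauss_measure_def)

lemma space_cgauss_measure [simp]: "space (cgauss_measure V) = UNIV"
  by (simp add: cgauss_measure_def)

lemma cgauss_cgauss_measure:
  assumes "0 \<le> V" shows "cgauss (cgauss_measure V) (\<lambda>z. z) V"
proof -
  have "(CLINT z|cgauss_measure V. iexp (Re (a * z))) = complex_of_real (exp (- (V * (cmod a)\<^sup>2 / 4)))" for a
  proof -
    define s where "s = sqrt (V / 2)"
    have s2: "s\<^sup>2 = V / 2" using assms by (simp add: s_def)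
    let ?N = "std_normal_distribution"
    have "(CLINT z|cgauss_measure V. iexp (Re (a * z))) =
        (CLINT p|?N \<Otimes>\<^sub>M ?N. iexp ((s * Re a) * fst p) * iexp ((- (s * Im a)) * snd p))"
      unfolding cgauss_measure_def s_def[symmetric]
      by (subst integral_distr) (auto simp: exp_add[symmetric] algebra_simps intro!: Bochner_Integration.integral_cong)
    also have "\<dots> = char ?N (s * Re a) * char ?N (- (s * Im a))"
      unfolding char_def by (rule integral_pair_mult_bounded) (auto simp: prob_space_std_normal)
    also have "\<dots> = complex_of_real (exp (- (V * (cmod a)\<^sup>2 / 4)))"
      unfolding char_std_normal_distribution
      by (simp add: exp_add[symmetric] of_real_mult[symmetric] power_mult_distrib s2 cmod_power2 field_simps del: of_real_mult)
    finally show ?thesis .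
  qed
  then show ?thesis using assms by (simp add: cgauss_def)
qed

lemma cgauss_law:
  assumes "prob_space M" "cgauss M Z V"
  shows "distr M borel Z = cgauss_measure V"
proof -
  interpret M: prob_space M by fact
  interpret G: prob_space "cgauss_measure V" by (rule prob_space_cgauss_measure)
  have "distr M borel Z = distr (cgauss_measure V) borel (\<lambda>z. z)"
    using assms(2) cgauss_cgauss_measure[of V]
    by (intro complex_char_law_eq_single) (auto simp: cgauss_def M.finite_measure_axioms G.finite_measure_axioms)
  also have "\<dots> = cgauss_measure V" by (rule distr_id2) simp
  finally show ?thesis .
qed

lemma real_gauss_law:
  assumes "prob_space M" and [measurable]: "X \<in> borel_measurable M" and "0 \<le> v"
    and ch: "\<And>t. (CLINT x|M. iexp (t * X x)) = complex_of_real (exp (- (v * t\<^sup>2 / 2)))"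
  shows "distr M borel X = distr std_normal_distribution borel (\<lambda>x. sqrt v * x)"
proof (rule Levy_uniqueness)
  interpret M: prob_space M by fact
  interpret N: prob_space std_normal_distribution by (rule prob_space_std_normal)
  show "real_distribution (distr M borel X)" "real_distribution (distr std_normal_distribution borel (\<lambda>x. sqrt v * x))"
    by (auto simp: real_distribution_def real_distribution_axioms_def intro!: M.prob_space_distr N.prob_space_distr)
  show "char (distr M borel X) = char (distr std_normal_distribution borel (\<lambda>x. sqrt v * x))"
  proof
    fix t
    have "char (distr std_normal_distribution borel (\<lambda>x. sqrt v * x)) t = char std_normal_distribution (t * sqrt v)"
      unfolding char_def by (subst integral_distr) (auto simp: mult.assoc)
    also have "\<dots> = complex_of_real (exp (- (v * t\<^sup>2 / 2)))"
      using assms(3) by (simp add: char_std_normal_distribution power_mult_distrib mult.commute)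
    also have "\<dots> = char (distr M borel X) t"
      unfolding char_def by (subst integral_distr) (simp_all add: ch del: of_real_mult)
    finally show "char (distr M borel X) t = char (distr std_normal_distribution borel (\<lambda>x. sqrt v * x)) t" ..
  qed
qed

lemma real_gauss_moments:
  assumes "prob_space M" and [measurable]: "X \<in> borel_measurable M" and "0 \<le> v"
    and ch: "\<And>t. (CLINT x|M. iexp (t * X x)) = complex_of_real (exp (- (v * t\<^sup>2 / 2)))"
  shows "integrable M (\<lambda>x. X x ^ 2)" "(LINT x|M. X x ^ 2) = v"
        "integrable M (\<lambda>x. X x ^ 4)" "(LINT x|M. X x ^ 4) = 3 * v\<^sup>2"
proof -
  note law = real_gauss_law[OF assms]
  have i: "integrable M (\<lambda>x. X x ^ k)" for k
  proof -
    have "integrable (distr M borel X) (\<lambda>x. x ^ k)"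
      unfolding law by (subst integrable_distr_eq) (auto simp: power_mult_distrib intro: integrable_std_normal_distribution_moment)
    then show ?thesis by (subst (asm) integrable_distr_eq) auto
  qed
  have e: "(LINT x|M. X x ^ k) = sqrt v ^ k * (LINT x|std_normal_distribution. x ^ k)" for k
  proof -
    have "(LINT x|M. X x ^ k) = (LINT x|distr M borel X. x ^ k)" by (subst integral_distr) auto
    also have "\<dots> = sqrt v ^ k * (LINT x|std_normal_distribution. x ^ k)"
      unfolding law by (subst integral_distr) (auto simp: power_mult_distrib)
    finally show ?thesis .
  qed
  have 4: "sqrt v ^ 4 = v\<^sup>2" using assms(3) by (metis mult_2 numeral_Bit0 power_add power2_eq_square real_sqrt_pow2)
  show "integrable M (\<lambda>x. X x ^ 2)" "integrable M (\<lambda>x. X x ^ 4)" by (rule i)+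
  show "(LINT x|M. X x ^ 2) = v"
    using e[of 2] std_normal_distribution_even_moments(1)[of 1] assms(3) by simp
  show "(LINT x|M. X x ^ 4) = 3 * v\<^sup>2"
    using e[of 4] std_normal_distribution_even_moments(1)[of 2] 4 by (simp add: fact_numeral)
qed

lemma cgauss_real_part_char:
  assumes "cgauss M Z V"
  shows "(CLINT x|M. iexp (t * Re (a * Z x))) = complex_of_real (exp (- ((V * (cmod a)\<^sup>2 / 2) * t\<^sup>2 / 2)))"
proof -
  have "(CLINT x|M. iexp (Re ((complex_of_real t * a) * Z x))) = complex_of_real (exp (- (V * (cmod (complex_of_real t * a))\<^sup>2 / 4)))"
    using assms unfolding cgauss_def by blast
  moreover have "Re ((complex_of_real t * a) * z) = t * Re (a * z)" for z by (simp add: algebra_simps)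
  ultimately show ?thesis by (simp add: norm_mult power_mult_distrib field_simps del: of_real_mult)
qed

text \<open>Fourth powers of projections onto four directions spaced by 45 degrees average to a
  rotation-invariant quantity; the fourth powers of the cosines add up to 3/2, hence the factor 2/3.
  The weights 1/4 compensate the fourth power of the modulus of \<open>1 + \<i>\<close> and
  \<open>1 - \<i>\<close>. The fourth moment of a modulus thus reduces to real Gaussians, one
  direction at a time.\<close>

lemma cmod_power4_decomp:
  fixes z :: complex
  shows "cmod z ^ 4 = (2/3) * (Re (1 * z) ^ 4 + Re (\<i> * z) ^ 4 + (1/4) * Re ((1 + \<i>) * z) ^ 4 + (1/4) * Re ((1 - \<i>) * z) ^ 4)"
proof -
  have *: "cmod z ^ 4 = ((Re z)\<^sup>2 + (Im z)\<^sup>2)\<^sup>2" by (simp flip: cmod_power2 power_mult)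
  show ?thesis unfolding * by (simp add: power4_eq_xxxx power2_eq_square field_simps)
qed

lemma cgauss_moments:
  assumes "prob_space M" "cgauss M Z V"
  shows "integrable M (\<lambda>x. (cmod (Z x))\<^sup>2)" "(LINT x|M. (cmod (Z x))\<^sup>2) = V"
        "integrable M (\<lambda>x. cmod (Z x) ^ 4)" "(LINT x|M. cmod (Z x) ^ 4) = 2 * V\<^sup>2"
proof -
  have [measurable]: "Z \<in> borel_measurable M" and V: "0 \<le> V" using assms(2) by (auto simp: cgauss_def)
  note m = real_gauss_moments[OF assms(1) _ _ cgauss_real_part_char[OF assms(2)]]
  have i2: "integrable M (\<lambda>x. Re (a * Z x) ^ 2)" and e2: "(LINT x|M. Re (a * Z x) ^ 2) = V * (cmod a)\<^sup>2 / 2"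
   and i4: "integrable M (\<lambda>x. Re (a * Z x) ^ 4)" and e4: "(LINT x|M. Re (a * Z x) ^ 4) = 3 * (V * (cmod a)\<^sup>2 / 2)\<^sup>2" for a
    using m[of a] V by auto
  have sq: "(cmod z)\<^sup>2 = (Re (1 * z))\<^sup>2 + (Re (\<i> * z))\<^sup>2" for z by (simp add: cmod_power2)
  show "integrable M (\<lambda>x. (cmod (Z x))\<^sup>2)" unfolding sq by (intro Bochner_Integration.integrable_add i2)
  show "(LINT x|M. (cmod (Z x))\<^sup>2) = V"
    unfolding sq by (subst Bochner_Integration.integral_add[OF i2 i2]) (simp only: e2, simp)
  have c: "(cmod (1 + \<i>))\<^sup>2 = 2" "(cmod (1 - \<i>))\<^sup>2 = 2" by (simp_all add: cmod_power2)
  show "integrable M (\<lambda>x. cmod (Z x) ^ 4)"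
    unfolding cmod_power4_decomp by (intro integrable_mult_right Bochner_Integration.integrable_add i4)
  show "(LINT x|M. cmod (Z x) ^ 4) = 2 * V\<^sup>2"
    unfolding cmod_power4_decomp integral_mult_right_zero
    by (simp only: Bochner_Integration.integral_add Bochner_Integration.integrable_add integrable_mult_right i4 integral_mult_right_zero e4 c)
       (simp add: power2_eq_square)
qed

lemma cgauss_scale:
  assumes "cgauss M Z V" shows "cgauss M (\<lambda>x. c * Z x) ((cmod c)\<^sup>2 * V)"
proof -
  have [measurable]: "Z \<in> borel_measurable M" and V: "0 \<le> V" using assms by (auto simp: cgauss_def)
  have "(CLINT x|M. iexp (Re (a * (c * Z x)))) = complex_of_real (exp (- (V * (cmod (a * c))\<^sup>2 / 4)))" for a
    using assms unfolding cgauss_def mult.assoc[symmetric] by blast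
  then show ?thesis using V unfolding cgauss_def by (simp add: norm_mult power_mult_distrib mult_ac)
qed

text \<open>A real projection of nondegenerate noise is Gaussian with a density, so every line is a
  null set. This disposes of ties between symbols and of the real axis in the PSK
  computation.\<close>

lemma cgauss_line_null:
  assumes "0 < V" "a \<noteq> 0"
  shows "AE z in cgauss_measure V. Re (a * z) \<noteq> c"
proof -
  let ?N = std_normal_distribution
  let ?v = "V * (cmod a)\<^sup>2 / 2"
  have v: "?v > 0" using assms by simp
  have law: "distr (cgauss_measure V) borel (\<lambda>z. Re (a * z)) = distr ?N borel (\<lambda>x. sqrt ?v * x)"
    using cgauss_real_part_char[OF cgauss_cgauss_measure[of V]] assms
    by (intro real_gauss_law prob_space_cgauss_measure) auto
  have "AE x in ?N. x \<noteq> c / sqrt ?v"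
    by (subst AE_density) (use AE_lborel_singleton[of "c / sqrt ?v"] in auto)
  then have "AE x in ?N. sqrt ?v * x \<noteq> c"
  proof (rule AE_mp, intro AE_I2 impI notI)
    fix x assume "x \<noteq> c / sqrt ?v" "sqrt ?v * x = c"
    then show False using v by (metis nonzero_mult_div_cancel_left real_sqrt_eq_zero_cancel_iff less_irrefl)
  qed
  then have "AE x in distr ?N borel (\<lambda>x. sqrt ?v * x). x \<noteq> c"
    by (subst AE_distr_iff) auto
  then have "AE x in distr (cgauss_measure V) borel (\<lambda>z. Re (a * z)). x \<noteq> c" unfolding law .
  then show ?thesis by (subst (asm) AE_distr_iff) auto
qed

section \<open>Gaussian vectors and independence\<close>

lemma borel_measurable_cnj [measurable]: "cnj \<in> borel_measurable borel"
  by (intro borel_measurable_continuous_onI continuous_intros)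

lemma space_vec_borel [simp]: "space (vec_borel n) = carrier_vec n"
  by (simp add: vec_borel_def)

lemma space_mat_borel [simp]: "space (mat_borel nr nc) = carrier_mat nr nc"
  by (simp add: mat_borel_def)

lemma measurable_vec_index [measurable]: "i < n \<Longrightarrow> (\<lambda>v. v $ i) \<in> borel_measurable (vec_borel n)"
proof -
  assume i: "i < n"
  have "(\<lambda>v. \<lambda>i\<in>{..<n}. v $ i) \<in> measurable (vec_borel n) (Pi\<^sub>M {..<n} (\<lambda>_. borel))"
    unfolding vec_borel_def by (rule measurable_vimage_algebra1) (auto simp: space_PiM)
  from measurable_compose[OF this measurable_component_singleton[of i "{..<n}" "\<lambda>_. borel"]] i
  show ?thesis by simp
qed

lemma measurable_mat_index [measurable]:
  "i < nr \<Longrightarrow> j < nc \<Longrightarrow> (\<lambda>A. A $$ (i, j)) \<in> borel_measurable (mat_borel nr nc)"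
proof -
  assume i: "i < nr" "j < nc"
  have "(\<lambda>A. \<lambda>ij\<in>{..<nr} \<times> {..<nc}. A $$ ij) \<in> measurable (mat_borel nr nc) (Pi\<^sub>M ({..<nr} \<times> {..<nc}) (\<lambda>_. borel))"
    unfolding mat_borel_def by (rule measurable_vimage_algebra1) (auto simp: space_PiM)
  from measurable_compose[OF this measurable_component_singleton[of "(i, j)" "{..<nr} \<times> {..<nc}" "\<lambda>_. borel"]] i
  show ?thesis by simp
qed

lemma measurable_vec_borelI:
  assumes "\<And>x. x \<in> space M \<Longrightarrow> X x \<in> carrier_vec n" "\<And>i. i < n \<Longrightarrow> (\<lambda>x. X x $ i) \<in> borel_measurable M"
  shows "X \<in> measurable M (vec_borel n)"
  unfolding vec_borel_def
  by (rule measurable_vimage_algebra2) (use assms in \<open>auto intro!: measurable_restrict\<close>)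

text \<open>In the degenerate case a zero mean forces the constant to be 0, so the same formula
  holds with variance 0 and no case distinction is left for later.\<close>

lemma real_gaussian_centered:
  assumes "prob_space M" and X [measurable]: "X \<in> borel_measurable M" and g: "real_gaussian M X"
  shows "integrable M X" "integrable M (\<lambda>x. (X x)\<^sup>2)"
    and "(LINT x|M. X x) = 0 \<Longrightarrow>
      (CLINT x|M. iexp (t * X x)) = complex_of_real (exp (- ((LINT x|M. (X x)\<^sup>2) * t\<^sup>2 / 2)))"
proof -
  interpret prob_space M by fact
  have "integrable M X \<and> integrable M (\<lambda>x. (X x)\<^sup>2) \<and> ((LINT x|M. X x) = 0 \<longrightarrow>
      (CLINT x|M. iexp (t * X x)) = complex_of_real (exp (- ((LINT x|M. (X x)\<^sup>2) * t\<^sup>2 / 2))))"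
    using g unfolding real_gaussian_def
  proof (elim disjE exE conjE)
    fix \<mu> \<tau> :: real assume \<tau>: "0 < \<tau>" and D: "distributed M lborel X (normal_density \<mu> \<tau>)"
    define Y where "Y = (\<lambda>x. (X x - \<mu>) / \<tau>)"
    have [measurable]: "Y \<in> borel_measurable M" by (simp add: Y_def)
    have DY: "distributed M lborel Y std_normal_density"
      using D unfolding normal_standard_normal_convert[OF \<tau>] Y_def .
    have law: "distr M borel Y = std_normal_distribution"
    proof -
      have "distr M borel Y = distr M lborel Y" by (rule distr_cong) simp_all
      then show ?thesis using distributed_distr_eq_density[OF DY] by simp
    qed
    have iY: "integrable M (\<lambda>x. Y x ^ k)" for k
    proof -
      have "integrable (distr M borel Y) (\<lambda>y. y ^ k)"
        unfolding law by (rule integrable_std_normal_distribution_moment)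
      then show ?thesis by (subst (asm) integrable_distr_eq) auto
    qed
    have XY: "X x = \<mu> + \<tau> * Y x" for x using \<tau> by (simp add: Y_def)
    have iX: "integrable M X" unfolding XY[abs_def] using iY[of 1] by auto
    have iX2: "integrable M (\<lambda>x. (X x)\<^sup>2)"
      unfolding XY[abs_def] power2_sum using iY[of 1] iY[of 2] by (auto simp: power_mult_distrib)
    have "(CLINT x|M. iexp (t * X x)) = complex_of_real (exp (- ((LINT x|M. (X x)\<^sup>2) * t\<^sup>2 / 2)))"
      if "(LINT x|M. X x) = 0"
    proof -
      have \<mu>: "\<mu> = 0" using that normal_distributed_expectation[OF \<tau> D] by simp
      have v: "(LINT x|M. (X x)\<^sup>2) = \<tau>\<^sup>2"
        using normal_distributed_variance[OF \<tau> D] that by simp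
      have "(CLINT x|M. iexp (t * X x)) = (CLINT x|M. iexp ((t * \<tau>) * Y x))"
        by (rule Bochner_Integration.integral_cong) (simp_all add: XY \<mu> mult.assoc)
      also have "\<dots> = char (distr M borel Y) (t * \<tau>)"
        unfolding char_def by (subst integral_distr) auto
      also have "\<dots> = complex_of_real (exp (- ((LINT x|M. (X x)\<^sup>2) * t\<^sup>2 / 2)))"
        unfolding law char_std_normal_distribution v by (simp add: power_mult_distrib mult.commute)
      finally show ?thesis .
    qed
    with iX iX2 show ?thesis by blast
  next
    fix c assume c: "AE x in M. X x = c"
    have "integrable M X" by (subst integrable_cong_AE[where g="\<lambda>_. c"]) (use c in auto)
    moreover have "integrable M (\<lambda>x. (X x)\<^sup>2)"
      by (subst integrable_cong_AE[where g="\<lambda>_. c\<^sup>2"]) (use c in auto)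
    moreover have "(LINT x|M. X x) = (LINT x|M. c)"
      by (rule integral_cong_AE) (use c in auto)
    moreover have "(LINT x|M. (X x)\<^sup>2) = (LINT x|M. c\<^sup>2)"
      by (rule integral_cong_AE) (use c in auto)
    moreover have "(CLINT x|M. iexp (t * X x)) = (CLINT x|M. iexp (t * c))"
      by (rule integral_cong_AE) (use c in auto)
    ultimately show ?thesis by (simp add: prob_space)
  qed
  then show "integrable M X" "integrable M (\<lambda>x. (X x)\<^sup>2)"
    and "(LINT x|M. X x) = 0 \<Longrightarrow>
      (CLINT x|M. iexp (t * X x)) = complex_of_real (exp (- ((LINT x|M. (X x)\<^sup>2) * t\<^sup>2 / 2)))" by blast+
qed

text \<open>Rotation invariance makes the mean of the square of a combination vanish, so its real
  part carries exactly half of the second absolute moment. Multiplying the coefficients by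
  \<open>z\<close> extends this to every direction, which is the transform required by
  \<open>cgauss\<close>.\<close>

lemma circular_gaussian_cgauss:
  assumes "prob_space M" and X: "circular_gaussian M n X"
  shows "cgauss M (\<lambda>\<omega>. \<Sum>i<n. a i * X \<omega> $ i) (LINT \<omega>|M. (cmod (\<Sum>i<n. a i * X \<omega> $ i))\<^sup>2)"
proof -
  interpret prob_space M by fact
  have meas [measurable]: "X \<in> measurable M (vec_borel n)"
    and gauss: "\<And>a. a \<in> carrier_vec n \<Longrightarrow> real_gaussian M (\<lambda>\<omega>. Re (a \<bullet> X \<omega>))"
    and mean: "\<And>i. i < n \<Longrightarrow> (CLINT \<omega>|M. X \<omega> $ i) = 0"
    and rot: "\<And>\<phi>. distr M (vec_borel n) (\<lambda>\<omega>. cis \<phi> \<cdot>\<^sub>v X \<omega>) = distr M (vec_borel n) X"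
    using X by (auto simp: circular_gaussian_def)
  have carr: "\<omega> \<in> space M \<Longrightarrow> X \<omega> \<in> carrier_vec n" for \<omega>
    using measurable_space[OF meas] by simp
  have [measurable]: "(\<lambda>\<omega>. X \<omega> $ i) \<in> borel_measurable M" if "i < n" for i
    using measurable_compose[OF meas measurable_vec_index[OF that]] .
  let ?Z = "\<lambda>b \<omega>. \<Sum>i<n. b i * X \<omega> $ i"
  have Zm [measurable]: "?Z b \<in> borel_measurable M" for b by measurable
  have g: "real_gaussian M (\<lambda>\<omega>. Re (?Z b \<omega>))" for b
  proof -
    have e: "vec n b \<bullet> X \<omega> = ?Z b \<omega>" if "\<omega> \<in> space M" for \<omega>
      using carrier_vecD[OF carr[OF that]] by (simp add: scalar_prod_def atLeast0LessThan)
    have *: "(AE \<omega> in M. Re (vec n b \<bullet> X \<omega>) = c) \<longleftrightarrow> (AE \<omega> in M. Re (?Z b \<omega>) = c)" for c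
      by (intro AE_cong) (simp only: e)
    have **: "distr M lborel (\<lambda>\<omega>. Re (vec n b \<bullet> X \<omega>)) = distr M lborel (\<lambda>\<omega>. Re (?Z b \<omega>))"
      by (intro distr_cong) (simp_all only: e)
    have ***: "(\<lambda>\<omega>. Re (vec n b \<bullet> X \<omega>)) \<in> borel_measurable M \<longleftrightarrow> (\<lambda>\<omega>. Re (?Z b \<omega>)) \<in> borel_measurable M"
      by (intro measurable_cong) (simp_all only: e)
    show ?thesis using gauss[of "vec n b"] unfolding real_gaussian_def distributed_def * ** by (simp add: ***)
  qed
  note rg = real_gaussian_centered[OF assms(1) _ g]
  \<comment> \<open>The imaginary part is the real part of the combination with coefficients
    \<open>- \<i> * b i\<close>, so the hypothesis on real parts covers it.\<close>
  have iZ: "integrable M (?Z b)" for b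
  proof -
    have "integrable M (\<lambda>\<omega>. Re (?Z b \<omega>))" "integrable M (\<lambda>\<omega>. Re (?Z (\<lambda>i. - \<i> * b i) \<omega>))"
      by (rule rg(1); measurable)+
    moreover have "Re (?Z (\<lambda>i. - \<i> * b i) \<omega>) = Im (?Z b \<omega>)" for \<omega> by simp
    ultimately have "integrable M (\<lambda>\<omega>. complex_of_real (Re (?Z b \<omega>)) + \<i> * complex_of_real (Im (?Z b \<omega>)))"
      by (simp only:) (intro Bochner_Integration.integrable_add integrable_mult_right integrable_of_real)
    then show ?thesis by (simp only: complex_eq[symmetric])
  qed
  have iX: "integrable M (\<lambda>\<omega>. X \<omega> $ i)" if "i < n" for i
  proof -
    have "(\<Sum>j<n. (if j = i then 1 else 0) * X \<omega> $ j) = (\<Sum>j<n. if j = i then X \<omega> $ j else 0)" for \<omega>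
      by (intro sum.cong) auto
    then show ?thesis using iZ[of "\<lambda>j. if j = i then 1 else 0"] that by simp
  qed
  have m0: "(LINT \<omega>|M. Re (?Z b \<omega>)) = 0" for b
  proof -
    have "(LINT \<omega>|M. Re (?Z b \<omega>)) = Re (CLINT \<omega>|M. ?Z b \<omega>)" by (rule integral_Re[OF iZ])
    also have "(CLINT \<omega>|M. ?Z b \<omega>) = (\<Sum>i<n. b i * (CLINT \<omega>|M. X \<omega> $ i))"
      using iX by (subst Bochner_Integration.integral_sum) auto
    also have "\<dots> = 0" using mean by simp
    finally show ?thesis by simp
  qed
  have sqZ: "integrable M (\<lambda>\<omega>. (cmod (?Z b \<omega>))\<^sup>2)" for b
  proof -
    have "integrable M (\<lambda>\<omega>. (Re (?Z b \<omega>))\<^sup>2)" "integrable M (\<lambda>\<omega>. (Re (?Z (\<lambda>i. - \<i> * b i) \<omega>))\<^sup>2)"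
      by (rule rg(2); measurable)+
    moreover have "Re (?Z (\<lambda>i. - \<i> * b i) \<omega>) = Im (?Z b \<omega>)" for \<omega> by simp
    ultimately show ?thesis unfolding cmod_power2 by (intro Bochner_Integration.integrable_add) simp_all
  qed
  have isq: "integrable M (\<lambda>\<omega>. (?Z b \<omega>)\<^sup>2)" for b
    by (rule Bochner_Integration.integrable_bound[OF sqZ[of b]]) (auto simp: norm_power)
  \<comment> \<open>A quarter turn multiplies the combination by \<open>\<i>\<close> and changes the
    sign of its square, while the law stays the same.\<close>
  have zero: "(CLINT \<omega>|M. (?Z b \<omega>)\<^sup>2) = 0" for b
  proof -
    let ?f = "\<lambda>v. (\<Sum>i<n. b i * v $ i)\<^sup>2"
    have rm: "(\<lambda>\<omega>. cis (pi/2) \<cdot>\<^sub>v X \<omega>) \<in> measurable M (vec_borel n)"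
    proof (rule measurable_vec_borelI)
      show "(\<lambda>\<omega>. (cis (pi/2) \<cdot>\<^sub>v X \<omega>) $ i) \<in> borel_measurable M" if "i < n" for i
      proof (subst measurable_cong)
        show "(cis (pi/2) \<cdot>\<^sub>v X \<omega>) $ i = cis (pi/2) * X \<omega> $ i" if "\<omega> \<in> space M" for \<omega>
          using carr[OF that] \<open>i < n\<close> by simp
        show "(\<lambda>\<omega>. cis (pi/2) * X \<omega> $ i) \<in> borel_measurable M" using that by measurable
      qed
    qed (use carr in auto)
    have "(CLINT \<omega>|M. (?Z b \<omega>)\<^sup>2) = (CLINT v|distr M (vec_borel n) X. ?f v)"
      by (subst integral_distr) auto
    also have "\<dots> = (CLINT v|distr M (vec_borel n) (\<lambda>\<omega>. cis (pi/2) \<cdot>\<^sub>v X \<omega>). ?f v)" unfolding rot ..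
    also have "\<dots> = (CLINT \<omega>|M. ?f (cis (pi/2) \<cdot>\<^sub>v X \<omega>))" by (subst integral_distr[OF rm]) auto
    also have "\<dots> = (CLINT \<omega>|M. - (?Z b \<omega>)\<^sup>2)"
    proof (rule Bochner_Integration.integral_cong[OF refl])
      fix \<omega> assume "\<omega> \<in> space M"
      then have "(\<Sum>i<n. b i * (cis (pi/2) \<cdot>\<^sub>v X \<omega>) $ i) = \<i> * ?Z b \<omega>"
        using carr[of \<omega>] by (auto simp: sum_distrib_left intro!: sum.cong)
      then show "?f (cis (pi/2) \<cdot>\<^sub>v X \<omega>) = - (?Z b \<omega>)\<^sup>2" by (simp add: power_mult_distrib)
    qed
    also have "\<dots> = - (CLINT \<omega>|M. (?Z b \<omega>)\<^sup>2)" by simp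
    finally show ?thesis by simp
  qed
  have half: "(LINT \<omega>|M. (Re (?Z b \<omega>))\<^sup>2) = (LINT \<omega>|M. (cmod (?Z b \<omega>))\<^sup>2) / 2" for b
  proof -
    have "(Re z)\<^sup>2 = (cmod z)\<^sup>2 / 2 + Re (z\<^sup>2) / 2" for z
      by (simp add: cmod_power2 power2_eq_square[of z] field_simps) (simp add: power2_eq_square)
    then have "(LINT \<omega>|M. (Re (?Z b \<omega>))\<^sup>2) = (LINT \<omega>|M. (cmod (?Z b \<omega>))\<^sup>2 / 2 + Re ((?Z b \<omega>)\<^sup>2) / 2)" by presburger
    also have "\<dots> = (LINT \<omega>|M. (cmod (?Z b \<omega>))\<^sup>2) / 2 + Re (CLINT \<omega>|M. (?Z b \<omega>)\<^sup>2) / 2"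
      using sqZ[of b] isq[of b] by (subst Bochner_Integration.integral_add) (auto simp: integrable_Re)
    finally show ?thesis unfolding zero by simp
  qed
  have "(CLINT \<omega>|M. iexp (Re (z * ?Z a \<omega>))) = complex_of_real (exp (- ((LINT \<omega>|M. (cmod (?Z a \<omega>))\<^sup>2) * (cmod z)\<^sup>2 / 4)))" for z
  proof -
    have zZ: "z * ?Z a \<omega> = ?Z (\<lambda>i. z * a i) \<omega>" for \<omega> by (simp add: sum_distrib_left mult.assoc)
    have "(CLINT \<omega>|M. iexp (Re (z * ?Z a \<omega>))) = (CLINT \<omega>|M. iexp (1 * Re (?Z (\<lambda>i. z * a i) \<omega>)))"
      unfolding zZ by simp
    also have "\<dots> = complex_of_real (exp (- ((LINT \<omega>|M. (Re (?Z (\<lambda>i. z * a i) \<omega>))\<^sup>2) * 1\<^sup>2 / 2)))"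
      by (rule rg(3)[OF _ m0]) measurable
    also have "(LINT \<omega>|M. (Re (?Z (\<lambda>i. z * a i) \<omega>))\<^sup>2) = (LINT \<omega>|M. (cmod (z * ?Z a \<omega>))\<^sup>2) / 2"
      unfolding half zZ ..
    also have "(LINT \<omega>|M. (cmod (z * ?Z a \<omega>))\<^sup>2) = (cmod z)\<^sup>2 * (LINT \<omega>|M. (cmod (?Z a \<omega>))\<^sup>2)"
      by (simp add: norm_mult power_mult_distrib)
    finally show ?thesis by (simp add: mult.commute)
  qed
  then show ?thesis unfolding cgauss_def by (auto intro!: integral_nonneg_AE)
qed

lemma second_moment_expand:
  fixes X :: "nat \<Rightarrow> 'a \<Rightarrow> complex"
  assumes [measurable]: "\<And>i. i < n \<Longrightarrow> X i \<in> borel_measurable M"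
    and sq: "\<And>i. i < n \<Longrightarrow> integrable M (\<lambda>\<omega>. (cmod (X i \<omega>))\<^sup>2)"
  shows "complex_of_real (LINT \<omega>|M. (cmod (\<Sum>i<n. a i * X i \<omega>))\<^sup>2) =
    (\<Sum>i<n. \<Sum>j<n. cnj (a i) * a j * (CLINT \<omega>|M. cnj (X i \<omega>) * X j \<omega>))"
proof -
  have i: "integrable M (\<lambda>\<omega>. cnj (X i \<omega>) * X j \<omega>)" if "i < n" "j < n" for i j
  proof (rule Bochner_Integration.integrable_bound)
    show "integrable M (\<lambda>\<omega>. (cmod (X i \<omega>))\<^sup>2 + (cmod (X j \<omega>))\<^sup>2)" using sq that by simp
    have "x * y \<le> x\<^sup>2 + y\<^sup>2" if "0 \<le> x" "0 \<le> y" for x y :: real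
      using sum_squares_bound[of x y] that mult_nonneg_nonneg[of x y] by linarith
    then show "AE \<omega> in M. norm (cnj (X i \<omega>) * X j \<omega>) \<le> norm ((cmod (X i \<omega>))\<^sup>2 + (cmod (X j \<omega>))\<^sup>2)"
      by (auto simp: norm_mult)
    show "(\<lambda>\<omega>. cnj (X i \<omega>) * X j \<omega>) \<in> borel_measurable M" using that by measurable
  qed
  have e: "complex_of_real ((cmod (\<Sum>i<n. a i * X i \<omega>))\<^sup>2) = (\<Sum>i<n. \<Sum>j<n. cnj (a i) * a j * (cnj (X i \<omega>) * X j \<omega>))" for \<omega>
  proof -
    have "complex_of_real ((cmod z)\<^sup>2) = cnj z * z" for z by (metis complex_norm_square mult.commute)
    then have "complex_of_real ((cmod (\<Sum>i<n. a i * X i \<omega>))\<^sup>2) = (\<Sum>i<n. cnj (a i * X i \<omega>)) * (\<Sum>i<n. a i * X i \<omega>)"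
      by (simp only: cnj_sum)
    also have "\<dots> = (\<Sum>i<n. \<Sum>j<n. cnj (a i) * a j * (cnj (X i \<omega>) * X j \<omega>))"
      unfolding sum_product by (simp add: mult_ac)
    finally show ?thesis .
  qed
  have "complex_of_real (LINT \<omega>|M. (cmod (\<Sum>i<n. a i * X i \<omega>))\<^sup>2) = (CLINT \<omega>|M. complex_of_real ((cmod (\<Sum>i<n. a i * X i \<omega>))\<^sup>2))"
    by (rule integral_complex_of_real[symmetric])
  also have "\<dots> = (\<Sum>i<n. \<Sum>j<n. cnj (a i) * a j * (CLINT \<omega>|M. cnj (X i \<omega>) * X j \<omega>))"
  proof -
    have "(CLINT \<omega>|M. \<Sum>j<n. cnj (a k) * a j * (cnj (X k \<omega>) * X j \<omega>)) = (\<Sum>j<n. CLINT \<omega>|M. cnj (a k) * a j * (cnj (X k \<omega>) * X j \<omega>))" if "k < n" for k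
      by (rule Bochner_Integration.integral_sum) (use that in \<open>auto intro!: i integrable_mult_right\<close>)
    moreover have "(CLINT \<omega>|M. \<Sum>i<n. \<Sum>j<n. cnj (a i) * a j * (cnj (X i \<omega>) * X j \<omega>)) = (\<Sum>i<n. CLINT \<omega>|M. \<Sum>j<n. cnj (a i) * a j * (cnj (X i \<omega>) * X j \<omega>))"
      by (rule Bochner_Integration.integral_sum) (auto intro!: i integrable_mult_right Bochner_Integration.integrable_sum)
    ultimately show ?thesis unfolding e by simp
  qed
  finally show ?thesis .
qed

text \<open>A factorising transform is that of two independent copies of the sample, one supplying
  the coordinates in \<open>K\<close> and the other supplying the rest; uniqueness then identifies
  the laws.\<close>

lemma independent_split_law:
  fixes V :: "'i \<Rightarrow> 'a \<Rightarrow> complex"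
  assumes "prob_space M" and I: "finite I" "K \<subseteq> I" and [measurable]: "\<And>i. i \<in> I \<Longrightarrow> V i \<in> borel_measurable M"
    and ch: "\<And>a. (CLINT x|M. iexp (Re (\<Sum>i\<in>I. a i * V i x))) =
      (CLINT x|M. iexp (Re (\<Sum>i\<in>K. a i * V i x))) * (CLINT x|M. iexp (Re (\<Sum>i\<in>I - K. a i * V i x)))"
  shows "distr M (Pi\<^sub>M I (\<lambda>_. borel)) (\<lambda>x. \<lambda>i\<in>I. V i x) =
    distr (M \<Otimes>\<^sub>M M) (Pi\<^sub>M I (\<lambda>_. borel)) (\<lambda>p. \<lambda>i\<in>I. if i \<in> K then V i (fst p) else V i (snd p))"
proof (rule complex_char_law_eq)
  interpret prob_space M by fact
  interpret P: pair_prob_space M M ..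
  show "finite_measure M" "finite_measure (M \<Otimes>\<^sub>M M)" by unfold_locales
  have [measurable]: "\<And>i. i \<in> K \<Longrightarrow> V i \<in> borel_measurable M" using I assms(4) by blast
  show "(\<lambda>p. if i \<in> K then V i (fst p) else V i (snd p)) \<in> borel_measurable (M \<Otimes>\<^sub>M M)" if "i \<in> I" for i
    using that by (cases "i \<in> K") auto
  fix a :: "'i \<Rightarrow> complex"
  let ?f = "\<lambda>x. iexp (Re (\<Sum>i\<in>K. a i * V i x))" and ?g = "\<lambda>x. iexp (Re (\<Sum>i\<in>I - K. a i * V i x))"
  have s: "(\<Sum>i\<in>I. a i * (if i \<in> K then V i x else V i y)) = (\<Sum>i\<in>K. a i * V i x) + (\<Sum>i\<in>I - K. a i * V i y)" for x y
  proof -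
    have "(\<Sum>i\<in>I. a i * (if i \<in> K then V i x else V i y)) = (\<Sum>i\<in>K. a i * (if i \<in> K then V i x else V i y)) + (\<Sum>i\<in>I - K. a i * (if i \<in> K then V i x else V i y))"
      using I by (simp add: sum.subset_diff add.commute)
    also have "\<dots> = (\<Sum>i\<in>K. a i * V i x) + (\<Sum>i\<in>I - K. a i * V i y)"
      by (intro arg_cong2[where f="(+)"] sum.cong) auto
    finally show ?thesis .
  qed
  have "(CLINT p|(M \<Otimes>\<^sub>M M). iexp (Re (\<Sum>i\<in>I. a i * (if i \<in> K then V i (fst p) else V i (snd p))))) =
    (CLINT p|(M \<Otimes>\<^sub>M M). ?f (fst p) * ?g (snd p))"
    unfolding s by (simp add: exp_add[symmetric] distrib_left)
  also have "\<dots> = (CLINT x|M. ?f x) * (CLINT x|M. ?g x)"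
    by (rule integral_pair_mult_bounded) (auto simp: assms(1))
  finally show "(CLINT x|M. iexp (Re (\<Sum>i\<in>I. a i * V i x))) =
      (CLINT p|(M \<Otimes>\<^sub>M M). iexp (Re (\<Sum>i\<in>I. a i * (if i \<in> K then V i (fst p) else V i (snd p)))))"
    using ch[of a] by simp
qed (use I in simp_all)

text \<open>Fubini on the two copies: the coordinates outside \<open>K\<close> become constants
  taken from one sample point \<open>y\<close>, and a bound uniform in \<open>y\<close> survives the
  integration.\<close>

lemma independent_split_prob_le:
  fixes V :: "'i \<Rightarrow> 'a \<Rightarrow> complex"
  assumes "prob_space M" and I: "finite I" "K \<subseteq> I" and [measurable]: "\<And>i. i \<in> I \<Longrightarrow> V i \<in> borel_measurable M"
    and ch: "\<And>a. (CLINT x|M. iexp (Re (\<Sum>i\<in>I. a i * V i x))) =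
      (CLINT x|M. iexp (Re (\<Sum>i\<in>K. a i * V i x))) * (CLINT x|M. iexp (Re (\<Sum>i\<in>I - K. a i * V i x)))"
    and A [measurable]: "A \<in> sets (Pi\<^sub>M I (\<lambda>_. borel))"
    and le: "\<And>y. y \<in> space M \<Longrightarrow> measure M {x\<in>space M. (\<lambda>i\<in>I. if i \<in> K then V i x else V i y) \<in> A} \<le> c"
  shows "measure M {x\<in>space M. (\<lambda>i\<in>I. V i x) \<in> A} \<le> c"
proof -
  interpret prob_space M by fact
  interpret P: pair_prob_space M M ..
  let ?W = "\<lambda>p. \<lambda>i\<in>I. if i \<in> K then V i (fst p) else V i (snd p)"
  obtain y0 where "y0 \<in> space M" using not_empty by auto
  then have c: "0 \<le> c" using le[of y0] measure_nonneg order_trans by blast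
  have W [measurable]: "?W \<in> measurable (M \<Otimes>\<^sub>M M) (Pi\<^sub>M I (\<lambda>_. borel))"
  proof (rule measurable_restrict)
    show "(\<lambda>p. if i \<in> K then V i (fst p) else V i (snd p)) \<in> borel_measurable (M \<Otimes>\<^sub>M M)" if "i \<in> I" for i
      using that by (cases "i \<in> K") auto
  qed
  have "emeasure M {x\<in>space M. (\<lambda>i\<in>I. V i x) \<in> A} = emeasure (distr M (Pi\<^sub>M I (\<lambda>_. borel)) (\<lambda>x. \<lambda>i\<in>I. V i x)) A"
    by (subst emeasure_distr) (auto intro!: arg_cong[where f="emeasure M"])
  also have "\<dots> = emeasure (distr (M \<Otimes>\<^sub>M M) (Pi\<^sub>M I (\<lambda>_. borel)) ?W) A"
    by (simp only: independent_split_law[OF assms(1-5)])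
  also have "\<dots> = emeasure (M \<Otimes>\<^sub>M M) (?W -` A \<inter> space (M \<Otimes>\<^sub>M M))"
    by (rule emeasure_distr[OF W A])
  also have "\<dots> = (\<integral>\<^sup>+y. emeasure M ((\<lambda>x. (x, y)) -` (?W -` A \<inter> space (M \<Otimes>\<^sub>M M))) \<partial>M)"
    by (rule P.emeasure_pair_measure_alt2) measurable
  also have "\<dots> \<le> (\<integral>\<^sup>+y. ennreal c \<partial>M)"
  proof (rule nn_integral_mono)
    fix y assume y: "y \<in> space M"
    have Wxy: "?W (x, y) = (\<lambda>i\<in>I. if i \<in> K then V i x else V i y)" for x by (simp only: fst_conv snd_conv)
    have "(\<lambda>x. (x, y)) -` (?W -` A \<inter> space (M \<Otimes>\<^sub>M M)) = {x\<in>space M. (\<lambda>i\<in>I. if i \<in> K then V i x else V i y) \<in> A}"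
      unfolding set_eq_iff vimage_eq Int_iff Wxy using y by (auto simp: space_pair_measure)
    then have "emeasure M ((\<lambda>x. (x, y)) -` (?W -` A \<inter> space (M \<Otimes>\<^sub>M M))) =
        ennreal (measure M {x\<in>space M. (\<lambda>i\<in>I. if i \<in> K then V i x else V i y) \<in> A})"
      by (simp only: emeasure_eq_measure)
    also have "\<dots> \<le> ennreal c" by (rule ennreal_leI[OF le[OF y]])
    finally show "emeasure M ((\<lambda>x. (x, y)) -` (?W -` A \<inter> space (M \<Otimes>\<^sub>M M))) \<le> ennreal c" .
  qed
  also have "\<dots> = ennreal c" by (simp add: emeasure_space_1)
  finally show ?thesis using c by (simp add: emeasure_eq_measure)
qed

section \<open>Covariance forms and linear prediction\<close>

definition herm_form :: "nat \<Rightarrow> complex mat \<Rightarrow> (nat \<Rightarrow> complex) \<Rightarrow> (nat \<Rightarrow> complex) \<Rightarrow> complex" where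
  "herm_form n C a b = (\<Sum>i<n. \<Sum>j<n. cnj (a i) * b j * C $$ (i, j))"

lemma herm_form_add_left: "herm_form n C (\<lambda>i. a i + a' i) b = herm_form n C a b + herm_form n C a' b"
  by (simp add: herm_form_def distrib_left distrib_right sum.distrib)

lemma herm_form_add_right: "herm_form n C a (\<lambda>i. b i + b' i) = herm_form n C a b + herm_form n C a b'"
  by (simp add: herm_form_def distrib_left distrib_right sum.distrib)

lemma herm_form_scale_left: "herm_form n C (\<lambda>i. z * a i) b = cnj z * herm_form n C a b"
  by (simp add: herm_form_def sum_distrib_left mult_ac)

lemma herm_form_scale_right: "herm_form n C a (\<lambda>i. z * b i) = z * herm_form n C a b"
  by (simp add: herm_form_def sum_distrib_left mult_ac)

lemma herm_form_cnj:
  assumes "\<And>i j. i < n \<Longrightarrow> j < n \<Longrightarrow> C $$ (i, j) = cnj (C $$ (j, i))"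
  shows "herm_form n C b a = cnj (herm_form n C a b)"
proof -
  have "herm_form n C b a = (\<Sum>j<n. \<Sum>i<n. cnj (b i) * a j * C $$ (i, j))"
    unfolding herm_form_def by (rule sum.swap)
  also have "\<dots> = (\<Sum>j<n. \<Sum>i<n. cnj (cnj (a j) * b i * C $$ (j, i)))"
  proof (intro sum.cong refl)
    fix j i assume "j \<in> {..<n}" "i \<in> {..<n}"
    then have "C $$ (i, j) = cnj (C $$ (j, i))" by (intro assms) auto
    then show "cnj (b i) * a j * C $$ (i, j) = cnj (cnj (a j) * b i * C $$ (j, i))" by (simp only: complex_cnj_mult complex_cnj_cnj mult_ac)
  qed
  finally show ?thesis by (simp add: herm_form_def cnj_sum)
qed

text \<open>The linear prediction of coordinate \<open>k\<close> from the coordinates in \<open>J\<close> with coefficients \<open>c\<close> is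
  optimal with residual variance \<open>\<tau>2\<close> for the covariance matrix \<open>C\<close>.\<close>

definition predictor :: "nat \<Rightarrow> complex mat \<Rightarrow> nat \<Rightarrow> nat set \<Rightarrow> (nat \<Rightarrow> complex) \<Rightarrow> real \<Rightarrow> bool" where
  "predictor n C k J c \<tau>2 \<longleftrightarrow> k < n \<and> J \<subseteq> {..<n} - {k} \<and>
     (\<forall>j\<in>J. C $$ (j, k) = (\<Sum>i\<in>J. c i * C $$ (j, i))) \<and>
     complex_of_real \<tau>2 = C $$ (k, k) - (\<Sum>i\<in>J. c i * C $$ (k, i))"

text \<open>Here \<open>u\<close> holds the coefficients of the prediction residual. The normal
  equations make it orthogonal, in the form given by \<open>C\<close>, to everything supported on
  \<open>J\<close>, and the identity is Pythagoras.\<close>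

lemma predictor_form:
  assumes p: "predictor n C k J c \<tau>2" and h: "\<And>i j. i < n \<Longrightarrow> j < n \<Longrightarrow> C $$ (i, j) = cnj (C $$ (j, i))"
  defines "u \<equiv> \<lambda>i. if i = k then 1 else if i \<in> J then - c i else 0"
  assumes w: "\<And>i. i \<notin> J \<Longrightarrow> w i = 0"
  shows "herm_form n C (\<lambda>i. \<alpha> * u i + w i) (\<lambda>i. \<alpha> * u i + w i) = complex_of_real ((cmod \<alpha>)\<^sup>2 * \<tau>2) + herm_form n C w w"
proof -
  have k: "k < n" and J: "J \<subseteq> {..<n} - {k}" and o: "\<And>j. j \<in> J \<Longrightarrow> C $$ (j, k) = (\<Sum>i\<in>J. c i * C $$ (j, i))"
    and t: "complex_of_real \<tau>2 = C $$ (k, k) - (\<Sum>i\<in>J. c i * C $$ (k, i))"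
    using p by (auto simp: predictor_def)
  have fJ: "finite J" using J by (meson finite_Diff finite_lessThan finite_subset)
  have sub: "(\<Sum>j<n. f j) = f k + (\<Sum>j\<in>J. f j)" if "\<And>j. j \<noteq> k \<Longrightarrow> j \<notin> J \<Longrightarrow> f j = 0" for f :: "nat \<Rightarrow> complex"
  proof -
    have "(\<Sum>j<n. f j) = (\<Sum>j\<in>insert k J. f j)"
      by (rule sum.mono_neutral_right) (use that k J in auto)
    also have "\<dots> = f k + (\<Sum>j\<in>J. f j)" using fJ J by (subst sum.insert) auto
    finally show ?thesis .
  qed
  have row: "(\<Sum>j<n. u j * C $$ (i, j)) = C $$ (i, k) - (\<Sum>j\<in>J. c j * C $$ (i, j))" for i
  proof -
    have "(\<Sum>j<n. u j * C $$ (i, j)) = u k * C $$ (i, k) + (\<Sum>j\<in>J. u j * C $$ (i, j))"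
      by (rule sub) (auto simp: u_def)
    also have "(\<Sum>j\<in>J. u j * C $$ (i, j)) = (\<Sum>j\<in>J. - (c j * C $$ (i, j)))"
      using J by (intro sum.cong) (auto simp: u_def)
    finally show ?thesis by (simp add: u_def sum_negf)
  qed
  have bu: "herm_form n C a u = (\<Sum>i<n. cnj (a i) * (C $$ (i, k) - (\<Sum>j\<in>J. c j * C $$ (i, j))))" for a
    unfolding herm_form_def row[symmetric] by (simp add: sum_distrib_left mult.assoc)
  have wu: "herm_form n C w u = 0"
    unfolding bu by (rule sum.neutral) (use w o in force)
  have uw: "herm_form n C u w = 0"
    using herm_form_cnj[OF h, where a=w and b=u] wu by simp
  have uu: "herm_form n C u u = complex_of_real \<tau>2"
  proof -
    have "herm_form n C u u = cnj (u k) * (C $$ (k, k) - (\<Sum>j\<in>J. c j * C $$ (k, j))) + (\<Sum>i\<in>J. cnj (u i) * (C $$ (i, k) - (\<Sum>j\<in>J. c j * C $$ (i, j))))"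
      unfolding bu by (rule sub) (auto simp: u_def)
    also have "(\<Sum>i\<in>J. cnj (u i) * (C $$ (i, k) - (\<Sum>j\<in>J. c j * C $$ (i, j)))) = 0"
      by (rule sum.neutral) (use o in force)
    finally show ?thesis using t by (simp add: u_def)
  qed
  have "herm_form n C (\<lambda>i. \<alpha> * u i + w i) (\<lambda>i. \<alpha> * u i + w i) = cnj \<alpha> * \<alpha> * complex_of_real \<tau>2 + herm_form n C w w"
    unfolding herm_form_add_left herm_form_add_right herm_form_scale_left herm_form_scale_right by (simp add: uu uw wu)
  also have "cnj \<alpha> * \<alpha> = complex_of_real ((cmod \<alpha>)\<^sup>2)"
    by (metis complex_norm_square mult.commute)
  finally show ?thesis by simp
qed

section \<open>Characteristic functions of the channel and the noise\<close>

context mimo_system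
begin

lemma H_carrier: "\<omega> \<in> space \<Omega> \<Longrightarrow> H \<omega> \<in> carrier_mat Nr Nt"
  using measurable_space[OF channel_measurable] by simp

lemma H_entry_measurable [measurable]: "m < Nr \<Longrightarrow> j < Nt \<Longrightarrow> (\<lambda>\<omega>. H \<omega> $$ (m, j)) \<in> borel_measurable \<Omega>"
  using measurable_compose[OF channel_measurable measurable_mat_index] .

lemma row_combination:
  assumes "m < Nr"
  shows "cgauss \<Omega> (\<lambda>\<omega>. \<Sum>j<Nt. a j * row (H \<omega>) m $ j) (Re (herm_form Nt \<Sigma> a a))"
proof -
  let ?X = "\<lambda>\<omega>. row (H \<omega>) m"
  note cg = circular_gaussian_cgauss[OF prob_space_axioms row_gaussian[OF assms]]
  have meas: "random_variable (vec_borel Nt) ?X" using row_gaussian[OF assms] by (simp add: circular_gaussian_def)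
  have [measurable]: "(\<lambda>\<omega>. ?X \<omega> $ i) \<in> borel_measurable \<Omega>" if "i < Nt" for i
    using measurable_compose[OF meas measurable_vec_index[OF that]] .
  have sq: "integrable \<Omega> (\<lambda>\<omega>. (cmod (?X \<omega> $ i))\<^sup>2)" if "i < Nt" for i
  proof -
    have "(\<Sum>j<Nt. (if j = i then 1 else 0) * ?X \<omega> $ j) = (\<Sum>j<Nt. if j = i then ?X \<omega> $ j else 0)" for \<omega>
      by (intro sum.cong) auto
    then show ?thesis using cgauss_moments(1)[OF prob_space_axioms cg[of "\<lambda>j. if j = i then 1 else 0"]] that by simp
  qed
  have cov: "(CLINT \<omega>|\<Omega>. cnj (?X \<omega> $ i) * ?X \<omega> $ j) = \<Sigma> $$ (i, j)" if "i < Nt" "j < Nt" for i j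
    using row_covariance[OF assms, symmetric] that by simp
  have "complex_of_real (LINT \<omega>|\<Omega>. (cmod (\<Sum>i<Nt. a i * ?X \<omega> $ i))\<^sup>2) = herm_form Nt \<Sigma> a a"
    unfolding herm_form_def by (subst second_moment_expand) (use sq cov in auto)
  then have "(LINT \<omega>|\<Omega>. (cmod (\<Sum>i<Nt. a i * ?X \<omega> $ i))\<^sup>2) = Re (herm_form Nt \<Sigma> a a)"
    by (metis Re_complex_of_real)
  with cg[of a] show ?thesis by simp
qed

lemma noise_measurable [measurable]: "random_variable (vec_borel Nr) \<xi>"
  using noise_gaussian by (simp add: circular_gaussian_def)

lemma noise_combination:
  "cgauss \<Omega> (\<lambda>\<omega>. \<Sum>m<Nr. b m * \<xi> \<omega> $ m) (\<sigma>\<^sup>2 * (\<Sum>m<Nr. (cmod (b m))\<^sup>2))"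
proof -
  note cg = circular_gaussian_cgauss[OF prob_space_axioms noise_gaussian]
  have [measurable]: "(\<lambda>\<omega>. \<xi> \<omega> $ i) \<in> borel_measurable \<Omega>" if "i < Nr" for i
    using measurable_compose[OF noise_measurable measurable_vec_index[OF that]] .
  have sq: "integrable \<Omega> (\<lambda>\<omega>. (cmod (\<xi> \<omega> $ i))\<^sup>2)" if "i < Nr" for i
  proof -
    have "(\<Sum>j<Nr. (if j = i then 1 else 0) * \<xi> \<omega> $ j) = (\<Sum>j<Nr. if j = i then \<xi> \<omega> $ j else 0)" for \<omega>
      by (intro sum.cong) auto
    then show ?thesis using cgauss_moments(1)[OF prob_space_axioms cg[of "\<lambda>j. if j = i then 1 else 0"]] that by simp
  qed
  have cov: "(CLINT \<omega>|\<Omega>. cnj (\<xi> \<omega> $ i) * \<xi> \<omega> $ j) = (if i = j then complex_of_real (\<sigma>\<^sup>2) else 0)" if "i < Nr" "j < Nr" for i j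
  proof -
    \<comment> \<open>The noise covariance has the conjugate on the second factor, so the entry is
      read at \<open>(j, i)\<close>.\<close>
    have "mat Nr Nr (\<lambda>(i, j). expectation (\<lambda>\<omega>. \<xi> \<omega> $ i * cnj (\<xi> \<omega> $ j))) $$ (j, i) = (complex_of_real (\<sigma>\<^sup>2) \<cdot>\<^sub>m 1\<^sub>m Nr) $$ (j, i)"
      by (simp only: noise_covariance)
    then show ?thesis using that by (auto simp: mult.commute)
  qed
  have "complex_of_real (LINT \<omega>|\<Omega>. (cmod (\<Sum>i<Nr. b i * \<xi> \<omega> $ i))\<^sup>2) =
      (\<Sum>i<Nr. \<Sum>j<Nr. if j = i then complex_of_real (\<sigma>\<^sup>2 * (cmod (b i))\<^sup>2) else 0)"
  proof (subst second_moment_expand)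
    have "cnj (b i) * b i = complex_of_real ((cmod (b i))\<^sup>2)" for i by (metis complex_norm_square mult.commute)
    then show "(\<Sum>i<Nr. \<Sum>j<Nr. cnj (b i) * b j * (CLINT \<omega>|\<Omega>. cnj (\<xi> \<omega> $ i) * \<xi> \<omega> $ j)) =
        (\<Sum>i<Nr. \<Sum>j<Nr. if j = i then complex_of_real (\<sigma>\<^sup>2 * (cmod (b i))\<^sup>2) else 0)"
      by (intro sum.cong refl) (auto simp: cov)
  qed (use sq in auto)
  also have "\<dots> = complex_of_real (\<sigma>\<^sup>2 * (\<Sum>m<Nr. (cmod (b m))\<^sup>2))"
    by (simp add: sum_distrib_left)
  finally have "(LINT \<omega>|\<Omega>. (cmod (\<Sum>i<Nr. b i * \<xi> \<omega> $ i))\<^sup>2) = \<sigma>\<^sup>2 * (\<Sum>m<Nr. (cmod (b m))\<^sup>2)"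
    by (simp only: of_real_eq_iff)
  with cg[of b] show ?thesis by simp
qed

text \<open>Independence of the rows turns the exponent into a sum of one covariance form per row.
  Later facts about the joint law of the channel entries derive from this formula.\<close>

lemma channel_char:
  "(CLINT \<omega>|\<Omega>. iexp (Re (\<Sum>m<Nr. \<Sum>j<Nt. A m j * H \<omega> $$ (m, j)))) =
    complex_of_real (exp (- (\<Sum>m<Nr. Re (herm_form Nt \<Sigma> (A m) (A m))) / 4))"
proof -
  let ?f = "\<lambda>m v. iexp (Re (\<Sum>j<Nt. A m j * v $ j))"
  have "(CLINT \<omega>|\<Omega>. iexp (Re (\<Sum>m<Nr. \<Sum>j<Nt. A m j * H \<omega> $$ (m, j)))) = (CLINT \<omega>|\<Omega>. (\<Prod>m<Nr. ?f m (row (H \<omega>) m)))"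
  proof (rule Bochner_Integration.integral_cong[OF refl])
    fix \<omega> assume "\<omega> \<in> space \<Omega>"
    then have "H \<omega> \<in> carrier_mat Nr Nt" by (rule H_carrier)
    then have "(\<Sum>m<Nr. \<Sum>j<Nt. A m j * H \<omega> $$ (m, j)) = (\<Sum>m<Nr. \<Sum>j<Nt. A m j * row (H \<omega>) m $ j)"
      by (intro sum.cong refl) auto
    then show "iexp (Re (\<Sum>m<Nr. \<Sum>j<Nt. A m j * H \<omega> $$ (m, j))) = (\<Prod>m<Nr. ?f m (row (H \<omega>) m))"
      by (simp add: exp_sum[symmetric] sum_distrib_left del: Re_sum add: Re_sum[of "\<lambda>m. \<Sum>j<Nt. A m j * row (H \<omega>) m $ j" "{..<Nr}"])
  qed
  also have "\<dots> = (\<Prod>m<Nr. CLINT \<omega>|\<Omega>. ?f m (row (H \<omega>) m))"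
  proof (rule indep_vars_lebesgue_integral)
    have "indep_vars (\<lambda>_. borel) (\<lambda>m \<omega>. ?f m (row (H \<omega>) m)) {..<Nr}"
      by (rule indep_vars_compose2[OF rows_indep]) measurable
    then show "indep_vars (\<lambda>_. borel) (\<lambda>m \<omega>. ?f m (row (H \<omega>) m)) {..<Nr}" .
    fix m assume m: "m \<in> {..<Nr}"
    have [measurable]: "(\<lambda>\<omega>. \<Sum>j<Nt. A m j * row (H \<omega>) m $ j) \<in> borel_measurable \<Omega>"
      using row_combination[of m "A m"] m by (simp add: cgauss_def)
    show "integrable \<Omega> (\<lambda>\<omega>. ?f m (row (H \<omega>) m))" by (rule integrable_iexp_comp) measurable
  qed simp
  also have "\<dots> = (\<Prod>m<Nr. complex_of_real (exp (- (Re (herm_form Nt \<Sigma> (A m) (A m)) / 4))))"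
  proof (rule prod.cong[OF refl])
    fix m assume "m \<in> {..<Nr}"
    then have "(CLINT \<omega>|\<Omega>. iexp (Re (1 * (\<Sum>j<Nt. A m j * row (H \<omega>) m $ j)))) =
       complex_of_real (exp (- (Re (herm_form Nt \<Sigma> (A m) (A m)) * (cmod 1)\<^sup>2 / 4)))"
      using row_combination[of m "A m"] unfolding cgauss_def by blast
    then show "(CLINT \<omega>|\<Omega>. ?f m (row (H \<omega>) m)) = complex_of_real (exp (- (Re (herm_form Nt \<Sigma> (A m) (A m)) / 4)))"
      by (simp only: mult_1_left norm_one power_one mult_1_right)
  qed
  also have "\<dots> = complex_of_real (exp (- (\<Sum>m<Nr. Re (herm_form Nt \<Sigma> (A m) (A m))) / 4))"
    by (simp only: of_real_prod[symmetric] exp_sum[symmetric] finite_lessThan sum_negf sum_divide_distrib minus_divide_left[symmetric])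
  finally show ?thesis .
qed

definition innovation :: "nat \<Rightarrow> nat set \<Rightarrow> (nat \<Rightarrow> complex) \<Rightarrow> nat \<Rightarrow> 'w \<Rightarrow> complex" where
  "innovation k J c m \<omega> = H \<omega> $$ (m, k) - (\<Sum>j\<in>J. c j * H \<omega> $$ (m, j))"

lemma innovation_measurable [measurable]:
  "m < Nr \<Longrightarrow> k < Nt \<Longrightarrow> J \<subseteq> {..<Nt} \<Longrightarrow> innovation k J c m \<in> borel_measurable \<Omega>"
  unfolding innovation_def[abs_def] by measurable auto

text \<open>Row by row, \<open>predictor_form\<close> removes the cross term between the innovation
  and the columns in \<open>J\<close>. The resulting factorisation is their independence.\<close>

lemma innovation_char:
  assumes p: "predictor Nt \<Sigma> k J c \<tau>2" and h: "\<And>i j. i < Nt \<Longrightarrow> j < Nt \<Longrightarrow> \<Sigma> $$ (i, j) = cnj (\<Sigma> $$ (j, i))"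
  shows "(CLINT \<omega>|\<Omega>. iexp (Re (\<Sum>m<Nr. \<alpha> m * innovation k J c m \<omega> + (\<Sum>j\<in>J. b m j * H \<omega> $$ (m, j))))) =
    complex_of_real (exp (- (\<Sum>m<Nr. (cmod (\<alpha> m))\<^sup>2 * \<tau>2) / 4) *
      exp (- (\<Sum>m<Nr. Re (herm_form Nt \<Sigma> (\<lambda>j. if j \<in> J then b m j else 0) (\<lambda>j. if j \<in> J then b m j else 0))) / 4))"
proof -
  define u where "u = (\<lambda>i. if i = k then 1 else if i \<in> J then - c i else 0)"
  define w where "w = (\<lambda>m j. if j \<in> J then b m j else 0)"
  have k: "k < Nt" and J: "J \<subseteq> {..<Nt} - {k}" using p by (auto simp: predictor_def)
  have fJ: "finite J" using J by (meson finite_Diff finite_lessThan finite_subset)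
  have "(\<Sum>j<Nt. (\<alpha> m * u j + w m j) * H \<omega> $$ (m, j)) = \<alpha> m * innovation k J c m \<omega> + (\<Sum>j\<in>J. b m j * H \<omega> $$ (m, j))" for m \<omega>
  proof -
    have "(\<Sum>j<Nt. (\<alpha> m * u j + w m j) * H \<omega> $$ (m, j)) = (\<Sum>j\<in>insert k J. (\<alpha> m * u j + w m j) * H \<omega> $$ (m, j))"
      by (rule sum.mono_neutral_right) (use k J in \<open>auto simp: u_def w_def\<close>)
    also have "\<dots> = \<alpha> m * H \<omega> $$ (m, k) + (\<Sum>j\<in>J. (\<alpha> m * u j + w m j) * H \<omega> $$ (m, j))"
      using fJ J by (subst sum.insert) (auto simp: u_def w_def)
    also have "(\<Sum>j\<in>J. (\<alpha> m * u j + w m j) * H \<omega> $$ (m, j)) = (\<Sum>j\<in>J. b m j * H \<omega> $$ (m, j) - \<alpha> m * (c j * H \<omega> $$ (m, j)))"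
      using J by (intro sum.cong) (auto simp: u_def w_def algebra_simps)
    finally show ?thesis by (simp add: innovation_def sum_subtractf sum_distrib_left algebra_simps)
  qed
  then have "(CLINT \<omega>|\<Omega>. iexp (Re (\<Sum>m<Nr. \<alpha> m * innovation k J c m \<omega> + (\<Sum>j\<in>J. b m j * H \<omega> $$ (m, j))))) =
    (CLINT \<omega>|\<Omega>. iexp (Re (\<Sum>m<Nr. \<Sum>j<Nt. (\<alpha> m * u j + w m j) * H \<omega> $$ (m, j))))" by presburger
  also have "\<dots> = complex_of_real (exp (- (\<Sum>m<Nr. Re (herm_form Nt \<Sigma> (\<lambda>j. \<alpha> m * u j + w m j) (\<lambda>j. \<alpha> m * u j + w m j))) / 4))"
    by (rule channel_char)
  also have "(\<Sum>m<Nr. Re (herm_form Nt \<Sigma> (\<lambda>j. \<alpha> m * u j + w m j) (\<lambda>j. \<alpha> m * u j + w m j))) =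
    (\<Sum>m<Nr. (cmod (\<alpha> m))\<^sup>2 * \<tau>2) + (\<Sum>m<Nr. Re (herm_form Nt \<Sigma> (w m) (w m)))"
    unfolding sum.distrib[symmetric] u_def
    by (intro sum.cong refl, subst predictor_form[OF p h]) (auto simp: w_def)
  finally show ?thesis by (simp add: w_def exp_add[symmetric] add_divide_distrib del: of_real_mult)
qed

lemma innovation_combination:
  assumes p: "predictor Nt \<Sigma> k J c \<tau>2" and h: "\<And>i j. i < Nt \<Longrightarrow> j < Nt \<Longrightarrow> \<Sigma> $$ (i, j) = cnj (\<Sigma> $$ (j, i))"
    and t: "0 \<le> \<tau>2"
  shows "cgauss \<Omega> (\<lambda>\<omega>. \<Sum>m<Nr. \<alpha> m * innovation k J c m \<omega>) (\<tau>2 * (\<Sum>m<Nr. (cmod (\<alpha> m))\<^sup>2))"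
proof -
  have kJ: "k < Nt" "J \<subseteq> {..<Nt}" using p by (auto simp: predictor_def)
  have z: "herm_form Nt \<Sigma> (\<lambda>_. 0) (\<lambda>_. 0) = 0" by (simp add: herm_form_def)
  have "(CLINT \<omega>|\<Omega>. iexp (Re (z * (\<Sum>m<Nr. \<alpha> m * innovation k J c m \<omega>)))) =
     complex_of_real (exp (- (\<tau>2 * (\<Sum>m<Nr. (cmod (\<alpha> m))\<^sup>2) * (cmod z)\<^sup>2 / 4)))" for z
    using innovation_char[OF p h, of "\<lambda>m. z * \<alpha> m" "\<lambda>_ _. 0"] 
    by (simp add: z sum_distrib_left mult.assoc norm_mult power_mult_distrib sum_distrib_right mult_ac del: Re_sum)
  then show ?thesis unfolding cgauss_def using t kJ
    by (auto intro!: mult_nonneg_nonneg sum_nonneg borel_measurable_sum borel_measurable_times innovation_measurable)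
qed

text \<open>The innovations are independent of the columns in \<open>J\<close>: a bound that holds for every frozen
  value of these columns holds for the channel.\<close>

lemma innovation_prob_le:
  assumes p: "predictor Nt \<Sigma> k J c \<tau>2" and h: "\<And>i j. i < Nt \<Longrightarrow> j < Nt \<Longrightarrow> \<Sigma> $$ (i, j) = cnj (\<Sigma> $$ (j, i))"
    and P: "Measurable.pred (Pi\<^sub>M ({..<Nr} \<times> insert k J) (\<lambda>_. borel)) (\<lambda>f. P (\<lambda>m. f (m, k)) (\<lambda>j m. f (m, j)))"
    and loc: "\<And>x x' w w'. (\<And>m. m < Nr \<Longrightarrow> x m = x' m) \<Longrightarrow> (\<And>m j. m < Nr \<Longrightarrow> j \<in> J \<Longrightarrow> w j m = w' j m) \<Longrightarrow> P x w = P x' w'"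
    and le: "\<And>w. prob {\<omega>\<in>space \<Omega>. P (\<lambda>m. innovation k J c m \<omega>) w} \<le> d"
  shows "prob {\<omega>\<in>space \<Omega>. P (\<lambda>m. innovation k J c m \<omega>) (\<lambda>j m. H \<omega> $$ (m, j))} \<le> d"
proof -
  have k: "k < Nt" and J: "J \<subseteq> {..<Nt} - {k}" using p by (auto simp: predictor_def)
  have fJ: "finite J" using J by (meson finite_Diff finite_lessThan finite_subset)
  \<comment> \<open>The channel restricted to the columns \<open>insert k J\<close>, with column
    \<open>k\<close> replaced by its innovation; the set \<open>?K\<close> below collects the
    innovation entries.\<close>
  define V where "V = (\<lambda>(m, j) \<omega>. if j = k then innovation k J c m \<omega> else H \<omega> $$ (m, j))"
  let ?I = "{..<Nr} \<times> insert k J" and ?K = "{..<Nr} \<times> {k}"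
  let ?A = "{f \<in> space (Pi\<^sub>M ?I (\<lambda>_. borel)). P (\<lambda>m. f (m, k)) (\<lambda>j m. f (m, j))}"
  have eqs: "(\<Sum>i\<in>?I. a i * V i \<omega>) = (\<Sum>m<Nr. a (m, k) * innovation k J c m \<omega> + (\<Sum>j\<in>J. a (m, j) * H \<omega> $$ (m, j)))" for a \<omega>
  proof -
    have "(\<Sum>i\<in>?I. a i * V i \<omega>) = (\<Sum>m<Nr. \<Sum>j\<in>insert k J. a (m, j) * V (m, j) \<omega>)"
      by (simp add: sum.cartesian_product' split_beta)
    also have "\<dots> = (\<Sum>m<Nr. a (m, k) * innovation k J c m \<omega> + (\<Sum>j\<in>J. a (m, j) * H \<omega> $$ (m, j)))"
      using fJ J by (intro sum.cong refl, subst sum.insert) (auto simp: V_def intro!: sum.cong)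
    finally show ?thesis .
  qed
  \<comment> \<open>The vanishing terms bring each factor into the shape of
    \<open>innovation_char\<close>, applied once with \<open>b = 0\<close> and once with
    \<open>\<alpha> = 0\<close>.\<close>
  have eqK: "(\<Sum>i\<in>?K. a i * V i \<omega>) = (\<Sum>m<Nr. a (m, k) * innovation k J c m \<omega> + (\<Sum>j\<in>J. 0 * H \<omega> $$ (m, j)))" for a \<omega>
    by (simp add: sum.cartesian_product' V_def)
  have IK: "?I - ?K = {..<Nr} \<times> J" using J by auto
  have eqIK: "(\<Sum>i\<in>?I - ?K. a i * V i \<omega>) = (\<Sum>m<Nr. 0 * innovation k J c m \<omega> + (\<Sum>j\<in>J. a (m, j) * H \<omega> $$ (m, j)))" for a \<omega>
    unfolding IK using J by (auto simp: sum.cartesian_product' V_def intro!: sum.cong)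
  have "prob {\<omega>\<in>space \<Omega>. (\<lambda>i\<in>?I. V i \<omega>) \<in> ?A} \<le> d"
  proof (rule independent_split_prob_le[OF prob_space_axioms])
    show "V i \<in> borel_measurable \<Omega>" if "i \<in> ?I" for i
      using that k J by (cases i; cases "snd i = k") (auto simp: V_def intro!: innovation_measurable H_entry_measurable)
    show "?A \<in> sets (Pi\<^sub>M ?I (\<lambda>_. borel))" using P by measurable
    show "(CLINT \<omega>|\<Omega>. iexp (Re (\<Sum>i\<in>?I. a i * V i \<omega>))) =
        (CLINT \<omega>|\<Omega>. iexp (Re (\<Sum>i\<in>?K. a i * V i \<omega>))) * (CLINT \<omega>|\<Omega>. iexp (Re (\<Sum>i\<in>?I - ?K. a i * V i \<omega>)))" for a
    proof -
      have z: "herm_form Nt \<Sigma> (\<lambda>_. 0) (\<lambda>_. 0) = 0" by (simp add: herm_form_def)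
      show ?thesis unfolding eqs eqK eqIK
        using innovation_char[OF p h, of "\<lambda>m. a (m, k)" "\<lambda>m j. a (m, j)"]
          innovation_char[OF p h, of "\<lambda>m. a (m, k)" "\<lambda>m j. 0"] innovation_char[OF p h, of "\<lambda>m. 0" "\<lambda>m j. a (m, j)"]
        by (simp only: ) (simp add: z)
    qed
    fix y assume y: "y \<in> space \<Omega>"
    have "{\<omega>\<in>space \<Omega>. (\<lambda>i\<in>?I. if i \<in> ?K then V i \<omega> else V i y) \<in> ?A} =
       {\<omega>\<in>space \<Omega>. P (\<lambda>m. innovation k J c m \<omega>) (\<lambda>j m. H y $$ (m, j))}"
    proof (rule Collect_cong, rule conj_cong[OF refl])
      fix \<omega>
      have "P (\<lambda>m. (\<lambda>i\<in>?I. if i \<in> ?K then V i \<omega> else V i y) (m, k)) (\<lambda>j m. (\<lambda>i\<in>?I. if i \<in> ?K then V i \<omega> else V i y) (m, j))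
         = P (\<lambda>m. innovation k J c m \<omega>) (\<lambda>j m. H y $$ (m, j))"
        by (rule loc) (use J in \<open>auto simp: V_def\<close>)
      then show "((\<lambda>i\<in>?I. if i \<in> ?K then V i \<omega> else V i y) \<in> ?A) = P (\<lambda>m. innovation k J c m \<omega>) (\<lambda>j m. H y $$ (m, j))"
        by (simp add: space_PiM)
    qed
    then show "prob {\<omega>\<in>space \<Omega>. (\<lambda>i\<in>?I. if i \<in> ?K then V i \<omega> else V i y) \<in> ?A} \<le> d" using le by simp
  qed (use fJ in auto)
  also have "{\<omega>\<in>space \<Omega>. (\<lambda>i\<in>?I. V i \<omega>) \<in> ?A} = {\<omega>\<in>space \<Omega>. P (\<lambda>m. innovation k J c m \<omega>) (\<lambda>j m. H \<omega> $$ (m, j))}"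
  proof (rule Collect_cong, rule conj_cong[OF refl])
    fix \<omega>
    have "P (\<lambda>m. (\<lambda>i\<in>?I. V i \<omega>) (m, k)) (\<lambda>j m. (\<lambda>i\<in>?I. V i \<omega>) (m, j)) = P (\<lambda>m. innovation k J c m \<omega>) (\<lambda>j m. H \<omega> $$ (m, j))"
      by (rule loc) (use J in \<open>auto simp: V_def\<close>)
    then show "((\<lambda>i\<in>?I. V i \<omega>) \<in> ?A) = P (\<lambda>m. innovation k J c m \<omega>) (\<lambda>j m. H \<omega> $$ (m, j))"
      by (simp add: space_PiM)
  qed
  finally show ?thesis .
qed

end

section \<open>Gram--Schmidt residuals\<close>

definition cip :: "nat \<Rightarrow> (nat \<Rightarrow> complex) \<Rightarrow> (nat \<Rightarrow> complex) \<Rightarrow> complex" where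
  "cip r u v = (\<Sum>m<r. cnj (u m) * v m)"

definition nsq :: "nat \<Rightarrow> (nat \<Rightarrow> complex) \<Rightarrow> real" where
  "nsq r u = (\<Sum>m<r. (cmod (u m))\<^sup>2)"

lemma cip_self: "cip r u u = complex_of_real (nsq r u)"
  unfolding cip_def nsq_def of_real_sum by (intro sum.cong refl) (metis complex_norm_square mult.commute)

lemma cip_add_right: "cip r u (\<lambda>m. x m + y m) = cip r u x + cip r u y"
  by (simp add: cip_def distrib_left sum.distrib)

lemma cip_diff_right: "cip r u (\<lambda>m. x m - y m) = cip r u x - cip r u y"
  by (simp add: cip_def right_diff_distrib sum_subtractf)

lemma cip_scale_right: "cip r u (\<lambda>m. c * x m) = c * cip r u x"
  by (simp add: cip_def sum_distrib_left mult_ac)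

lemma cip_scale_divide_right: "cip r u (\<lambda>m. c * x m / d) = c * cip r u x / d"
  by (simp add: cip_def sum_distrib_left sum_divide_distrib mult_ac)

lemma cip_sum_right: "cip r u (\<lambda>m. \<Sum>j\<in>J. x j m) = (\<Sum>j\<in>J. cip r u (x j))"
  unfolding cip_def sum_distrib_left by (rule sum.swap)

lemma cip_cnj: "cip r v u = cnj (cip r u v)"
  by (simp add: cip_def cnj_sum mult.commute)

lemma nsq_nonneg [simp]: "0 \<le> nsq r u"
  by (simp add: nsq_def sum_nonneg)

lemma nsq_eq_0_iff: "nsq r u = 0 \<longleftrightarrow> (\<forall>m<r. u m = 0)"
  by (auto simp: nsq_def sum_nonneg_eq_0_iff)

lemma cip_cong: "(\<And>m. m < r \<Longrightarrow> u m = u' m) \<Longrightarrow> (\<And>m. m < r \<Longrightarrow> v m = v' m) \<Longrightarrow> cip r u v = cip r u' v'"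
  by (simp add: cip_def)

lemma nsq_cong: "(\<And>m. m < r \<Longrightarrow> u m = u' m) \<Longrightarrow> nsq r u = nsq r u'"
  by (simp add: nsq_def)

lemma cip_nsq_0: "nsq r u = 0 \<Longrightarrow> cip r u v = 0"
  by (simp add: nsq_eq_0_iff cip_def)

text \<open>\<open>resid r w i x\<close> is the component of \<open>x\<close> orthogonal to \<open>w 0, \<dots>, w (i - 1)\<close> (Gram--Schmidt).
  For dependent vectors the quotient is \<open>0 / 0 = 0\<close>, so that the recursion stays correct.\<close>

primrec resid :: "nat \<Rightarrow> (nat \<Rightarrow> nat \<Rightarrow> complex) \<Rightarrow> nat \<Rightarrow> (nat \<Rightarrow> complex) \<Rightarrow> nat \<Rightarrow> complex" where
  "resid r w 0 x = x"
| "resid r w (Suc i) x = (\<lambda>m. resid r w i x m -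
     cip r (resid r w i (w i)) (resid r w i x) / complex_of_real (nsq r (resid r w i (w i))) * resid r w i (w i) m)"

abbreviation gs :: "nat \<Rightarrow> (nat \<Rightarrow> nat \<Rightarrow> complex) \<Rightarrow> nat \<Rightarrow> nat \<Rightarrow> complex" where
  "gs r w i \<equiv> resid r w i (w i)"

lemma resid_orthogonal: "j < i \<Longrightarrow> cip r (gs r w j) (resid r w i x) = 0"
proof (induction i arbitrary: j x)
  case (Suc i)
  show ?case
  proof (cases "j = i")
    case True
    then show ?thesis
      by (cases "nsq r (gs r w i) = 0") (auto simp: cip_diff_right cip_scale_divide_right cip_self cip_nsq_0)
  next
    case False
    then have "j < i" using Suc by simp
    then show ?thesis by (simp add: cip_diff_right cip_scale_divide_right Suc.IH)
  qed
qed simp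

lemma gs_orthogonal: "i \<noteq> j \<Longrightarrow> cip r (gs r w i) (gs r w j) = 0"
  using resid_orthogonal[of i j r w "w j"] resid_orthogonal[of j i r w "w i"] cip_cnj[of r "gs r w i" "gs r w j"]
  by (cases i j rule: linorder_cases) auto

text \<open>The vectors \<open>gs r w j\<close> are pairwise orthogonal, so the coefficient taken
  from the current residual equals the one taken from \<open>x\<close> itself. Linearity in
  \<open>x\<close> is visible in this form only.\<close>

lemma resid_closed_form:
  "resid r w i x = (\<lambda>m. x m - (\<Sum>j<i. cip r (gs r w j) x / complex_of_real (nsq r (gs r w j)) * gs r w j m))"
proof (induction i)
  case (Suc i)
  have "cip r (gs r w i) (resid r w i x) = cip r (gs r w i) x - (\<Sum>j<i. cip r (gs r w i) (\<lambda>m. cip r (gs r w j) x / complex_of_real (nsq r (gs r w j)) * gs r w j m))"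
    unfolding Suc by (simp only: cip_diff_right cip_sum_right)
  also have "(\<Sum>j<i. cip r (gs r w i) (\<lambda>m. cip r (gs r w j) x / complex_of_real (nsq r (gs r w j)) * gs r w j m)) = 0"
    by (rule sum.neutral) (auto simp: cip_scale_divide_right gs_orthogonal)
  finally have *: "cip r (gs r w i) (resid r w i x) = cip r (gs r w i) x" by simp
  show ?case unfolding resid.simps * by (subst Suc) (simp add: fun_eq_iff)
qed simp

lemma resid_add: "resid r w i (\<lambda>m. x m + y m) m = resid r w i x m + resid r w i y m"
  by (simp add: resid_closed_form[where x="\<lambda>m. x m + y m"] resid_closed_form[where x=x] resid_closed_form[where x=y]
      cip_add_right add_divide_distrib distrib_right sum.distrib)

lemma resid_scale: "resid r w i (\<lambda>m. c * x m) m = c * resid r w i x m"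
  by (simp add: resid_closed_form[where x="\<lambda>m. c * x m"] resid_closed_form[where x=x]
      cip_scale_right sum_distrib_left right_diff_distrib mult.assoc)

lemma resid_zero: "resid r w i (\<lambda>m. 0) m = 0"
  using resid_scale[of r w i 0 "\<lambda>m. 0" m] by simp

lemma resid_sum: "finite J \<Longrightarrow> resid r w i (\<lambda>m. \<Sum>j\<in>J. c j * x j m) m = (\<Sum>j\<in>J. c j * resid r w i (x j) m)"
proof (induction J rule: finite_induct)
  case (insert j J)
  have "resid r w i (\<lambda>m. \<Sum>j\<in>insert j J. c j * x j m) m = resid r w i (\<lambda>m. c j * x j m + (\<Sum>j\<in>J. c j * x j m)) m"
    using insert.hyps by simp
  also have "\<dots> = c j * resid r w i (x j) m + (\<Sum>j\<in>J. c j * resid r w i (x j) m)"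
    unfolding resid_add resid_scale insert.IH ..
  finally show ?case using insert.hyps by simp
qed (simp add: resid_zero)

lemma resid_cong:
  assumes "\<And>m. m < r \<Longrightarrow> x m = x' m" "\<And>j m. j < i \<Longrightarrow> m < r \<Longrightarrow> w j m = w' j m" "m < r"
  shows "resid r w i x m = resid r w' i x' m"
  using assms
proof (induction i arbitrary: x x' m)
  case (Suc i)
  have a: "resid r w i x m = resid r w' i x' m" if "m < r" for m
    by (rule Suc.IH) (use Suc.prems that in auto)
  have b: "gs r w i m = gs r w' i m" if "m < r" for m
    by (rule Suc.IH) (use Suc.prems that in auto)
  have "cip r (gs r w i) (resid r w i x) = cip r (gs r w' i) (resid r w' i x')" "nsq r (gs r w i) = nsq r (gs r w' i)"
    by (intro cip_cong nsq_cong a b; assumption)+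
  then show ?case using a b Suc.prems(3) by simp
qed simp

lemma resid_vanish:
  assumes "j < i" "m < r" shows "resid r w i (w j) m = 0"
  using assms
proof (induction i arbitrary: m)
  case (Suc i)
  show ?case
  proof (cases "j = i")
    case True
    show ?thesis
    proof (cases "nsq r (gs r w i) = 0")
      case z: True
      then have "gs r w i m = 0" using Suc.prems by (simp add: nsq_eq_0_iff)
      then show ?thesis using True by simp
    next
      case False
      then show ?thesis using True by (simp add: cip_self)
    qed
  next
    case False
    then have v: "resid r w i (w j) m = 0" if "m < r" for m using Suc that by simp
    then have "cip r (gs r w i) (resid r w i (w j)) = 0" by (simp add: cip_def)
    then show ?thesis using v Suc.prems by simp
  qed
qed simp

lemma resid_span: "\<exists>c. \<forall>m. x m = resid r w i x m + (\<Sum>j<i. c j * w j m)"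
proof (induction i arbitrary: x)
  case (Suc i)
  obtain c where c: "\<And>m. x m = resid r w i x m + (\<Sum>j<i. c j * w j m)" using Suc by blast
  obtain d where d: "\<And>m. w i m = gs r w i m + (\<Sum>j<i. d j * w j m)" using Suc[of "w i"] by blast
  define q where "q = cip r (gs r w i) (resid r w i x) / complex_of_real (nsq r (gs r w i))"
  define e where "e = (\<lambda>j. if j = i then q else c j - q * d j)"
  have "x m = resid r w (Suc i) x m + (\<Sum>j<Suc i. e j * w j m)" for m
  proof -
    have "(\<Sum>j<i. e j * w j m) = (\<Sum>j<i. c j * w j m) - q * (\<Sum>j<i. d j * w j m)"
      unfolding sum_distrib_left sum_subtractf[symmetric] by (intro sum.cong) (auto simp: e_def algebra_simps)
    then have "(\<Sum>j<Suc i. e j * w j m) = (\<Sum>j<i. c j * w j m) - q * (\<Sum>j<i. d j * w j m) + q * w i m"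
      by (simp add: e_def)
    moreover have "resid r w (Suc i) x m = resid r w i x m - q * gs r w i m" by (simp add: q_def)
    moreover have "q * w i m = q * gs r w i m + q * (\<Sum>j<i. d j * w j m)" by (subst d) (simp add: distrib_left)
    ultimately show ?thesis using c[of m] by (simp only:) simp
  qed
  then show ?case by blast
qed simp

text \<open>The residual map is an orthogonal projection: it is self-adjoint and idempotent, which
  is what moving it across the inner product expresses.\<close>

lemma cip_resid_resid: "cip r (resid r w i x) (resid r w i y) = cip r x (resid r w i y)"
proof -
  let ?z = "resid r w i y"
  have "cip r ?z (resid r w i x) = cip r ?z x - (\<Sum>j<i. cip r (gs r w j) x / complex_of_real (nsq r (gs r w j)) * cip r ?z (gs r w j))"
    by (subst (2) resid_closed_form) (simp add: cip_diff_right cip_sum_right cip_scale_divide_right)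
  also have "(\<Sum>j<i. cip r (gs r w j) x / complex_of_real (nsq r (gs r w j)) * cip r ?z (gs r w j)) = 0"
    by (rule sum.neutral) (auto simp: cip_cnj[of r "resid r w i y"] resid_orthogonal)
  finally show ?thesis using cip_cnj[of r "resid r w i x" ?z] cip_cnj[of r x ?z] by simp
qed

lemma nsq_resid: "nsq r (resid r w i x) = nsq r x - (\<Sum>j<i. (cmod (cip r (gs r w j) x))\<^sup>2 / nsq r (gs r w j))"
proof -
  have "complex_of_real (nsq r (resid r w i x)) = cip r x (resid r w i x)"
    using cip_resid_resid[of r w i x x] by (simp add: cip_self)
  also have "\<dots> = cip r x x - (\<Sum>j<i. cip r (gs r w j) x / complex_of_real (nsq r (gs r w j)) * cip r x (gs r w j))"
    by (subst resid_closed_form) (simp add: cip_diff_right cip_sum_right cip_scale_divide_right)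
  also have "\<dots> = complex_of_real (nsq r x - (\<Sum>j<i. (cmod (cip r (gs r w j) x))\<^sup>2 / nsq r (gs r w j)))"
  proof -
    have "cip r (gs r w j) x / complex_of_real (nsq r (gs r w j)) * cip r x (gs r w j) =
        complex_of_real ((cmod (cip r (gs r w j) x))\<^sup>2 / nsq r (gs r w j))" for j
      unfolding cip_cnj[of r x] of_real_divide complex_norm_square by simp
    then show ?thesis by (simp only: cip_self of_real_diff of_real_sum)
  qed
  finally show ?thesis by (simp only: of_real_eq_iff)
qed

text \<open>A trace argument: if every basis vector had zero residual, Pythagoras would make its
  squared coordinates along the Gram-Schmidt vectors add up to 1. Summing over the \<open>r\<close>
  basis vectors counts the nonzero Gram-Schmidt vectors, of which there are at most
  \<open>i < r\<close>.\<close>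

lemma resid_basis_nonzero:
  assumes "i < r" shows "\<exists>m<r. nsq r (resid r w i (\<lambda>l. if l = m then 1 else 0)) \<noteq> 0"
proof (rule ccontr)
  assume "\<not> ?thesis"
  then have z: "nsq r (resid r w i (\<lambda>l. if l = m then 1 else 0)) = 0" if "m < r" for m using that by blast
  have c: "cip r u (\<lambda>l. if l = m then 1 else 0) = cnj (u m)" if "m < r" for u m
  proof -
    have "cip r u (\<lambda>l. if l = m then 1 else 0) = (\<Sum>l<r. if l = m then cnj (u l) else 0)"
      unfolding cip_def by (intro sum.cong) auto
    then show ?thesis using that by simp
  qed
  have n: "nsq r (\<lambda>l. if l = m then 1 else 0) = 1" if "m < r" for m
  proof -
    have "nsq r (\<lambda>l. if l = m then 1 else 0) = (\<Sum>l<r. if l = m then 1 else 0)"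
      unfolding nsq_def by (intro sum.cong) auto
    then show ?thesis using that by simp
  qed
  have eq1: "(1::real) = (\<Sum>j<i. (cmod (gs r w j m))\<^sup>2 / nsq r (gs r w j))" if "m < r" for m
    using z[OF that] unfolding nsq_resid[of r w i] c[OF that] n[OF that] complex_mod_cnj by linarith
  have "(\<Sum>m<r. 1::real) = (\<Sum>m<r. \<Sum>j<i. (cmod (gs r w j m))\<^sup>2 / nsq r (gs r w j))"
    by (intro sum.cong refl eq1) (simp only: lessThan_iff)
  also have "\<dots> = (\<Sum>j<i. \<Sum>m<r. (cmod (gs r w j m))\<^sup>2 / nsq r (gs r w j))" by (rule sum.swap)
  also have "\<dots> = (\<Sum>j<i. nsq r (gs r w j) / nsq r (gs r w j))"
    by (simp only: sum_divide_distrib[symmetric] nsq_def[symmetric])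
  \<comment> \<open>Each quotient is 1, or 0 by the convention \<open>0 / 0 = 0\<close>.\<close>
  also have "\<dots> \<le> (\<Sum>j<i. 1)" by (intro sum_mono) simp
  finally show False using assms by simp
qed

lemma resid_measurable:
  assumes "\<And>m. m < r \<Longrightarrow> (\<lambda>\<omega>. x \<omega> m) \<in> borel_measurable M"
    and "\<And>j m. j < i \<Longrightarrow> m < r \<Longrightarrow> (\<lambda>\<omega>. w \<omega> j m) \<in> borel_measurable M" and "m < r"
  shows "(\<lambda>\<omega>. resid r (w \<omega>) i (x \<omega>) m) \<in> borel_measurable M"
  using assms
proof (induction i arbitrary: x m)
  case (Suc i)
  have [measurable]: "(\<lambda>\<omega>. resid r (w \<omega>) i (x \<omega>) m) \<in> borel_measurable M" if "m < r" for m
    by (rule Suc.IH) (use Suc.prems that in auto)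
  have [measurable]: "(\<lambda>\<omega>. gs r (w \<omega>) i m) \<in> borel_measurable M" if "m < r" for m
    by (rule Suc.IH) (use Suc.prems that in auto)
  show ?case using Suc.prems(3) unfolding resid.simps cip_def nsq_def by measurable
qed simp

lemma nsq_measurable:
  assumes "\<And>m. m < r \<Longrightarrow> (\<lambda>\<omega>. x \<omega> m) \<in> borel_measurable M"
  shows "(\<lambda>\<omega>. nsq r (x \<omega>)) \<in> borel_measurable M"
  using assms unfolding nsq_def by measurable

section \<open>Fourth moments and concentration of residuals\<close>

text \<open>Over the four units, the fourth powers add up to
  \<open>4 * |a|^4 + 4 * |b|^4 + 16 * |a|^2 * |b|^2\<close>; subtracting the pure fourth powers
  leaves the mixed term. Every modulus on the right belongs to one linear combination, hence to one
  Gaussian variable.\<close>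

lemma cmod_polarization4:
  "(cmod a)\<^sup>2 * (cmod b)\<^sup>2 = (1/16) * (cmod (a + b) ^ 4 + cmod (a + (-1) * b) ^ 4 + cmod (a + \<i> * b) ^ 4 + cmod (a + (- \<i>) * b) ^ 4
     + (-4) * cmod a ^ 4 + (-4) * cmod b ^ 4)"
proof -
  define A x y where "A = (cmod a)\<^sup>2 + (cmod b)\<^sup>2" and "x = Re (cnj a * b)" and "y = Im (cnj a * b)"
  have 4: "cmod z ^ 4 = ((cmod z)\<^sup>2)\<^sup>2" for z by (simp flip: power_mult)
  have p: "(cmod (a + b))\<^sup>2 = A + 2 * x" "(cmod (a + (-1) * b))\<^sup>2 = A - 2 * x"
    "(cmod (a + \<i> * b))\<^sup>2 = A - 2 * y" "(cmod (a + (- \<i>) * b))\<^sup>2 = A + 2 * y"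
    unfolding A_def x_def y_def cmod_power2 by (simp_all add: power2_eq_square algebra_simps)
  have xy: "x\<^sup>2 + y\<^sup>2 = (cmod a)\<^sup>2 * (cmod b)\<^sup>2"
    unfolding x_def y_def cmod_power2[symmetric] by (simp add: norm_mult power_mult_distrib)
  have "(A + 2 * x)\<^sup>2 + (A - 2 * x)\<^sup>2 + (A - 2 * y)\<^sup>2 + (A + 2 * y)\<^sup>2 = 4 * A\<^sup>2 + 8 * (x\<^sup>2 + y\<^sup>2)"
    by (simp add: power2_eq_square algebra_simps)
  moreover have "A\<^sup>2 = ((cmod a)\<^sup>2)\<^sup>2 + ((cmod b)\<^sup>2)\<^sup>2 + 2 * ((cmod a)\<^sup>2 * (cmod b)\<^sup>2)"
    unfolding A_def by (simp only: power2_sum mult.assoc)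
  ultimately show ?thesis unfolding 4 p xy by simp
qed

text \<open>Uncorrelated jointly circular Gaussian variables have uncorrelated squared moduli: by
  polarization, the mixed fourth moment is a combination of fourth moments of single variables.\<close>

lemma cgauss_square_sum_variance:
  fixes y :: "nat \<Rightarrow> 'a \<Rightarrow> complex"
  assumes "prob_space M"
    and g: "\<And>\<alpha>. cgauss M (\<lambda>\<omega>. \<Sum>j<p. \<alpha> j * y j \<omega>) (t * (\<Sum>j<p. (cmod (\<alpha> j))\<^sup>2))"
  shows "integrable M (\<lambda>\<omega>. ((\<Sum>j<p. (cmod (y j \<omega>))\<^sup>2) - real p * t)\<^sup>2)"
    and "(LINT \<omega>|M. ((\<Sum>j<p. (cmod (y j \<omega>))\<^sup>2) - real p * t)\<^sup>2) = real p * t\<^sup>2"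
proof -
  interpret prob_space M by fact
  have one: "cgauss M (y j) t" if "j < p" for j
  proof -
    have "(\<Sum>l<p. (if l = j then 1 else 0) * y l \<omega>) = (\<Sum>l<p. if l = j then y l \<omega> else 0)" for \<omega>
      by (intro sum.cong) auto
    moreover have "(\<Sum>l<p. (cmod (if l = j then 1 else 0))\<^sup>2) = (\<Sum>l<p. if l = j then 1 else 0)"
      by (intro sum.cong) auto
    ultimately show ?thesis using g[of "\<lambda>l. if l = j then 1 else 0"] that by (simp add: eta_contract_eq)
  qed
  have two: "cgauss M (\<lambda>\<omega>. y i \<omega> + c * y j \<omega>) (2 * t)" if "i < p" "j < p" "i \<noteq> j" "cmod c = 1" for i j c
  proof -
    have "(\<Sum>l<p. (if l = i then 1 else if l = j then c else 0) * y l \<omega>) = (\<Sum>l\<in>{i, j}. (if l = i then 1 else if l = j then c else 0) * y l \<omega>)" for \<omega>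
      by (rule sum.mono_neutral_right) (use that in auto)
    moreover have "(\<Sum>l<p. (cmod (if l = i then 1 else if l = j then c else 0))\<^sup>2) = (\<Sum>l\<in>{i, j}. (cmod (if l = i then 1 else if l = j then c else 0))\<^sup>2)"
      by (rule sum.mono_neutral_right) (use that in auto)
    ultimately show ?thesis using g[of "\<lambda>l. if l = i then 1 else if l = j then c else 0"] that by (simp add: mult.commute)
  qed
  have i2: "integrable M (\<lambda>\<omega>. (cmod (y j \<omega>))\<^sup>2)" and e2: "(LINT \<omega>|M. (cmod (y j \<omega>))\<^sup>2) = t"
    and i4: "integrable M (\<lambda>\<omega>. cmod (y j \<omega>) ^ 4)" and e4: "(LINT \<omega>|M. cmod (y j \<omega>) ^ 4) = 2 * t\<^sup>2" if "j < p" for j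
    using cgauss_moments[OF assms(1) one[OF that]] by auto
  have ij: "integrable M (\<lambda>\<omega>. (cmod (y i \<omega>))\<^sup>2 * (cmod (y j \<omega>))\<^sup>2)"
    and eij: "(LINT \<omega>|M. (cmod (y i \<omega>))\<^sup>2 * (cmod (y j \<omega>))\<^sup>2) = (if i = j then 2 * t\<^sup>2 else t\<^sup>2)" if "i < p" "j < p" for i j
  proof -
    have "integrable M (\<lambda>\<omega>. (cmod (y i \<omega>))\<^sup>2 * (cmod (y j \<omega>))\<^sup>2) \<and>
      (LINT \<omega>|M. (cmod (y i \<omega>))\<^sup>2 * (cmod (y j \<omega>))\<^sup>2) = (if i = j then 2 * t\<^sup>2 else t\<^sup>2)"
    proof (cases "i = j")
      case True
      have "(cmod z)\<^sup>2 * (cmod z)\<^sup>2 = cmod z ^ 4" for z by (simp flip: power_add)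
      then show ?thesis using True i4[OF that(1)] e4[OF that(1)] by simp
    next
      case False
      \<comment> \<open>Each combination has variance \<open>2 * t\<close> and fourth moment
        \<open>8 * t^2\<close>, so polarization yields
        \<open>(4 * 8 - 4 * 2 - 4 * 2) / 16 = 1\<close> times \<open>t^2\<close>.\<close>
      note m = cgauss_moments(3,4)[OF assms(1) two[OF that False]]
      have m1: "integrable M (\<lambda>\<omega>. cmod (y i \<omega> + y j \<omega>) ^ 4)" "(LINT \<omega>|M. cmod (y i \<omega> + y j \<omega>) ^ 4) = 8 * t\<^sup>2"
        using m[of 1] by (simp_all add: power_mult_distrib)
      have m2: "integrable M (\<lambda>\<omega>. cmod (y i \<omega> + c * y j \<omega>) ^ 4)" "(LINT \<omega>|M. cmod (y i \<omega> + c * y j \<omega>) ^ 4) = 8 * t\<^sup>2"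
        if "cmod c = 1" for c
        using m[OF that] by (simp_all add: power_mult_distrib)
      have c: "cmod (-1) = 1" "cmod \<i> = 1" "cmod (- \<i>) = 1" by simp_all
      note ints = m1(1) m2(1)[OF c(1)] m2(1)[OF c(2)] m2(1)[OF c(3)] i4[OF that(1)] i4[OF that(2)]
      show ?thesis unfolding cmod_polarization4 using False
        by (simp only: if_False integral_mult_right_zero Bochner_Integration.integral_add Bochner_Integration.integrable_add
            integrable_mult_right ints m1(2) m2(2)[OF c(1)] m2(2)[OF c(2)] m2(2)[OF c(3)] e4[OF that(1)] e4[OF that(2)]) simp
    qed
    then show "integrable M (\<lambda>\<omega>. (cmod (y i \<omega>))\<^sup>2 * (cmod (y j \<omega>))\<^sup>2)"
      "(LINT \<omega>|M. (cmod (y i \<omega>))\<^sup>2 * (cmod (y j \<omega>))\<^sup>2) = (if i = j then 2 * t\<^sup>2 else t\<^sup>2)" by blast+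
  qed
  \<comment> \<open>The product of the centred variables \<open>|y i|^2 - t\<close> and
    \<open>|y j|^2 - t\<close>; only the diagonal has a nonzero mean, namely
    \<open>2 * t^2 - t^2\<close>.\<close>
  let ?c = "\<lambda>i j \<omega>. ((cmod (y i \<omega>))\<^sup>2 * (cmod (y j \<omega>))\<^sup>2 - t * (cmod (y i \<omega>))\<^sup>2) - (t * (cmod (y j \<omega>))\<^sup>2 - t\<^sup>2)"
  have ic: "integrable M (?c i j)" if "i < p" "j < p" for i j
    using ij[OF that] i2[OF that(1)] i2[OF that(2)] by simp
  have ec: "(LINT \<omega>|M. ?c i j \<omega>) = (if j = i then t\<^sup>2 else 0)" if "i < p" "j < p" for i j
  proof -
    have "(LINT \<omega>|M. ?c i j \<omega>) = (if i = j then 2 * t\<^sup>2 else t\<^sup>2) - t * t - (t * t - t\<^sup>2)"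
      using ij[OF that] i2[OF that(1)] i2[OF that(2)] e2[OF that(1)] e2[OF that(2)] eij[OF that]
      by (simp add: Bochner_Integration.integral_diff prob_space)
    then show ?thesis by (simp add: power2_eq_square)
  qed
  have sq: "((\<Sum>j<p. (cmod (y j \<omega>))\<^sup>2) - real p * t)\<^sup>2 = (\<Sum>i<p. \<Sum>j<p. ?c i j \<omega>)" for \<omega>
  proof -
    have "(\<Sum>j<p. (cmod (y j \<omega>))\<^sup>2) - real p * t = (\<Sum>j<p. (cmod (y j \<omega>))\<^sup>2 - t)"
      by (simp add: sum_subtractf)
    then show ?thesis by (simp add: power2_eq_square sum_product algebra_simps)
  qed
  show "integrable M (\<lambda>\<omega>. ((\<Sum>j<p. (cmod (y j \<omega>))\<^sup>2) - real p * t)\<^sup>2)"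
    unfolding sq by (intro Bochner_Integration.integrable_sum ic) auto
  have "(LINT \<omega>|M. (\<Sum>i<p. \<Sum>j<p. ?c i j \<omega>)) = (\<Sum>i<p. \<Sum>j<p. LINT \<omega>|M. ?c i j \<omega>)"
  proof -
    have "(LINT \<omega>|M. (\<Sum>j<p. ?c i j \<omega>)) = (\<Sum>j<p. LINT \<omega>|M. ?c i j \<omega>)" if "i < p" for i
      by (rule Bochner_Integration.integral_sum) (use that in \<open>auto intro!: ic\<close>)
    moreover have "(LINT \<omega>|M. (\<Sum>i<p. \<Sum>j<p. ?c i j \<omega>)) = (\<Sum>i<p. LINT \<omega>|M. (\<Sum>j<p. ?c i j \<omega>))"
      by (rule Bochner_Integration.integral_sum) (intro Bochner_Integration.integrable_sum ic; simp)
    ultimately show ?thesis by simp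
  qed
  also have "\<dots> = (\<Sum>i<p. \<Sum>j<p. if j = i then t\<^sup>2 else 0)" by (intro sum.cong refl ec) auto
  also have "\<dots> = real p * t\<^sup>2" by simp
  finally show "(LINT \<omega>|M. ((\<Sum>j<p. (cmod (y j \<omega>))\<^sup>2) - real p * t)\<^sup>2) = real p * t\<^sup>2" unfolding sq .
qed

text \<open>Some standard basis vector has a nonzero residual \<open>q\<close>. A vanishing residual
  of the random vector makes its inner product with \<open>q\<close> vanish, by self-adjointness of
  the projection, and this inner product is a nondegenerate Gaussian. The bound is written as
  \<open>\<le> 0\<close> to fit the transfer from frozen columns.\<close>

lemma resid_nonzero_prob:
  assumes "prob_space M" and g: "\<And>\<alpha>. cgauss M (\<lambda>\<omega>. \<Sum>m<r. \<alpha> m * e m \<omega>) (t * (\<Sum>m<r. (cmod (\<alpha> m))\<^sup>2))"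
    and "0 < t" "i < r"
  shows "measure M {\<omega>\<in>space M. nsq r (resid r w i (\<lambda>m. e m \<omega>)) = 0} \<le> 0"
proof -
  interpret prob_space M by fact
  obtain m where "m < r" and m: "nsq r (resid r w i (\<lambda>l. if l = m then 1 else 0)) \<noteq> 0"
    using resid_basis_nonzero[OF assms(4)] by blast
  define q where "q = resid r w i (\<lambda>l. if l = m then 1 else 0)"
  let ?Z = "\<lambda>\<omega>. \<Sum>l<r. cnj (q l) * e l \<omega>"
  have V: "0 < t * (\<Sum>l<r. (cmod (cnj (q l)))\<^sup>2)" using m assms(3) nsq_nonneg[of r q] by (simp add: q_def nsq_def less_le)
  have [measurable]: "?Z \<in> borel_measurable M" using g[of "\<lambda>l. cnj (q l)"] by (simp add: cgauss_def)
  have "AE z in distr M borel ?Z. Re (1 * z) \<noteq> 0"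
    unfolding cgauss_law[OF assms(1) g[of "\<lambda>l. cnj (q l)"]] by (rule cgauss_line_null[OF V]) simp
  then have "AE \<omega> in M. Re (?Z \<omega>) \<noteq> 0" by (subst (asm) AE_distr_iff) auto
  then have ae: "AE \<omega> in M. \<omega> \<notin> {\<omega>\<in>space M. Re (?Z \<omega>) = 0}" by (rule AE_mp) (rule AE_I2, simp)
  have S: "{\<omega>\<in>space M. Re (?Z \<omega>) = 0} \<in> sets M" by measurable
  have 0: "measure M {\<omega>\<in>space M. Re (?Z \<omega>) = 0} = 0" using ae prob_eq_0[OF S] by simp
  have "measure M {\<omega>\<in>space M. nsq r (resid r w i (\<lambda>m. e m \<omega>)) = 0} \<le> measure M {\<omega>\<in>space M. Re (?Z \<omega>) = 0}"
  proof (rule finite_measure_mono)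
    show "{\<omega>\<in>space M. nsq r (resid r w i (\<lambda>m. e m \<omega>)) = 0} \<subseteq> {\<omega>\<in>space M. Re (?Z \<omega>) = 0}"
    proof (intro Collect_mono impI conjI, elim conjE, assumption, elim conjE)
      fix \<omega> assume z: "nsq r (resid r w i (\<lambda>m. e m \<omega>)) = 0"
      have "?Z \<omega> = cip r q (\<lambda>m. e m \<omega>)" by (simp add: cip_def)
      also have "\<dots> = cnj (cip r (\<lambda>m. e m \<omega>) q)" by (rule cip_cnj)
      also have "cip r (\<lambda>m. e m \<omega>) q = cip r (resid r w i (\<lambda>m. e m \<omega>)) q"
        unfolding q_def by (rule cip_resid_resid[symmetric])
      also have "\<dots> = 0" using z by (rule cip_nsq_0)
      finally show "Re (?Z \<omega>) = 0" by simp
    qed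
  qed measurable
  with 0 show ?thesis by simp
qed

text \<open>The squared residual is the squared norm minus the squared coordinates along the
  normalised Gram-Schmidt vectors. These coordinates are again uncorrelated Gaussians of variance
  \<open>t\<close>, so the two sums have variances \<open>r * t^2\<close> and
  \<open>p * t^2\<close>. Bounding the second moment of their difference by twice the sum is crude,
  but it is linear in the dimension, against a square \<open>a^2\<close> of quadratic order in the
  application.\<close>

lemma resid_concentration:
  assumes "prob_space M" and g: "\<And>\<alpha>. cgauss M (\<lambda>\<omega>. \<Sum>m<r. \<alpha> m * e m \<omega>) (t * (\<Sum>m<r. (cmod (\<alpha> m))\<^sup>2))"
    and n: "\<And>j. j < p \<Longrightarrow> nsq r (gs r w j) \<noteq> 0" and "0 < a"
  shows "measure M {\<omega>\<in>space M. a \<le> \<bar>nsq r (resid r w p (\<lambda>m. e m \<omega>)) - (real r - real p) * t\<bar>}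
    \<le> 2 * (real r + real p) * t\<^sup>2 / a\<^sup>2"
proof -
  interpret prob_space M by fact
  define v where "v = (\<lambda>j m. gs r w j m / complex_of_real (sqrt (nsq r (gs r w j))))"
  have vv: "cip r (v i) (v j) = (if i = j then 1 else 0)" if "i < p" "j < p" for i j
  proof -
    have "cip r (v i) (v j) = cip r (gs r w i) (gs r w j) / complex_of_real (sqrt (nsq r (gs r w i)) * sqrt (nsq r (gs r w j)))"
      by (simp add: cip_def v_def sum_divide_distrib)
    then show ?thesis using n[OF that(1)] gs_orthogonal[of i j r w] by (auto simp: cip_self simp del: of_real_mult)
  qed
  let ?y = "\<lambda>j \<omega>. cip r (v j) (\<lambda>m. e m \<omega>)"
  have gy: "cgauss M (\<lambda>\<omega>. \<Sum>j<p. \<alpha> j * ?y j \<omega>) (t * (\<Sum>j<p. (cmod (\<alpha> j))\<^sup>2))" for \<alpha>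
  proof -
    let ?b = "\<lambda>m. \<Sum>j<p. cnj (\<alpha> j) * v j m"
    have 1: "(\<Sum>j<p. \<alpha> j * ?y j \<omega>) = (\<Sum>m<r. cnj (?b m) * e m \<omega>)" for \<omega>
    proof -
      have "(\<Sum>j<p. \<alpha> j * ?y j \<omega>) = (\<Sum>j<p. \<Sum>m<r. \<alpha> j * (cnj (v j m) * e m \<omega>))" by (simp add: cip_def sum_distrib_left)
      also have "\<dots> = (\<Sum>m<r. \<Sum>j<p. \<alpha> j * (cnj (v j m) * e m \<omega>))" by (rule sum.swap)
      also have "\<dots> = (\<Sum>m<r. cnj (?b m) * e m \<omega>)" by (simp add: cnj_sum sum_distrib_left sum_distrib_right mult_ac)
      finally show ?thesis .
    qed
    have "complex_of_real (nsq r ?b) = cip r ?b ?b" by (simp add: cip_self)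
    also have "\<dots> = (\<Sum>j<p. cnj (\<alpha> j) * cip r ?b (v j))" by (simp only: cip_sum_right cip_scale_right)
    also have "\<dots> = (\<Sum>j<p. cnj (\<alpha> j) * cnj (\<Sum>i<p. cnj (\<alpha> i) * cip r (v j) (v i)))"
      by (simp only: cip_cnj[of r ?b] cip_sum_right cip_scale_right)
    also have "\<dots> = (\<Sum>j<p. cnj (\<alpha> j) * cnj (\<Sum>i<p. if i = j then cnj (\<alpha> i) else 0))"
      by (intro sum.cong refl arg_cong2[where f=times] arg_cong[where f=cnj]) (auto simp: vv)
    also have "\<dots> = (\<Sum>j<p. complex_of_real ((cmod (\<alpha> j))\<^sup>2))"
      by (intro sum.cong refl) (simp add: complex_norm_square mult.commute del: of_real_power)
    finally have "complex_of_real (nsq r ?b) = complex_of_real (\<Sum>j<p. (cmod (\<alpha> j))\<^sup>2)" by (simp only: of_real_sum)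
    then have 2: "(\<Sum>m<r. (cmod (cnj (?b m)))\<^sup>2) = (\<Sum>j<p. (cmod (\<alpha> j))\<^sup>2)" unfolding of_real_eq_iff by (simp only: nsq_def complex_mod_cnj)
    show ?thesis unfolding 1 2[symmetric] by (rule g)
  qed
  let ?A = "\<lambda>\<omega>. (\<Sum>m<r. (cmod (e m \<omega>))\<^sup>2) - real r * t" and ?B = "\<lambda>\<omega>. (\<Sum>j<p. (cmod (?y j \<omega>))\<^sup>2) - real p * t"
  let ?D = "\<lambda>\<omega>. nsq r (resid r w p (\<lambda>m. e m \<omega>)) - (real r - real p) * t"
  have D: "?D \<omega> = ?A \<omega> - ?B \<omega>" for \<omega>
  proof -
    have "(cmod (cip r (gs r w j) x))\<^sup>2 / nsq r (gs r w j) = (cmod (cip r (v j) x))\<^sup>2" if "j < p" for j x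
    proof -
      have "cip r (v j) x = cip r (gs r w j) x / complex_of_real (sqrt (nsq r (gs r w j)))"
        by (simp add: cip_def v_def sum_divide_distrib)
      then show ?thesis by (simp add: norm_divide power_divide)
    qed
    then show ?thesis unfolding nsq_resid[of r w p] by (simp add: nsq_def algebra_simps)
  qed
  have em: "e m \<in> borel_measurable M" if "m < r" for m
  proof -
    have "(\<Sum>l<r. (if l = m then 1 else 0) * e l \<omega>) = (\<Sum>l<r. if l = m then e l \<omega> else 0)" for \<omega>
      by (intro sum.cong) auto
    then show ?thesis using g[of "\<lambda>l. if l = m then 1 else 0"] that by (simp add: cgauss_def eta_contract_eq)
  qed
  have Dm [measurable]: "?D \<in> borel_measurable M"
    by (intro borel_measurable_diff nsq_measurable resid_measurable borel_measurable_const em) auto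
  note a = cgauss_square_sum_variance[OF assms(1) g] and b = cgauss_square_sum_variance[OF assms(1) gy]
  have le: "(?D \<omega>)\<^sup>2 \<le> 2 * (?A \<omega>)\<^sup>2 + 2 * (?B \<omega>)\<^sup>2" for \<omega>
  proof -
    have "(x - y)\<^sup>2 \<le> 2 * x\<^sup>2 + 2 * y\<^sup>2" for x y :: real
      using zero_le_power2[of "x + y"] by (simp add: power2_eq_square algebra_simps)
    then show ?thesis unfolding D .
  qed
  have iAB: "integrable M (\<lambda>\<omega>. 2 * (?A \<omega>)\<^sup>2 + 2 * (?B \<omega>)\<^sup>2)" using a(1) b(1) by simp
  have iD: "integrable M (\<lambda>\<omega>. (?D \<omega>)\<^sup>2)"
    by (rule Bochner_Integration.integrable_bound[OF iAB]) (use le in \<open>auto simp: abs_of_nonneg\<close>)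
  have "(LINT \<omega>|M. (?D \<omega>)\<^sup>2) \<le> (LINT \<omega>|M. 2 * (?A \<omega>)\<^sup>2 + 2 * (?B \<omega>)\<^sup>2)"
    by (rule integral_mono[OF iD iAB le])
  also have "\<dots> = 2 * (real r + real p) * t\<^sup>2"
    using a b by (simp add: algebra_simps)
  finally have ED: "(LINT \<omega>|M. (?D \<omega>)\<^sup>2) \<le> 2 * (real r + real p) * t\<^sup>2" .
  have "{\<omega>\<in>space M. a \<le> \<bar>?D \<omega>\<bar>} = {\<omega>\<in>space M. a\<^sup>2 \<le> (?D \<omega>)\<^sup>2}"
    using assms(4) by (auto simp: abs_le_square_iff[symmetric])
  then have "measure M {\<omega>\<in>space M. a \<le> \<bar>?D \<omega>\<bar>} \<le> (LINT \<omega>|M. (?D \<omega>)\<^sup>2) / a\<^sup>2"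
    using integral_Markov_inequality_measure[OF iD, of "{}" "a\<^sup>2"] assms(4) by simp
  also have "\<dots> \<le> 2 * (real r + real p) * t\<^sup>2 / a\<^sup>2" by (rule divide_right_mono[OF ED]) simp
  finally show ?thesis .
qed

section \<open>Innovations of the channel columns\<close>

lemma kms_index: "i < n \<Longrightarrow> j < n \<Longrightarrow> kms_matrix n \<rho> $$ (i, j) = (if i \<le> j then \<rho> ^ (j - i) else cnj (\<rho> ^ (i - j)))"
  by (simp add: kms_matrix_def)

lemma kms_hermitian: "i < n \<Longrightarrow> j < n \<Longrightarrow> kms_matrix n \<rho> $$ (i, j) = cnj (kms_matrix n \<rho> $$ (j, i))"
  by (auto simp: kms_index)

lemma kms_predictor_first:
  assumes "0 < n" shows "predictor n (kms_matrix n \<rho>) 0 {} c 1"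
  using assms by (simp add: predictor_def kms_index)

lemma sum_single_index:
  assumes "finite J" "l \<in> J" shows "(\<Sum>i\<in>J. (if i = l then a else 0) * f i) = a * (f l :: complex)"
proof -
  have "(\<Sum>i\<in>J. (if i = l then a else 0) * f i) = (\<Sum>i\<in>J. if i = l then a * f i else 0)"
    by (intro sum.cong) auto
  then show ?thesis using assms by simp
qed

lemma cnj_times_self: "\<rho> * cnj \<rho> = complex_of_real ((cmod \<rho>)\<^sup>2)"
  by (metis complex_norm_square)

text \<open>The columns of the channel form an autoregressive process of order one.\<close>

lemma kms_predictor_past:
  assumes "0 < k" "k < n"
  shows "predictor n (kms_matrix n \<rho>) k {..<k} (\<lambda>i. if i = k - 1 then \<rho> else 0) (1 - (cmod \<rho>)\<^sup>2)"
proof -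
  let ?K = "kms_matrix n \<rho>"
  have s: "(\<Sum>i\<in>{..<k}. (if i = k - 1 then \<rho> else 0) * ?K $$ (j, i)) = \<rho> * ?K $$ (j, k - 1)" for j
    by (rule sum_single_index) (use assms in auto)
  have "?K $$ (j, k) = \<rho> * ?K $$ (j, k - 1)" if "j < k" for j
    using that assms by (cases k) (auto simp: kms_index Suc_diff_le)
  moreover have "complex_of_real (1 - (cmod \<rho>)\<^sup>2) = ?K $$ (k, k) - \<rho> * ?K $$ (k, k - 1)"
    using assms by (simp add: kms_index cnj_times_self)
  ultimately show ?thesis unfolding predictor_def s using assms by auto
qed

text \<open>The autoregressive process is Markov in both directions, so only the two neighbours
  carry information about an interior column. The coefficients solve the two resulting normal
  equations; the remaining equations then hold with the same factor \<open>d\<close>.\<close>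

lemma kms_predictor_interior:
  fixes \<rho> :: complex
  assumes "0 < k" "Suc k < n"
  defines "d \<equiv> complex_of_real (1 + (cmod \<rho>)\<^sup>2)"
  shows "predictor n (kms_matrix n \<rho>) k ({..<n} - {k})
    (\<lambda>i. (if i = k - 1 then \<rho> / d else 0) + (if i = Suc k then cnj \<rho> / d else 0)) ((1 - (cmod \<rho>)\<^sup>2) / (1 + (cmod \<rho>)\<^sup>2))"
proof -
  let ?K = "kms_matrix n \<rho>" and ?J = "{..<n} - {k}"
  have d0: "d \<noteq> 0" unfolding d_def of_real_eq_0_iff using zero_le_power2[of "cmod \<rho>"] by linarith
  have d: "d = 1 + \<rho> * cnj \<rho>" by (simp add: d_def cnj_times_self)
  have s: "(\<Sum>i\<in>?J. ((if i = k - 1 then \<rho> / d else 0) + (if i = Suc k then cnj \<rho> / d else 0)) * ?K $$ (j, i)) =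
     \<rho> / d * ?K $$ (j, k - 1) + cnj \<rho> / d * ?K $$ (j, Suc k)" for j
    unfolding distrib_right sum.distrib by (intro arg_cong2[where f="(+)"] sum_single_index) (use assms in auto)
  have e: "\<rho> / d * x + cnj \<rho> / d * y = z" if "\<rho> * x + cnj \<rho> * y = d * z" for x y z
  proof -
    have "\<rho> / d * x + cnj \<rho> / d * y = (\<rho> * x + cnj \<rho> * y) / d" by (simp add: add_divide_distrib)
    then show ?thesis using that d0 by simp
  qed
  have "?K $$ (j, k) = \<rho> / d * ?K $$ (j, k - 1) + cnj \<rho> / d * ?K $$ (j, Suc k)" if "j < n" "j \<noteq> k" for j
  proof (rule e[symmetric], cases "j < k")
    case True
    then obtain p where p: "k = Suc (j + p)" using less_imp_Suc_add by blast
    have 1: "?K $$ (j, k - 1) = \<rho> ^ p" using that assms by (simp add: kms_index p)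
    have 2: "?K $$ (j, Suc k) = \<rho> ^ Suc (Suc p)" using that assms by (simp add: kms_index p)
    have 3: "?K $$ (j, k) = \<rho> ^ Suc p" using that assms by (simp add: kms_index p)
    show "\<rho> * ?K $$ (j, k - 1) + cnj \<rho> * ?K $$ (j, Suc k) = d * ?K $$ (j, k)"
      unfolding 1 2 3 d by (simp add: algebra_simps)
  next
    case False
    then have "k < j" using that by simp
    then obtain p where p: "j = Suc (k + p)" using less_imp_Suc_add by blast
    obtain l where l: "k = Suc l" using assms(1) by (cases k) auto
    \<comment> \<open>For \<open>p = 0\<close> the entry is diagonal and falls into the other branch
      of \<open>kms_matrix\<close>, hence the case split.\<close>
    have 2: "?K $$ (j, Suc k) = cnj \<rho> ^ p" using that assms by (cases p) (auto simp: kms_index p)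
    have 1: "?K $$ (j, k - 1) = cnj \<rho> ^ Suc (Suc p)" using that assms by (simp add: kms_index p l)
    have 3: "?K $$ (j, k) = cnj \<rho> ^ Suc p" using that assms by (simp add: kms_index p)
    show "\<rho> * ?K $$ (j, k - 1) + cnj \<rho> * ?K $$ (j, Suc k) = d * ?K $$ (j, k)"
      unfolding 1 2 3 d by (simp add: algebra_simps)
  qed
  moreover have "complex_of_real ((1 - (cmod \<rho>)\<^sup>2) / (1 + (cmod \<rho>)\<^sup>2)) = ?K $$ (k, k) - (\<rho> / d * ?K $$ (k, k - 1) + cnj \<rho> / d * ?K $$ (k, Suc k))"
  proof -
    have "?K $$ (k, k - 1) = cnj \<rho>" "?K $$ (k, Suc k) = \<rho>" "?K $$ (k, k) = 1"
      using assms by (simp_all add: kms_index)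
    moreover have "complex_of_real ((1 - (cmod \<rho>)\<^sup>2) / (1 + (cmod \<rho>)\<^sup>2)) = (1 - \<rho> * cnj \<rho>) / d"
      by (simp only: of_real_divide of_real_diff of_real_1 cnj_times_self d_def)
    moreover have "(1 - \<rho> * cnj \<rho>) / d = 1 - (\<rho> / d * cnj \<rho> + cnj \<rho> / d * \<rho>)"
      using d0 by (simp add: field_simps) (simp add: d)
    ultimately show ?thesis by simp
  qed
  ultimately show ?thesis unfolding predictor_def s using assms by auto
qed

section \<open>Linear independence and the removal of a column\<close>

definition independent_columns :: "nat \<Rightarrow> (nat \<Rightarrow> nat \<Rightarrow> complex) \<Rightarrow> nat \<Rightarrow> bool" where
  "independent_columns r w n \<longleftrightarrow> (\<forall>x. (\<forall>m<r. (\<Sum>j<n. x j * w j m) = 0) \<longrightarrow> (\<forall>j<n. x j = 0))"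

text \<open>Back substitution from the last column: taking residuals at stage \<open>j\<close> kills
  the earlier columns, and the later coefficients already vanish, so only \<open>x j\<close> times a
  nonzero vector is left.\<close>

lemma independent_columns_if_gs:
  assumes "\<And>i. i < n \<Longrightarrow> nsq r (gs r w i) \<noteq> 0"
  shows "independent_columns r w n"
proof -
  have "x j = 0" if x: "\<forall>m<r. (\<Sum>j<n. x j * w j m) = 0" and "j < n" for x j
    using \<open>j < n\<close>
  proof (induction j rule: measure_induct_rule[where f="\<lambda>j. n - j"])
    case (less j)
    have later: "x l = 0" if "j < l" "l < n" for l using less that by auto
    have "x j * gs r w j m = 0" if m: "m < r" for m
    proof -
      have "0 = resid r w j (\<lambda>m. \<Sum>l<n. x l * w l m) m"
        using resid_cong[of r "\<lambda>m. \<Sum>l<n. x l * w l m" "\<lambda>m. 0" j w w m] x m by (simp add: resid_zero)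
      also have "\<dots> = (\<Sum>l<n. x l * resid r w j (w l) m)" by (rule resid_sum) simp
      also have "\<dots> = (\<Sum>l<n. if l = j then x j * gs r w j m else 0)"
      proof (intro sum.cong refl)
        fix l assume "l \<in> {..<n}"
        then show "x l * resid r w j (w l) m = (if l = j then x j * gs r w j m else 0)"
          using later[of l] resid_vanish[of l j m r w] m by (cases l j rule: linorder_cases) auto
      qed
      also have "\<dots> = x j * gs r w j m" using less.prems by simp
      finally show ?thesis by simp
    qed
    moreover obtain m where "m < r" "gs r w j m \<noteq> 0"
      using assms[OF less.prems] by (auto simp: nsq_eq_0_iff)
    ultimately show ?case by auto
  qed
  then show ?thesis unfolding independent_columns_def by blast
qed

text \<open>A vanishing Gram-Schmidt vector expresses \<open>w i\<close> through its predecessors.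
  With the converse above, nondegeneracy does not depend on the order of the columns: it can be
  proved in the natural order and used after a column has been taken out.\<close>

lemma gs_nonzero_if_independent:
  assumes "independent_columns r w n" "i < n"
  shows "nsq r (gs r w i) \<noteq> 0"
proof
  assume z: "nsq r (gs r w i) = 0"
  obtain c where c: "\<And>m. w i m = gs r w i m + (\<Sum>j<i. c j * w j m)" using resid_span[of "w i" r w i] by blast
  define x where "x = (\<lambda>j. if j = i then 1 else if j < i then - c j else 0)"
  have "(\<Sum>j<n. x j * w j m) = 0" if "m < r" for m
  proof -
    have "(\<Sum>j<n. x j * w j m) = (\<Sum>j<Suc i. x j * w j m)"
      by (rule sum.mono_neutral_right) (use assms(2) in \<open>auto simp: x_def\<close>)
    also have "\<dots> = (\<Sum>j<i. - (c j * w j m)) + w i m"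
      by (simp add: x_def)
    also have "\<dots> = gs r w i m" by (subst c) (simp add: sum_negf)
    finally show ?thesis using z that by (simp add: nsq_eq_0_iff)
  qed
  then have "x i = 0" using assms unfolding independent_columns_def by blast
  then show False by (simp add: x_def)
qed

text \<open>The increasing enumeration of the indices other than \<open>k\<close>.\<close>

definition skip :: "nat \<Rightarrow> nat \<Rightarrow> nat" where "skip k j = (if j < k then j else Suc j)"

lemma skip_less: "k < n \<Longrightarrow> j < n - 1 \<Longrightarrow> skip k j < n" by (auto simp: skip_def)

lemma skip_neq [simp]: "skip k j \<noteq> k" by (auto simp: skip_def)

lemma skip_image: assumes "k < n" shows "skip k ` {..<n - 1} = {..<n} - {k}"
proof (intro equalityI subsetI)
  fix j assume "j \<in> {..<n} - {k}"
  then have "j = skip k (if j < k then j else j - 1)" "(if j < k then j else j - 1) < n - 1"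
    using assms by (auto simp: skip_def)
  then show "j \<in> skip k ` {..<n - 1}" by blast
qed (use assms in \<open>auto simp: skip_less\<close>)

lemma inj_skip: "inj_on (skip k) A" by (auto simp: inj_on_def skip_def split: if_splits)

lemma independent_columns_skip:
  assumes "independent_columns r w n" "k < n"
  shows "independent_columns r (\<lambda>j. w (skip k j)) (n - 1)"
  unfolding independent_columns_def
proof (intro allI impI)
  fix x j assume x: "\<forall>m<r. (\<Sum>j<n - 1. x j * w (skip k j) m) = 0" and j: "j < n - 1"
  define y where "y = (\<lambda>j. if j = k then 0 else x (if j < k then j else j - 1))"
  have y: "y (skip k l) = x l" for l by (auto simp: y_def skip_def)
  have "(\<Sum>j<n. y j * w j m) = 0" if "m < r" for m
  proof -
    have "(\<Sum>j<n. y j * w j m) = (\<Sum>j\<in>skip k ` {..<n - 1}. y j * w j m)"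
      unfolding skip_image[OF assms(2)] by (rule sum.mono_neutral_right) (auto simp: y_def)
    also have "\<dots> = (\<Sum>l<n - 1. x l * w (skip k l) m)"
      by (subst sum.reindex[OF inj_skip]) (simp add: y)
    finally show ?thesis using x that by simp
  qed
  then have "y (skip k j) = 0" using assms skip_less[OF assms(2) j] unfolding independent_columns_def by blast
  then show "x j = 0" by (simp add: y)
qed

text \<open>Lets a column be exchanged for its innovation, which differs from it by a combination of
  columns that are projected out.\<close>

lemma resid_subtract_span:
  assumes "finite J" "\<And>j. j \<in> J \<Longrightarrow> \<exists>l<p. v j = w l" "m < r"
  shows "resid r w p (\<lambda>m. x m - (\<Sum>j\<in>J. c j * v j m)) m = resid r w p x m"
proof -
  have "resid r w p (\<lambda>m. x m - (\<Sum>j\<in>J. c j * v j m)) m = resid r w p (\<lambda>m. x m + (\<Sum>j\<in>J. (- c j) * v j m)) m"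
    by (simp add: sum_negf)
  also have "\<dots> = resid r w p x m + (\<Sum>j\<in>J. - c j * resid r w p (v j) m)"
    unfolding resid_add resid_sum[OF assms(1)] ..
  also have "(\<Sum>j\<in>J. - c j * resid r w p (v j) m) = 0"
  proof (rule sum.neutral, rule ballI)
    fix j assume "j \<in> J"
    then obtain l where "l < p" "v j = w l" using assms(2) by blast
    then show "- c j * resid r w p (v j) m = 0" using resid_vanish[of l p m r w] assms(3) by simp
  qed
  finally show ?thesis by simp
qed

context mimo_system
begin

definition column :: "'w \<Rightarrow> nat \<Rightarrow> nat \<Rightarrow> complex" where "column \<omega> j m = H \<omega> $$ (m, j)"

text \<open>Gram-Schmidt looks only backwards, so the suitable predictor uses the earlier columns.
  Its residual variance, \<open>1 - |\<rho>|^2\<close> or 1 for the first column, is positive, and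
  \<open>i < Nr\<close> directions are not enough to absorb a nondegenerate innovation.\<close>

lemma full_rank_AE:
  assumes \<Sigma>: "\<Sigma> = kms_matrix Nt \<rho>" and "cmod \<rho> < 1" and "Nt \<le> Nr"
  shows "AE \<omega> in \<Omega>. independent_columns Nr (column \<omega>) Nt"
proof -
  have "AE \<omega> in \<Omega>. nsq Nr (gs Nr (column \<omega>) i) \<noteq> 0" if i: "i < Nt" for i
  proof -
    obtain c \<tau>2 where p: "predictor Nt \<Sigma> i {..<i} c \<tau>2" and t: "0 < \<tau>2"
    proof (cases "i = 0")
      case True
      then show thesis using that[of "\<lambda>_. 0" 1] kms_predictor_first[of Nt \<rho>] i by (auto simp: \<Sigma>)
    next
      case False
      then have "0 < 1 - (cmod \<rho>)\<^sup>2" using assms(2) by (simp add: power_less_one_iff abs_square_less_1)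
      then show thesis using that kms_predictor_past[of i Nt \<rho>] False i by (auto simp: \<Sigma>)
    qed
    have h: "\<Sigma> $$ (a, b) = cnj (\<Sigma> $$ (b, a))" if "a < Nt" "b < Nt" for a b
      unfolding \<Sigma> by (rule kms_hermitian[OF that])
    let ?P = "\<lambda>x w. nsq Nr (resid Nr w i x) = 0"
    have "prob {\<omega>\<in>space \<Omega>. ?P (\<lambda>m. innovation i {..<i} c m \<omega>) (\<lambda>j m. H \<omega> $$ (m, j))} \<le> 0"
    proof (rule innovation_prob_le[OF p h])
      have "(\<lambda>f. nsq Nr (resid Nr (\<lambda>j m. f (m, j)) i (\<lambda>m. f (m, i)))) \<in>
          borel_measurable (Pi\<^sub>M ({..<Nr} \<times> insert i {..<i}) (\<lambda>_. borel :: complex measure))"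
        by (intro nsq_measurable resid_measurable measurable_component_singleton) auto
      then show "Measurable.pred (Pi\<^sub>M ({..<Nr} \<times> insert i {..<i}) (\<lambda>_. borel :: complex measure))
          (\<lambda>f. nsq Nr (resid Nr (\<lambda>j m. f (m, j)) i (\<lambda>m. f (m, i))) = 0)" by measurable
      show "(nsq Nr (resid Nr w i x) = 0) = (nsq Nr (resid Nr w' i x') = 0)"
        if "\<And>m. m < Nr \<Longrightarrow> x m = x' m" "\<And>m j. m < Nr \<Longrightarrow> j \<in> {..<i} \<Longrightarrow> w j m = w' j m" for x x' w w'
        by (intro arg_cong[where f="\<lambda>y. y = 0"] nsq_cong resid_cong) (use that in auto)
      show "prob {\<omega>\<in>space \<Omega>. nsq Nr (resid Nr w i (\<lambda>m. innovation i {..<i} c m \<omega>)) = 0} \<le> 0" for w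
        using resid_nonzero_prob[OF prob_space_axioms innovation_combination[OF p h] t, of i w] t i assms(3) by simp
    qed
    moreover have eq: "nsq Nr (resid Nr (\<lambda>j m. H \<omega> $$ (m, j)) i (\<lambda>m. innovation i {..<i} c m \<omega>)) = nsq Nr (gs Nr (column \<omega>) i)" for \<omega>
      unfolding innovation_def column_def[abs_def]
      by (rule nsq_cong, rule resid_subtract_span[where v="\<lambda>j m. H \<omega> $$ (m, j)"]) auto
    ultimately have 0: "prob {\<omega>\<in>space \<Omega>. nsq Nr (gs Nr (column \<omega>) i) = 0} = 0"
      unfolding eq by (simp only: measure_le_0_iff)
    have "(\<lambda>\<omega>. nsq Nr (gs Nr (column \<omega>) i)) \<in> borel_measurable \<Omega>"
      by (intro nsq_measurable resid_measurable) (use i in \<open>auto simp: column_def intro!: H_entry_measurable\<close>)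
    then have "{\<omega>\<in>space \<Omega>. nsq Nr (gs Nr (column \<omega>) i) = 0} \<in> events" by measurable
    from prob_eq_0[OF this] 0 show ?thesis by auto
  qed
  then have "AE \<omega> in \<Omega>. \<forall>i\<in>{..<Nt}. nsq Nr (gs Nr (column \<omega>) i) \<noteq> 0"
    by (intro AE_finite_allI) auto
  then show ?thesis by eventually_elim (rule independent_columns_if_gs, auto)
qed

text \<open>The nondegeneracy of the Gram-Schmidt vectors is part of the event because the estimate
  for frozen columns needs it; for degenerate frozen columns the event is empty. Almost sure full
  rank removes this condition later.\<close>

lemma interior_concentration:
  assumes \<Sigma>: "\<Sigma> = kms_matrix Nt \<rho>" and "cmod \<rho> < 1" and "0 < k" "Suc k < Nt" "0 < a"
  defines "t \<equiv> (1 - (cmod \<rho>)\<^sup>2) / (1 + (cmod \<rho>)\<^sup>2)"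
  shows "prob {\<omega>\<in>space \<Omega>. (\<forall>j<Nt - 1. nsq Nr (gs Nr (\<lambda>l. column \<omega> (skip k l)) j) \<noteq> 0) \<and>
      a \<le> \<bar>nsq Nr (resid Nr (\<lambda>l. column \<omega> (skip k l)) (Nt - 1) (column \<omega> k)) - (real Nr - real (Nt - 1)) * t\<bar>}
    \<le> 2 * (real Nr + real (Nt - 1)) * t\<^sup>2 / a\<^sup>2"
proof -
  let ?J = "{..<Nt} - {k}" and ?B = "2 * (real Nr + real (Nt - 1)) * t\<^sup>2 / a\<^sup>2"
  obtain c where p: "predictor Nt \<Sigma> k ?J c t"
    using kms_predictor_interior[of k Nt \<rho>] assms(3,4) unfolding \<Sigma> t_def by blast
  have k: "k < Nt" using assms(4) by simp
  have t: "0 \<le> t" using assms(2) by (simp add: t_def abs_square_le_1 power_le_one)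
  have h: "\<Sigma> $$ (a, b) = cnj (\<Sigma> $$ (b, a))" if "a < Nt" "b < Nt" for a b
    unfolding \<Sigma> by (rule kms_hermitian[OF that])
  define P where "P = (\<lambda>x w. (\<forall>j<Nt - 1. nsq Nr (gs Nr (\<lambda>l. w (skip k l)) j) \<noteq> 0) \<and>
      a \<le> \<bar>nsq Nr (resid Nr (\<lambda>l. w (skip k l)) (Nt - 1) x) - (real Nr - real (Nt - 1)) * t\<bar>)"
  have sk: "skip k j \<in> ?J" if "j < Nt - 1" for j using skip_image[OF k] that by blast
  have "prob {\<omega>\<in>space \<Omega>. P (\<lambda>m. innovation k ?J c m \<omega>) (\<lambda>j m. H \<omega> $$ (m, j))} \<le> ?B"
  proof (rule innovation_prob_le[OF p h])
    let ?M = "Pi\<^sub>M ({..<Nr} \<times> insert k ?J) (\<lambda>_. borel :: complex measure)"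
    have 1: "(\<lambda>f. nsq Nr (resid Nr (\<lambda>l m. f (m, skip k l)) (Nt - 1) (\<lambda>m. f (m, k)))) \<in> borel_measurable ?M"
      by (intro nsq_measurable resid_measurable measurable_component_singleton) (use sk in auto)
    have 2: "(\<lambda>f. nsq Nr (gs Nr (\<lambda>l m. f (m, skip k l)) j)) \<in> borel_measurable ?M" if "j < Nt - 1" for j
      by (intro nsq_measurable resid_measurable measurable_component_singleton) (use sk that in auto)
    have "Measurable.pred ?M (\<lambda>f. \<forall>j\<in>{..<Nt - 1}. nsq Nr (gs Nr (\<lambda>l m. f (m, skip k l)) j) \<noteq> 0)"
      by (intro pred_intros_finite) (use 2 in \<open>auto\<close>)
    then show "Measurable.pred ?M (\<lambda>f. P (\<lambda>m. f (m, k)) (\<lambda>j m. f (m, j)))"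
      unfolding P_def Ball_def lessThan_iff using 1 by measurable
    show "P x w = P x' w'"
      if x: "\<And>m. m < Nr \<Longrightarrow> x m = x' m" and w: "\<And>m j. m < Nr \<Longrightarrow> j \<in> ?J \<Longrightarrow> w j m = w' j m" for x x' w w'
    proof -
      have "nsq Nr (gs Nr (\<lambda>l. w (skip k l)) j) = nsq Nr (gs Nr (\<lambda>l. w' (skip k l)) j)" if "j < Nt - 1" for j
        by (intro nsq_cong resid_cong w) (use sk that in auto)
      moreover have "nsq Nr (resid Nr (\<lambda>l. w (skip k l)) (Nt - 1) x) = nsq Nr (resid Nr (\<lambda>l. w' (skip k l)) (Nt - 1) x')"
        by (intro nsq_cong resid_cong w x) (use sk in auto)
      ultimately show ?thesis unfolding P_def by simp
    qed
    show "prob {\<omega>\<in>space \<Omega>. P (\<lambda>m. innovation k ?J c m \<omega>) w} \<le> ?B" for w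
    proof (cases "\<forall>j<Nt - 1. nsq Nr (gs Nr (\<lambda>l. w (skip k l)) j) \<noteq> 0")
      case True
      then show ?thesis unfolding P_def
        using resid_concentration[OF prob_space_axioms innovation_combination[OF p h t], where w="\<lambda>l. w (skip k l)" and p="Nt - 1" and a=a] assms(5) by simp
    next
      case False
      then have "{\<omega>\<in>space \<Omega>. P (\<lambda>m. innovation k ?J c m \<omega>) w} = {}" unfolding P_def by blast
      moreover have "0 \<le> ?B" by (intro divide_nonneg_nonneg mult_nonneg_nonneg) auto
      ultimately show ?thesis by (simp only: measure_empty)
    qed
  qed
  moreover have "P (\<lambda>m. innovation k ?J c m \<omega>) (\<lambda>j m. H \<omega> $$ (m, j)) =
     ((\<forall>j<Nt - 1. nsq Nr (gs Nr (\<lambda>l. column \<omega> (skip k l)) j) \<noteq> 0) \<and>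
      a \<le> \<bar>nsq Nr (resid Nr (\<lambda>l. column \<omega> (skip k l)) (Nt - 1) (column \<omega> k)) - (real Nr - real (Nt - 1)) * t\<bar>)" for \<omega>
  proof -
    have "nsq Nr (resid Nr (\<lambda>l m. H \<omega> $$ (m, skip k l)) (Nt - 1) (\<lambda>m. innovation k ?J c m \<omega>)) =
        nsq Nr (resid Nr (\<lambda>l m. H \<omega> $$ (m, skip k l)) (Nt - 1) (\<lambda>m. H \<omega> $$ (m, k)))"
      unfolding innovation_def
    proof (rule nsq_cong, rule resid_subtract_span[where v="\<lambda>j m. H \<omega> $$ (m, j)"])
      fix j assume "j \<in> ?J"
      then obtain l where "l < Nt - 1" "j = skip k l" using skip_image[OF k] by blast
      then show "\<exists>l<Nt - 1. (\<lambda>m. H \<omega> $$ (m, j)) = (\<lambda>m. H \<omega> $$ (m, skip k l))" by blast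
    qed auto
    then show ?thesis unfolding P_def column_def[abs_def] by simp
  qed
  ultimately show ?thesis by simp
qed

end

section \<open>Zero-forcing and nearest symbols\<close>

lemma mat_adjoint_carrier: "A \<in> carrier_mat r n \<Longrightarrow> mat_adjoint (A :: complex mat) \<in> carrier_mat n r"
  by (auto simp: mat_adjoint_def)

lemma mat_adjoint_index:
  assumes "A \<in> carrier_mat r n" "i < n" "m < r"
  shows "mat_adjoint (A :: complex mat) $$ (i, m) = cnj (A $$ (m, i))"
  using assms by (auto simp: mat_adjoint_def mat_of_rows_def)

lemma mult_mat_index:
  assumes "A \<in> carrier_mat r n" "B \<in> carrier_mat n l" "i < r" "j < l"
  shows "(A * B) $$ (i, j) = (\<Sum>m<n. A $$ (i, m) * B $$ (m, j))"
  using assms by (auto simp: scalar_prod_def atLeast0LessThan intro!: sum.cong)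

lemma gram_index:
  assumes "A \<in> carrier_mat r n" "i < n" "j < n"
  shows "(mat_adjoint A * A) $$ (i, j) = (\<Sum>m<r. cnj (A $$ (m, i)) * A $$ (m, j))"
  using assms by (subst mult_mat_index[OF mat_adjoint_carrier]) (auto simp: mat_adjoint_index)

text \<open>For a kernel vector \<open>v\<close> of the Gram matrix, the quadratic form at
  \<open>v\<close> is the squared norm of \<open>A\<close> applied to \<open>v\<close>, which
  therefore vanishes.\<close>

lemma det_gram_nonzero:
  assumes A: "A \<in> carrier_mat r n" and ind: "independent_columns r (\<lambda>j m. A $$ (m, j)) n"
  shows "det (mat_adjoint A * A) \<noteq> 0"
proof
  assume d: "det (mat_adjoint A * A) = 0"
  have G: "mat_adjoint A * A \<in> carrier_mat n n" using mat_adjoint_carrier[OF A] A by auto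
  obtain v where v: "v \<in> carrier_vec n" "v \<noteq> 0\<^sub>v n" "(mat_adjoint A * A) *\<^sub>v v = 0\<^sub>v n"
    using d unfolding det_0_iff_vec_prod_zero_field[OF G] by blast
  let ?y = "\<lambda>m. \<Sum>j<n. v $ j * A $$ (m, j)"
  have row: "(\<Sum>j<n. (\<Sum>m<r. cnj (A $$ (m, i)) * A $$ (m, j)) * v $ j) = 0" if "i < n" for i
  proof -
    have "0 = ((mat_adjoint A * A) *\<^sub>v v) $ i" using v that by simp
    also have "\<dots> = (\<Sum>j<n. (mat_adjoint A * A) $$ (i, j) * v $ j)"
      using v(1) that A mat_adjoint_carrier[OF A] by (simp add: mult_mat_vec_def scalar_prod_def atLeast0LessThan)
    finally show ?thesis using that A by (simp add: gram_index[OF A])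
  qed
  have "complex_of_real (nsq r ?y) = cip r ?y ?y" by (simp add: cip_self)
  also have "\<dots> = (\<Sum>m<r. \<Sum>i<n. cnj (v $ i) * (cnj (A $$ (m, i)) * ?y m))"
    by (simp add: cip_def cnj_sum sum_distrib_right mult.assoc)
  also have "\<dots> = (\<Sum>i<n. \<Sum>m<r. cnj (v $ i) * (cnj (A $$ (m, i)) * ?y m))" by (rule sum.swap)
  also have "\<dots> = (\<Sum>i<n. cnj (v $ i) * (\<Sum>m<r. \<Sum>j<n. cnj (A $$ (m, i)) * A $$ (m, j) * v $ j))"
    by (simp add: sum_distrib_left mult_ac)
  also have "\<dots> = (\<Sum>i<n. cnj (v $ i) * 0)"
  proof (intro sum.cong refl arg_cong2[where f=times])
    fix i assume "i \<in> {..<n}"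
    have "(\<Sum>m<r. \<Sum>j<n. cnj (A $$ (m, i)) * A $$ (m, j) * v $ j) = (\<Sum>j<n. \<Sum>m<r. cnj (A $$ (m, i)) * A $$ (m, j) * v $ j)"
      by (rule sum.swap)
    then show "(\<Sum>m<r. \<Sum>j<n. cnj (A $$ (m, i)) * A $$ (m, j) * v $ j) = 0"
      using row[of i] \<open>i \<in> {..<n}\<close> by (simp add: sum_distrib_right)
  qed
  finally have "nsq r ?y = 0" by simp
  then have "\<forall>j<n. v $ j = 0" using ind unfolding independent_columns_def nsq_eq_0_iff by blast
  then show False using v(1,2) by (auto simp: vec_eq_iff)
qed

text \<open>Inverses are unique, so the result of the elimination algorithm is given by Cramer's
  formula. Its entries are quotients of polynomials in the entries of \<open>G\<close>, which makes
  the measurability of the detector accessible.\<close>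

lemma mat_inverse_adj:
  fixes G :: "complex mat"
  assumes G: "G \<in> carrier_mat n n"
  shows "mat_inverse G = (if det G = 0 then None else Some ((1 / det G) \<cdot>\<^sub>m adj_mat G))"
proof (cases "mat_inverse G")
  case None
  then have "G \<notin> Units (ring_mat TYPE(complex) n ())" by (rule mat_inverse(1)[OF G])
  then show ?thesis using None det_non_zero_imp_unit[OF G, where b="()"] by auto
next
  case (Some B)
  then have B: "G * B = 1\<^sub>m n" "B * G = 1\<^sub>m n" "B \<in> carrier_mat n n" using mat_inverse(2)[OF G] by auto
  have d: "det G \<noteq> 0" using det_mult[OF B(3) G] B(2) by auto
  let ?C = "(1 / det G) \<cdot>\<^sub>m adj_mat G"
  have C: "?C \<in> carrier_mat n n" "G * ?C = 1\<^sub>m n"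
    using adj_mat[OF G] G d by (auto simp: mult_smult_distrib intro!: eq_matI)
  have "B = B * (G * ?C)" using B C by simp
  also have "\<dots> = (B * G) * ?C" by (rule assoc_mult_mat[symmetric, OF B(3) G C(1)])
  also have "\<dots> = ?C" unfolding B(2) by (rule left_mult_one_mat[OF C(1)])
  finally show ?thesis using Some d by simp
qed

lemma zf_pinv_carrier:
  assumes A: "A \<in> carrier_mat r n" shows "zf_pinv A \<in> carrier_mat n r"
proof -
  have G: "mat_adjoint A * A \<in> carrier_mat n n" using mat_adjoint_carrier[OF A] A by auto
  show ?thesis unfolding zf_pinv_def mat_inverse_adj[OF G]
    using A mat_adjoint_carrier[OF A] adj_mat(1)[OF G] by auto
qed

lemma zf_pinv_index:
  assumes A: "A \<in> carrier_mat r n" and "k < n" "m < r"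
  shows "zf_pinv A $$ (k, m) = (if det (mat_adjoint A * A) = 0 then 0 else
    (\<Sum>i<n. (adj_mat (mat_adjoint A * A) $$ (k, i) / det (mat_adjoint A * A)) * cnj (A $$ (m, i))))"
proof -
  have G: "mat_adjoint A * A \<in> carrier_mat n n" using mat_adjoint_carrier[OF A] A by auto
  show ?thesis
  proof (cases "det (mat_adjoint A * A) = 0")
    case True
    then show ?thesis unfolding zf_pinv_def mat_inverse_adj[OF G] using assms by auto
  next
    case False
    have "(((1 / det (mat_adjoint A * A)) \<cdot>\<^sub>m adj_mat (mat_adjoint A * A)) * mat_adjoint A) $$ (k, m) =
       (\<Sum>i<n. ((1 / det (mat_adjoint A * A)) \<cdot>\<^sub>m adj_mat (mat_adjoint A * A)) $$ (k, i) * mat_adjoint A $$ (i, m))"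
      by (rule mult_mat_index) (use assms adj_mat(1)[OF G] mat_adjoint_carrier[OF A] in auto)
    also have "\<dots> = (\<Sum>i<n. (adj_mat (mat_adjoint A * A) $$ (k, i) / det (mat_adjoint A * A)) * cnj (A $$ (m, i)))"
      using assms adj_mat(1)[OF G] by (intro sum.cong refl) (auto simp: mat_adjoint_index)
    finally show ?thesis using False unfolding zf_pinv_def mat_inverse_adj[OF G] by simp
  qed
qed

lemma zf_pinv_left_inverse:
  assumes A: "A \<in> carrier_mat r n" and d: "det (mat_adjoint A * A) \<noteq> 0" and "k < n" "j < n"
  shows "(\<Sum>m<r. zf_pinv A $$ (k, m) * A $$ (m, j)) = (if j = k then 1 else 0)"
proof -
  have G: "mat_adjoint A * A \<in> carrier_mat n n" using mat_adjoint_carrier[OF A] A by auto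
  let ?B = "(1 / det (mat_adjoint A * A)) \<cdot>\<^sub>m adj_mat (mat_adjoint A * A)"
  have B: "?B \<in> carrier_mat n n" using adj_mat(1)[OF G] by auto
  have "zf_pinv A * A = ?B * mat_adjoint A * A" using d unfolding zf_pinv_def mat_inverse_adj[OF G] by simp
  also have "\<dots> = ?B * (mat_adjoint A * A)" by (rule assoc_mult_mat[OF B mat_adjoint_carrier[OF A] A])
  also have "\<dots> = 1\<^sub>m n" using adj_mat[OF G] G d by (auto simp: mult_smult_assoc_mat intro!: eq_matI)
  finally have "(zf_pinv A * A) $$ (k, j) = (1\<^sub>m n) $$ (k, j)" by simp
  then show ?thesis using mult_mat_index[OF zf_pinv_carrier[OF A] A] assms(3,4) by auto
qed

lemma zf_output_index:
  assumes "H * F \<in> carrier_mat r n" "s \<in> carrier_vec n" "x \<in> carrier_vec r" "k < n"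
  shows "zf_output F H s x $ k = (\<Sum>m<r. zf_pinv (H * F) $$ (k, m) * ((\<Sum>j<n. (H * F) $$ (m, j) * s $ j) + x $ m))"
proof -
  define A where "A = H * F"
  have A: "A \<in> carrier_mat r n" using assms(1) by (simp add: A_def)
  have r: "(A *\<^sub>v s + x) $ m = (\<Sum>j<n. A $$ (m, j) * s $ j) + x $ m" if "m < r" for m
    using assms that A by (simp add: mult_mat_vec_def scalar_prod_def atLeast0LessThan)
  have "zf_output F H s x $ k = (\<Sum>m<r. zf_pinv A $$ (k, m) * (A *\<^sub>v s + x) $ m)"
    unfolding zf_output_def A_def[symmetric] Let_def
    using zf_pinv_carrier[OF A] assms A by (simp add: mult_mat_vec_def scalar_prod_def atLeast0LessThan)
  then show ?thesis using r by (simp add: A_def)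
qed

lemma zf_output_nonsingular:
  assumes A: "H * F \<in> carrier_mat r n" "s \<in> carrier_vec n" "x \<in> carrier_vec r" "k < n"
    and d: "det (mat_adjoint (H * F) * (H * F)) \<noteq> 0"
  shows "zf_output F H s x $ k = s $ k + (\<Sum>m<r. zf_pinv (H * F) $$ (k, m) * x $ m)"
proof -
  let ?A = "H * F"
  have "(\<Sum>m<r. zf_pinv ?A $$ (k, m) * (\<Sum>j<n. ?A $$ (m, j) * s $ j)) = (\<Sum>m<r. \<Sum>j<n. s $ j * (zf_pinv ?A $$ (k, m) * ?A $$ (m, j)))"
    by (simp add: sum_distrib_left mult_ac)
  also have "\<dots> = (\<Sum>j<n. \<Sum>m<r. s $ j * (zf_pinv ?A $$ (k, m) * ?A $$ (m, j)))" by (rule sum.swap)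
  also have "\<dots> = (\<Sum>j<n. s $ j * (\<Sum>m<r. zf_pinv ?A $$ (k, m) * ?A $$ (m, j)))"
    by (simp only: sum_distrib_left)
  also have "\<dots> = (\<Sum>j<n. if j = k then s $ j else 0)"
    by (intro sum.cong refl) (auto simp: zf_pinv_left_inverse[OF A(1) d A(4)])
  also have "\<dots> = s $ k" using A(4) by simp
  finally show ?thesis unfolding zf_output_index[OF A] by (simp add: distrib_left sum.distrib)
qed

text \<open>The noise amplification of a stream is the inverse squared distance of its column from the
  span of the other columns.\<close>

lemma dual_row_norm:
  assumes k: "k < n" and dual: "\<And>j. j < n \<Longrightarrow> (\<Sum>m<r. b m * h j m) = (if j = k then d else 0)"
    and span: "\<And>m. m < r \<Longrightarrow> cnj (b m) = (\<Sum>j<n. x j * h j m)"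
  shows "nsq r b * nsq r (resid r (\<lambda>l. h (skip k l)) (n - 1) (h k)) = (cmod d)\<^sup>2"
proof -
  let ?w = "\<lambda>l. h (skip k l)" and ?p = "n - 1"
  define u where "u = (\<lambda>m. cnj (b m))"
  let ?Q = "resid r ?w ?p"
  have cu: "cip r u (h j) = (if j = k then d else 0)" if "j < n" for j
    using dual[OF that] by (simp add: cip_def u_def)
  have ugs: "cip r u (gs r ?w i) = 0" if i: "i < ?p" for i
  proof -
    obtain c where c: "\<And>m. ?w i m = gs r ?w i m + (\<Sum>j<i. c j * ?w j m)" using resid_span[of "?w i" r ?w i] by blast
    have z: "cip r u (?w j) = 0" if "j < ?p" for j
      using cu[OF skip_less[OF k that]] by simp
    have "cip r u (?w i) = cip r u (gs r ?w i) + (\<Sum>j<i. c j * cip r u (?w j))"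
      by (subst c[abs_def]) (simp only: cip_add_right cip_sum_right cip_scale_right)
    then show ?thesis using z i by simp
  qed
  \<comment> \<open>Orthogonality to the other columns makes \<open>u\<close> a fixed point of the
    projection. As \<open>u\<close> also lies in the span of all columns, it is a multiple of the
    residual of column \<open>k\<close>.\<close>
  have "?Q u = u"
  proof -
    have "cip r (gs r ?w i) u = 0" if "i < ?p" for i using ugs[OF that] cip_cnj[of r "gs r ?w i" u] by simp
    then show ?thesis by (subst resid_closed_form) simp
  qed
  have Qu: "u m = x k * ?Q (h k) m" if m: "m < r" for m
  proof -
    have "u m = ?Q u m" using \<open>?Q u = u\<close> by simp
    also have "\<dots> = ?Q (\<lambda>m. \<Sum>j<n. x j * h j m) m"
      by (rule resid_cong) (use span m in \<open>auto simp: u_def\<close>)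
    also have "\<dots> = (\<Sum>j<n. x j * ?Q (h j) m)" by (rule resid_sum) simp
    also have "\<dots> = (\<Sum>j<n. if j = k then x j * ?Q (h j) m else 0)"
    proof (intro sum.cong refl)
      fix j assume j: "j \<in> {..<n}"
      show "x j * ?Q (h j) m = (if j = k then x j * ?Q (h j) m else 0)"
      proof (cases "j = k")
        case False
        then obtain l where "l < ?p" "j = skip k l" using skip_image[OF k] j by blast
        then show ?thesis using resid_vanish[of l ?p m r ?w] m False by simp
      qed simp
    qed
    also have "\<dots> = x k * ?Q (h k) m" using k by simp
    finally show ?thesis .
  qed
  have n1: "nsq r b = (cmod (x k))\<^sup>2 * nsq r (?Q (h k))"
  proof -
    have "nsq r b = nsq r u" by (simp add: nsq_def u_def)
    also have "\<dots> = nsq r (\<lambda>m. x k * ?Q (h k) m)" using Qu by (rule nsq_cong)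
    finally show ?thesis by (simp add: nsq_def norm_mult power_mult_distrib sum_distrib_left)
  qed
  \<comment> \<open>Pairing with column \<open>k\<close> determines the multiple: the modulus of
    \<open>d\<close> is that of \<open>x k\<close> times the squared residual norm.\<close>
  have "d = cip r u (h k)" using cu[OF k] by simp
  also have "\<dots> = cip r (\<lambda>m. x k * ?Q (h k) m) (h k)" by (rule cip_cong[OF Qu refl])
  also have "\<dots> = cnj (x k) * cip r (?Q (h k)) (h k)" by (simp add: cip_def sum_distrib_left mult.assoc)
  also have "cip r (?Q (h k)) (h k) = cnj (cip r (h k) (?Q (h k)))" by (rule cip_cnj)
  also have "cip r (h k) (?Q (h k)) = cip r (?Q (h k)) (?Q (h k))" by (rule cip_resid_resid[symmetric])
  finally have "d = cnj (x k) * complex_of_real (nsq r (?Q (h k)))" by (simp add: cip_self)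
  then have "(cmod d)\<^sup>2 = (cmod (x k))\<^sup>2 * (nsq r (?Q (h k)))\<^sup>2" by (simp add: norm_mult power_mult_distrib)
  then show ?thesis unfolding n1 by (simp add: power2_eq_square)
qed

section \<open>Measurability of the detector\<close>

lemma det_measurable:
  fixes X :: "'a \<Rightarrow> complex mat"
  assumes "\<And>\<omega>. \<omega> \<in> space M \<Longrightarrow> X \<omega> \<in> carrier_mat n n"
    and m: "\<And>i j. i < n \<Longrightarrow> j < n \<Longrightarrow> (\<lambda>\<omega>. X \<omega> $$ (i, j)) \<in> borel_measurable M"
  shows "(\<lambda>\<omega>. det (X \<omega>)) \<in> borel_measurable M"
proof (subst measurable_cong)
  show "det (X \<omega>) = (\<Sum>p | p permutes {0..<n}. signof p * (\<Prod>i = 0..<n. X \<omega> $$ (i, p i)))" if "\<omega> \<in> space M" for \<omega>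
    using det_def'[OF assms(1)[OF that]] by simp
  have "(\<lambda>\<omega>. X \<omega> $$ (i, p i)) \<in> borel_measurable M" if "p permutes {0..<n}" "i \<in> {0..<n}" for p i
    using that permutes_in_image[OF that(1), of i] by (intro m) auto
  then show "(\<lambda>\<omega>. \<Sum>p | p permutes {0..<n}. signof p * (\<Prod>i = 0..<n. X \<omega> $$ (i, p i))) \<in> borel_measurable M"
    by (intro borel_measurable_sum borel_measurable_times borel_measurable_const borel_measurable_prod) auto
qed

lemma zf_pinv_measurable:
  fixes A :: "'a \<Rightarrow> complex mat"
  assumes A: "\<And>\<omega>. \<omega> \<in> space M \<Longrightarrow> A \<omega> \<in> carrier_mat r n"
    and m [measurable]: "\<And>i j. i < r \<Longrightarrow> j < n \<Longrightarrow> (\<lambda>\<omega>. A \<omega> $$ (i, j)) \<in> borel_measurable M"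
    and "k < n" "l < r"
  shows "(\<lambda>\<omega>. zf_pinv (A \<omega>) $$ (k, l)) \<in> borel_measurable M"
proof -
  let ?G = "\<lambda>\<omega>. mat_adjoint (A \<omega>) * A \<omega>"
  have G: "?G \<omega> \<in> carrier_mat n n" if "\<omega> \<in> space M" for \<omega> using mat_adjoint_carrier[OF A[OF that]] A[OF that] by auto
  have Gm: "(\<lambda>\<omega>. ?G \<omega> $$ (i, j)) \<in> borel_measurable M" if "i < n" "j < n" for i j
  proof (subst measurable_cong)
    show "?G \<omega> $$ (i, j) = (\<Sum>m<r. cnj (A \<omega> $$ (m, i)) * A \<omega> $$ (m, j))" if "\<omega> \<in> space M" for \<omega>
      by (rule gram_index) (use A that \<open>i < n\<close> \<open>j < n\<close> in auto)
    show "(\<lambda>\<omega>. \<Sum>m<r. cnj (A \<omega> $$ (m, i)) * A \<omega> $$ (m, j)) \<in> borel_measurable M" using that by measurable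
  qed
  have dm [measurable]: "(\<lambda>\<omega>. det (?G \<omega>)) \<in> borel_measurable M" by (rule det_measurable[OF G Gm])
  have am [measurable]: "(\<lambda>\<omega>. adj_mat (?G \<omega>) $$ (k, i)) \<in> borel_measurable M" if i: "i < n" for i
  proof (subst measurable_cong)
    show "adj_mat (?G \<omega>) $$ (k, i) = (-1) ^ (i + k) * det (mat_delete (?G \<omega>) i k)" if "\<omega> \<in> space M" for \<omega>
    proof -
      have "adj_mat g $$ (k, i) = (-1) ^ (i + k) * det (mat_delete g i k)" if "g \<in> carrier_mat n n" for g :: "complex mat"
        using that \<open>k < n\<close> i by (auto simp: adj_mat_def cofactor_def)
      then show ?thesis using G[OF that] by blast
    qed
    have "(\<lambda>\<omega>. det (mat_delete (?G \<omega>) i k)) \<in> borel_measurable M"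
    proof (rule det_measurable)
      show "mat_delete (?G \<omega>) i k \<in> carrier_mat (n - 1) (n - 1)" if "\<omega> \<in> space M" for \<omega>
        by (rule mat_delete_carrier[OF G[OF that]])
      fix i' j' assume ij: "i' < n - 1" "j' < n - 1"
      let ?i = "if i' < i then i' else Suc i'" and ?j = "if j' < k then j' else Suc j'"
      show "(\<lambda>\<omega>. mat_delete (?G \<omega>) i k $$ (i', j')) \<in> borel_measurable M"
      proof (subst measurable_cong)
        show "mat_delete (?G \<omega>) i k $$ (i', j') = ?G \<omega> $$ (?i, ?j)" if "\<omega> \<in> space M" for \<omega>
        proof -
          have "mat_delete g i k $$ (i', j') = g $$ (?i, ?j)" if "g \<in> carrier_mat n n" for g :: "complex mat"
            using that ij by (auto simp: mat_delete_def)
          then show ?thesis using G[OF that] by blast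
        qed
        show "(\<lambda>\<omega>. ?G \<omega> $$ (?i, ?j)) \<in> borel_measurable M" by (rule Gm) (use ij in auto)
      qed
    qed
    then show "(\<lambda>\<omega>. (-1) ^ (i + k) * det (mat_delete (?G \<omega>) i k)) \<in> borel_measurable M" by measurable
  qed
  show ?thesis
  proof (subst measurable_cong)
    show "zf_pinv (A \<omega>) $$ (k, l) = (if det (?G \<omega>) = 0 then 0 else
       (\<Sum>i<n. (adj_mat (?G \<omega>) $$ (k, i) / det (?G \<omega>)) * cnj (A \<omega> $$ (l, i))))" if "\<omega> \<in> space M" for \<omega>
      by (rule zf_pinv_index[OF A[OF that] assms(3,4)])
    have [measurable]: "(\<lambda>\<omega>. \<Sum>i<n. (adj_mat (?G \<omega>) $$ (k, i) / det (?G \<omega>)) * cnj (A \<omega> $$ (l, i))) \<in> borel_measurable M"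
      using assms(4) by measurable
    show "(\<lambda>\<omega>. if det (?G \<omega>) = 0 then 0 else (\<Sum>i<n. (adj_mat (?G \<omega>) $$ (k, i) / det (?G \<omega>)) * cnj (A \<omega> $$ (l, i)))) \<in> borel_measurable M"
      by measurable
  qed
qed

text \<open>The choice made by \<open>nearest_symbol\<close> depends only on the finite set of nearest points.\<close>

lemma nearest_symbol_measurable:
  assumes "finite S"
  shows "nearest_symbol S \<in> borel_measurable borel"
proof -
  define A where "A = (\<lambda>z. {x\<in>S. \<forall>y\<in>S. (cmod (z - x))\<^sup>2 \<le> (cmod (z - y))\<^sup>2})"
  have n: "nearest_symbol S z = (SOME x. x \<in> A z)" for z
    unfolding nearest_symbol_def arg_min_on_def arg_min_def is_arg_min_def A_def
    by (rule arg_cong[where f=Eps]) (auto simp: fun_eq_iff not_less)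
  have [measurable]: "Measurable.pred borel (\<lambda>z. A z = T)" for T
  proof (cases "T \<subseteq> S")
    case True
    have "(A z = T) = (\<forall>x\<in>S. (x \<in> T) = (\<forall>y\<in>S. (cmod (z - x))\<^sup>2 \<le> (cmod (z - y))\<^sup>2))" for z
      using True unfolding A_def by auto
    then show ?thesis using assms by (simp only:) (intro pred_intros_finite pred_intros_logic; measurable)
  next
    case False
    then have "(A z = T) = False" for z unfolding A_def by auto
    then show ?thesis by simp
  qed
  have "nearest_symbol S z = (\<Sum>T\<in>Pow S. if A z = T then (SOME x. x \<in> T) else 0)" for z
  proof -
    have "A z \<in> Pow S" by (auto simp: A_def)
    then have "(\<Sum>T\<in>Pow S. if A z = T then (SOME x. x \<in> T) else 0) = (SOME x. x \<in> A z)"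
      using assms by simp
    then show ?thesis by (simp add: n)
  qed
  then have "nearest_symbol S = (\<lambda>z. \<Sum>T\<in>Pow S. if A z = T then (SOME x. x \<in> T) else 0)" by (rule ext)
  then show ?thesis by simp
qed

section \<open>Error regions in noise coordinates\<close>

lemma nearest_symbol_eq:
  assumes "c \<in> S" "\<And>c'. c' \<in> S \<Longrightarrow> c' \<noteq> c \<Longrightarrow> cmod (z - c) < cmod (z - c')"
  shows "nearest_symbol S z = c"
proof -
  have *: "is_arg_min (\<lambda>c. (cmod (z - c))\<^sup>2) (\<lambda>x. x \<in> S) x = (x = c)" for x
  proof
    assume x: "is_arg_min (\<lambda>c. (cmod (z - c))\<^sup>2) (\<lambda>x. x \<in> S) x"
    show "x = c"
    proof (rule ccontr)
      assume "x \<noteq> c"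
      then have "cmod (z - c) < cmod (z - x)" using x assms(2) by (auto simp: is_arg_min_def)
      then have "(cmod (z - c))\<^sup>2 < (cmod (z - x))\<^sup>2" by (simp add: power_strict_mono)
      then show False using x assms(1) by (auto simp: is_arg_min_def)
    qed
  next
    assume x: "x = c"
    have "\<not> (cmod (z - y))\<^sup>2 < (cmod (z - c))\<^sup>2" if "y \<in> S" for y
      using assms(2)[OF that] by (cases "y = c") (auto simp: not_less intro!: power_mono less_imp_le)
    then show "is_arg_min (\<lambda>c. (cmod (z - c))\<^sup>2) (\<lambda>x. x \<in> S) x" using x assms(1) by (auto simp: is_arg_min_def)
  qed
  then have "is_arg_min (\<lambda>c. (cmod (z - c))\<^sup>2) (\<lambda>x. x \<in> S) = (\<lambda>x. x = c)" by (rule ext)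
  then show ?thesis unfolding nearest_symbol_def arg_min_on_def arg_min_def by simp
qed

lemma nearest_symbol_minimal:
  assumes "finite S" "c \<in> S" shows "cmod (z - nearest_symbol S z) \<le> cmod (z - c)"
proof -
  have "(cmod (z - nearest_symbol S z))\<^sup>2 \<le> (cmod (z - c))\<^sup>2"
    unfolding nearest_symbol_def using assms by (intro arg_min_least) auto
  then show ?thesis by (simp add: abs_le_square_iff[symmetric])
qed

text \<open>The received point is \<open>c + w\<close>, and \<open>w\<close> is the noise. Ties
  count as errors, which makes the region a union of closed half-planes whatever rule
  \<open>nearest_symbol\<close> uses to break them.\<close>

definition symbol_error :: "complex set \<Rightarrow> complex \<Rightarrow> complex set" where
  "symbol_error S c = {w. \<exists>c'\<in>S - {c}. cmod (w + c - c') \<le> cmod w}"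

definition sep :: "complex set \<Rightarrow> real \<Rightarrow> real" where
  "sep S V = (\<Sum>c\<in>S. measure (cgauss_measure V) (symbol_error S c)) / real (card S)"

lemma symbol_error_measurable [measurable]: "finite S \<Longrightarrow> symbol_error S c \<in> sets borel"
proof -
  assume "finite S"
  have "symbol_error S c = (\<Union>c'\<in>S - {c}. {w. cmod (w + c - c') \<le> cmod w})" by (auto simp: symbol_error_def)
  also have "\<dots> \<in> sets borel"
    using \<open>finite S\<close> by (intro sets.finite_UN borel_closed closed_Collect_le continuous_intros) auto
  finally show ?thesis .
qed

text \<open>Two symbols are compared through a half-plane bounded by their perpendicular bisector;
  equality describes the line itself, a null set for nondegenerate noise.\<close>

lemma bisector: "cmod (w + d) = cmod w \<longleftrightarrow> Re (cnj d * w) = - (cmod d)\<^sup>2 / 2"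
  and bisector_le: "cmod (w + d) \<le> cmod w \<longleftrightarrow> Re (cnj d * w) \<le> - (cmod d)\<^sup>2 / 2"
proof -
  have e: "(cmod (w + d))\<^sup>2 = (cmod w)\<^sup>2 + 2 * Re (cnj d * w) + (cmod d)\<^sup>2"
    unfolding cmod_power2 by (simp add: power2_eq_square algebra_simps)
  have 1: "cmod (w + d) = cmod w \<longleftrightarrow> (cmod (w + d))\<^sup>2 = (cmod w)\<^sup>2" by (simp add: power2_eq_iff_nonneg)
  have 2: "cmod (w + d) \<le> cmod w \<longleftrightarrow> (cmod (w + d))\<^sup>2 \<le> (cmod w)\<^sup>2" by (simp add: abs_le_square_iff[symmetric])
  show "cmod (w + d) = cmod w \<longleftrightarrow> Re (cnj d * w) = - (cmod d)\<^sup>2 / 2" unfolding 1 e by (rule iffI; linarith)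
  show "cmod (w + d) \<le> cmod w \<longleftrightarrow> Re (cnj d * w) \<le> - (cmod d)\<^sup>2 / 2" unfolding 2 e by (rule iffI; linarith)
qed

text \<open>The choice rule and the error region can disagree only at a tie, hence only on finitely
  many bisectors.\<close>

lemma nearest_symbol_error_AE:
  assumes "finite S" "c \<in> S" "0 < V"
  shows "AE w in cgauss_measure V. (nearest_symbol S (c + w) \<noteq> c) = (w \<in> symbol_error S c)"
proof -
  have "AE w in cgauss_measure V. \<forall>c'\<in>S - {c}. cmod (w + (c - c')) \<noteq> cmod w"
  proof (intro AE_finite_allI)
    fix c' assume "c' \<in> S - {c}"
    then have "cnj (c - c') \<noteq> 0" by auto
    from cgauss_line_null[OF assms(3) this] show "AE w in cgauss_measure V. cmod (w + (c - c')) \<noteq> cmod w"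
      unfolding bisector .
  qed (use assms in simp)
  then show ?thesis
  proof eventually_elim
    fix w assume nt: "\<forall>c'\<in>S - {c}. cmod (w + (c - c')) \<noteq> cmod w"
    show "(nearest_symbol S (c + w) \<noteq> c) = (w \<in> symbol_error S c)"
    proof
      assume n: "nearest_symbol S (c + w) \<noteq> c"
      show "w \<in> symbol_error S c"
      proof (rule ccontr)
        assume "w \<notin> symbol_error S c"
        then have "nearest_symbol S (c + w) = c"
          by (intro nearest_symbol_eq assms) (auto simp: symbol_error_def not_le add.commute)
        with n show False by simp
      qed
    next
      assume "w \<in> symbol_error S c"
      then obtain c' where c': "c' \<in> S" "c' \<noteq> c" "cmod (w + (c - c')) \<le> cmod w"
        by (auto simp: symbol_error_def add_diff_eq)
      show "nearest_symbol S (c + w) \<noteq> c"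
      proof
        assume "nearest_symbol S (c + w) = c"
        then have "cmod w \<le> cmod (c + w - c')" using nearest_symbol_minimal[OF assms(1) c'(1), of "c + w"] by simp
        then show False using nt c' by (auto simp: algebra_simps)
      qed
    qed
  qed
qed

lemma nearest_symbol_error_prob:
  assumes "finite S" "c \<in> S" "0 < V"
  shows "measure (cgauss_measure V) {w. nearest_symbol S (c + w) \<noteq> c} = measure (cgauss_measure V) (symbol_error S c)"
proof (rule measure_eq_AE)
  note [measurable] = nearest_symbol_measurable[OF assms(1)]
  show "AE w in cgauss_measure V. (w \<in> {w. nearest_symbol S (c + w) \<noteq> c}) = (w \<in> symbol_error S c)"
    using nearest_symbol_error_AE[OF assms] by simp
  have "{w\<in>space borel. nearest_symbol S (c + w) \<noteq> c} \<in> sets borel" by measurable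
  then show "{w. nearest_symbol S (c + w) \<noteq> c} \<in> sets (cgauss_measure V)" by simp
  show "symbol_error S c \<in> sets (cgauss_measure V)" using assms by simp
qed

lemma sep_bounds: "finite S \<Longrightarrow> 0 \<le> sep S V \<and> sep S V \<le> 1"
proof -
  assume f: "finite S"
  interpret prob_space "cgauss_measure V" by (rule prob_space_cgauss_measure)
  have "(\<Sum>c\<in>S. prob (symbol_error S c)) \<le> (\<Sum>c\<in>S. 1)" by (intro sum_mono) simp
  then show ?thesis unfolding sep_def by (auto simp: divide_le_eq intro!: divide_nonneg_nonneg sum_nonneg)
qed

section \<open>Error probabilities of the constellations\<close>

lemma gaussian_Q_measure: "gaussian_Q x = measure std_normal_distribution {x..}"
proof -
  have "emeasure std_normal_distribution {x..} = (\<integral>\<^sup>+t. ennreal (indicator {x..} t * std_normal_density t) \<partial>lborel)"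
    by (subst emeasure_density) (auto intro!: nn_integral_cong split: split_indicator)
  also have "\<dots> = ennreal (LINT t|lborel. indicator {x..} t * std_normal_density t)"
    by (intro nn_integral_eq_integral Bochner_Integration.integrable_bound[OF integrable_normal_density[of 1 0]])
      (auto split: split_indicator)
  finally have "measure std_normal_distribution {x..} = (LINT t|lborel. indicator {x..} t * std_normal_density t)"
    unfolding measure_def by (simp add: integral_nonneg_AE)
  also have "\<dots> = (LINT t|lborel. 1 / sqrt (2 * pi) * (indicator {x..} t * exp (- (t\<^sup>2) / 2)))"
    by (intro Bochner_Integration.integral_cong) (auto simp: std_normal_density_def)
  also have "\<dots> = gaussian_Q x"
    unfolding integral_mult_right_zero by (simp add: gaussian_Q_def set_lebesgue_integral_def)
  finally show ?thesis ..
qed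

lemma std_normal_singleton: "measure std_normal_distribution {x} = 0"
  unfolding measure_def by (subst emeasure_density) (auto simp: nn_integral_indicator_singleton[of lborel, simplified] intro!: arg_cong[where f=enn2real])

lemma isCont_gaussian_Q: "isCont gaussian_Q x"
proof -
  interpret real_distribution std_normal_distribution by (rule real_dist_normal_dist)
  have Q: "gaussian_Q = (\<lambda>y. 1 - cdf std_normal_distribution y)"
  proof
    fix y
    have "gaussian_Q y = measure std_normal_distribution ({y} \<union> {y<..})"
      unfolding gaussian_Q_measure by (rule arg_cong[where f="measure std_normal_distribution"]) auto
    also have "\<dots> = measure std_normal_distribution {y<..}"
      using std_normal_singleton[of y] by (subst finite_measure_Union) auto
    also have "{y<..} = space std_normal_distribution - {..y}" by auto
    also have "measure std_normal_distribution \<dots> = 1 - cdf std_normal_distribution y"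
      unfolding cdf_def by (subst prob_compl) auto
    finally show "gaussian_Q y = 1 - cdf std_normal_distribution y" .
  qed
  have "isCont (cdf std_normal_distribution) x" using isCont_cdf[of x] std_normal_singleton[of x] by simp
  then show ?thesis unfolding Q by (intro continuous_intros)
qed

lemma gaussian_Q_reflect: "measure std_normal_distribution {..- x} = gaussian_Q x"
proof -
  have "distr std_normal_distribution borel (\<lambda>x. - x) = distr std_normal_distribution borel (\<lambda>x. sqrt 1 * x)"
  proof (rule real_gauss_law[OF prob_space_std_normal])
    show "(CLINT x|std_normal_distribution. iexp (t * - x)) = complex_of_real (exp (- (1 * t\<^sup>2 / 2)))" for t
      using fun_cong[OF char_std_normal_distribution, of "- t"] unfolding char_def by simp
  qed auto
  also have "\<dots> = std_normal_distribution" by (simp add: distr_id2)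
  finally have l: "distr std_normal_distribution borel (\<lambda>x. - x) = std_normal_distribution" .
  have "measure std_normal_distribution {..- x} = measure std_normal_distribution ((\<lambda>x. - x) -` {x..} \<inter> space std_normal_distribution)"
    by (rule arg_cong[where f="measure std_normal_distribution"]) auto
  also have "\<dots> = measure (distr std_normal_distribution borel (\<lambda>x. - x)) {x..}"
    by (rule measure_distr[symmetric]) auto
  finally show ?thesis unfolding l gaussian_Q_measure .
qed

text \<open>For a constellation on a line with spacing \<open>2 \<delta>\<close>, point \<open>i\<close> of \<open>1, \<dots>, L\<close> is missed if the
  noise exceeds \<open>\<delta>\<close> towards an existing neighbour.\<close>

definition line_error :: "nat \<Rightarrow> real \<Rightarrow> nat \<Rightarrow> real set" where
  "line_error L \<delta> i = {x. i < L \<and> \<delta> \<le> x \<or> 1 < i \<and> x \<le> - \<delta>}"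

text \<open>In each direction the adjacent point is the easiest to confuse with: losing to point
  \<open>j\<close> requires the noise to reach \<open>\<delta> * |j - i|\<close> on that
  side.\<close>

lemma line_error_iff:
  assumes "0 < \<delta>" "i \<in> {1..L}"
  shows "x \<in> line_error L \<delta> i \<longleftrightarrow>
    (\<exists>j\<in>{1..L}. j \<noteq> i \<and> (2 * \<delta> * (real j - real i))\<^sup>2 / 2 \<le> 2 * \<delta> * (real j - real i) * x)"
proof
  assume "x \<in> line_error L \<delta> i"
  then consider "i < L" "\<delta> \<le> x" | "1 < i" "x \<le> - \<delta>" by (auto simp: line_error_def)
  then show "\<exists>j\<in>{1..L}. j \<noteq> i \<and> (2 * \<delta> * (real j - real i))\<^sup>2 / 2 \<le> 2 * \<delta> * (real j - real i) * x"
  proof cases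
    case 1
    then show ?thesis using assms by (intro bexI[of _ "Suc i"]) (auto simp: power2_eq_square)
  next
    case 2
    then have "\<delta> * \<delta> \<le> \<delta> * - x" using assms by (intro mult_left_mono) auto
    then show ?thesis using 2 assms by (intro bexI[of _ "i - 1"]) (auto simp: power2_eq_square of_nat_diff)
  qed
next
  assume "\<exists>j\<in>{1..L}. j \<noteq> i \<and> (2 * \<delta> * (real j - real i))\<^sup>2 / 2 \<le> 2 * \<delta> * (real j - real i) * x"
  then obtain j where j: "j \<in> {1..L}" "j \<noteq> i" and le: "(2 * \<delta> * (real j - real i))\<^sup>2 / 2 \<le> 2 * \<delta> * (real j - real i) * x" by blast
  show "x \<in> line_error L \<delta> i"
  proof (cases "i < j")
    case True
    define D where "D = real j - real i"
    have d: "1 \<le> D" using True by (simp add: D_def)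
    have "2 * \<delta> * D * (\<delta> * D) \<le> 2 * \<delta> * D * x"
      using le unfolding D_def[symmetric] by (simp add: power2_eq_square mult_ac)
    then have "\<delta> * D \<le> x" using d assms(1) by (subst (asm) mult_le_cancel_left_pos) auto
    moreover have "\<delta> * 1 \<le> \<delta> * D" using d assms(1) by (intro mult_left_mono) auto
    ultimately show ?thesis using True j by (auto simp: line_error_def)
  next
    case False
    define D where "D = real j - real i"
    have d: "1 \<le> - D" using False j by (simp add: D_def)
    have "2 * \<delta> * (- D) * (\<delta> * (- D)) \<le> 2 * \<delta> * (- D) * (- x)"
      using le unfolding D_def[symmetric] by (simp add: power2_eq_square mult_ac)
    moreover have "0 < 2 * \<delta> * (- D)" using d assms(1) by (intro mult_pos_pos) auto
    ultimately have "\<delta> * (- D) \<le> - x" using mult_le_cancel_left_pos by blast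
    moreover have "\<delta> * 1 \<le> \<delta> * (- D)" using d assms(1) by (intro mult_left_mono) auto
    ultimately show ?thesis using False j by (auto simp: line_error_def)
  qed
qed

lemma line_error_measurable [measurable]: "line_error L \<delta> i \<in> sets borel"
  unfolding line_error_def by measurable

lemma line_error_prob:
  assumes "0 < \<delta>" "0 < s"
  shows "measure std_normal_distribution {x. s * x \<in> line_error L \<delta> i} =
    (of_bool (i < L) + of_bool (1 < i)) * gaussian_Q (\<delta> / s)"
proof -
  interpret prob_space std_normal_distribution by (rule prob_space_std_normal)
  have "{x. s * x \<in> line_error L \<delta> i} = (if i < L then {\<delta> / s..} else {}) \<union> (if 1 < i then {..- (\<delta> / s)} else {})"
    using assms by (auto simp: line_error_def field_simps)
  also have "measure std_normal_distribution \<dots> = measure std_normal_distribution (if i < L then {\<delta> / s..} else {}) +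
      measure std_normal_distribution (if 1 < i then {..- (\<delta> / s)} else {})"
    by (rule finite_measure_Union) (use divide_pos_pos[OF assms] in auto)
  finally show ?thesis by (simp add: gaussian_Q_reflect gaussian_Q_measure[symmetric] distrib_right)
qed

text \<open>There are \<open>L - 1\<close> gaps between adjacent points, and each can be crossed in
  two directions.\<close>

lemma sum_line_error:
  assumes "1 \<le> L"
  shows "(\<Sum>i\<in>{1..L}. (of_bool (i < L) + of_bool (1 < i)) * q) = 2 * (real L - 1) * q"
proof -
  have "(\<Sum>i\<in>{1..L}. of_bool (i < L)) = (\<Sum>i\<in>{1..<L}. 1 :: real)"
    by (rule sum.mono_neutral_cong_right) auto
  moreover have "(\<Sum>i\<in>{1..L}. of_bool (1 < i)) = (\<Sum>i\<in>{2..L}. 1 :: real)"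
    by (rule sum.mono_neutral_cong_right) auto
  ultimately show ?thesis using assms by (simp add: sum_distrib_right[symmetric] sum.distrib of_nat_diff)
qed

section \<open>Amplitude constellations\<close>

lemma cgauss_measure_cartesian:
  assumes "0 < V" and [measurable]: "{z. P (Re z) (Im z)} \<in> sets borel"
  shows "measure (cgauss_measure V) {z. P (Re z) (Im z)} =
    measure (std_normal_distribution \<Otimes>\<^sub>M std_normal_distribution) {p. P (sqrt (V / 2) * fst p) (sqrt (V / 2) * snd p)}"
  unfolding cgauss_measure_def
  by (subst measure_distr) (auto simp: space_pair_measure intro!: arg_cong[where f="measure _"])

lemma pair_prob_rectangle:
  assumes "prob_space M" "prob_space N" "A \<in> sets M" "B \<in> sets N"
  shows "measure (M \<Otimes>\<^sub>M N) (A \<times> B) = measure M A * measure N B"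
proof -
  interpret M: prob_space M by fact
  interpret N: prob_space N by fact
  show ?thesis unfolding measure_def using N.emeasure_pair_measure_Times[OF assms(3,4)] by (simp add: enn2real_mult)
qed

text \<open>Squaring cancels the squared modulus of \<open>w\<close>. What remains is linear in
  \<open>w\<close>, so for a product constellation it splits into a real and an imaginary
  part.\<close>

lemma symbol_error_offset:
  "w \<in> symbol_error S c \<longleftrightarrow> (\<exists>c'\<in>S - {c}. (cmod (c' - c))\<^sup>2 / 2 \<le> Re (cnj (c' - c) * w))"
proof -
  have "cmod (w + c - c') \<le> cmod w \<longleftrightarrow> (cmod (c' - c))\<^sup>2 / 2 \<le> Re (cnj (c' - c) * w)" for c'
  proof -
    have 1: "w + c - c' = w + (c - c')" by simp
    have 2: "Re (cnj (c - c') * w) = - Re (cnj (c' - c) * w)" by (simp add: algebra_simps)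
    show ?thesis unfolding 1 bisector_le 2 norm_minus_commute[of c c'] by (rule iffI; linarith)
  qed
  then show ?thesis by (simp add: symbol_error_def)
qed

text \<open>All bisectors are vertical, so the error depends on the real part of the noise alone,
  whose standard deviation is \<open>sqrt (V / 2)\<close>.\<close>

lemma sep_pam:
  assumes M: "2 \<le> M" and V: "0 < V"
  shows "sep (pam M) V = 2 * (real M - 1) / real M * gaussian_Q (sqrt (3 / (real M ^ 2 - 1)) / sqrt (V / 2))"
proof -
  define \<delta> s where "\<delta> = sqrt (3 / (real M ^ 2 - 1))" and "s = sqrt (V / 2)"
  define c where "c = (\<lambda>i. complex_of_real (\<delta> * (2 * real i - 1 - real M)))"
  have "1 < real M ^ 2" using M by (simp add: one_less_power)
  then have \<delta>: "0 < \<delta>" by (simp add: \<delta>_def)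
  have s: "0 < s" using V by (simp add: s_def)
  have S: "pam M = c ` {1..M}" by (auto simp: pam_def c_def \<delta>_def)
  have diff: "c j - c i = complex_of_real (2 * \<delta> * (real j - real i))" for i j
    unfolding c_def of_real_diff[symmetric] by (simp add: algebra_simps)
  have inj: "inj_on c {1..M}"
  proof (rule inj_onI)
    fix i j assume "c i = c j"
    then have "complex_of_real (2 * \<delta> * (real i - real j)) = 0" unfolding diff[symmetric] by simp
    then show "i = j" unfolding of_real_eq_0_iff using \<delta> by auto
  qed
  interpret N: prob_space std_normal_distribution by (rule prob_space_std_normal)
  have e: "measure (cgauss_measure V) (symbol_error (pam M) (c i)) = (of_bool (i < M) + of_bool (1 < i)) * gaussian_Q (\<delta> / s)"
    if i: "i \<in> {1..M}" for i
  proof -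
    have "w \<in> symbol_error (pam M) (c i) \<longleftrightarrow> Re w \<in> line_error M \<delta> i" for w
    proof -
      have "w \<in> symbol_error (pam M) (c i) \<longleftrightarrow> (\<exists>j\<in>{1..M}. j \<noteq> i \<and> (cmod (c j - c i))\<^sup>2 / 2 \<le> Re (cnj (c j - c i) * w))"
        unfolding symbol_error_offset S using inj i by (auto simp: inj_on_eq_iff)
      also have "\<dots> \<longleftrightarrow> Re w \<in> line_error M \<delta> i"
        unfolding line_error_iff[OF \<delta> i] diff by (simp only: norm_of_real power2_abs complex_cnj_complex_of_real Re_complex_of_real Im_complex_of_real times_complex.sel mult_zero_left diff_zero)
      finally show ?thesis .
    qed
    then have "measure (cgauss_measure V) (symbol_error (pam M) (c i)) = measure (cgauss_measure V) {z. Re z \<in> line_error M \<delta> i}"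
      by (intro arg_cong[where f="measure _"]) auto
    also have "\<dots> = measure (std_normal_distribution \<Otimes>\<^sub>M std_normal_distribution) {p. s * fst p \<in> line_error M \<delta> i}"
      unfolding s_def
    proof (rule cgauss_measure_cartesian[OF V, where P="\<lambda>x _. x \<in> line_error M \<delta> i"])
      have "{z \<in> space borel. Re z \<in> line_error M \<delta> i} \<in> sets borel" by measurable
      then show "{z. Re z \<in> line_error M \<delta> i} \<in> sets borel" by simp
    qed
    also have "{p. s * fst p \<in> line_error M \<delta> i} = {x. s * x \<in> line_error M \<delta> i} \<times> (UNIV :: real set)" by auto
    also have "measure (std_normal_distribution \<Otimes>\<^sub>M std_normal_distribution) \<dots> = measure std_normal_distribution {x. s * x \<in> line_error M \<delta> i} * measure std_normal_distribution UNIV"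
    proof (rule pair_prob_rectangle)
      have "{x \<in> space borel. s * x \<in> line_error M \<delta> i} \<in> sets borel" by measurable
      then show "{x. s * x \<in> line_error M \<delta> i} \<in> sets std_normal_distribution" by simp
    qed (auto simp: prob_space_std_normal)
    finally show ?thesis using N.prob_space unfolding line_error_prob[OF \<delta> s] by simp
  qed
  have "sep (pam M) V = (\<Sum>i\<in>{1..M}. measure (cgauss_measure V) (symbol_error (pam M) (c i))) / real M"
    unfolding sep_def S sum.reindex[OF inj] card_image[OF inj] by simp
  also have "\<dots> = (\<Sum>i\<in>{1..M}. (of_bool (i < M) + of_bool (1 < i)) * gaussian_Q (\<delta> / s)) / real M"
    using e by (intro arg_cong2[where f="(/)"] sum.cong) auto
  also have "\<dots> = 2 * (real M - 1) / real M * gaussian_Q (\<delta> / s)"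
    using M by (subst sum_line_error) auto
  finally show ?thesis unfolding \<delta>_def s_def .
qed

text \<open>A competitor that differs in both coordinates can win only if one of the two competitors
  differing in a single coordinate wins too, so the region of correct decisions is a rectangle.
  Independence of the noise parts gives the probability \<open>(1 - P i) * (1 - P k)\<close>, and
  the sum over the grid factors.\<close>

lemma sep_qam:
  assumes L: "2 \<le> L" and V: "0 < V"
  shows "sep (qam (L ^ 2)) V =
    4 * (real L - 1) / real L * gaussian_Q (sqrt (3 / (2 * (real L ^ 2 - 1))) / sqrt (V / 2)) -
    4 * (real L - 1)\<^sup>2 / real L ^ 2 * (gaussian_Q (sqrt (3 / (2 * (real L ^ 2 - 1))) / sqrt (V / 2)))\<^sup>2"
proof -
  define \<delta> s where "\<delta> = sqrt (3 / (2 * (real L ^ 2 - 1)))" and "s = sqrt (V / 2)"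
  let ?I = "{1..L} \<times> {1..L}" and ?S = "qam (L ^ 2)"
  define a where "a = (\<lambda>i. \<delta> * (2 * real i - 1 - real L))"
  define c where "c = (\<lambda>p. Complex (a (fst p)) (a (snd p)))"
  define q where "q = gaussian_Q (\<delta> / s)"
  define P where "P = (\<lambda>i::nat. (of_bool (i < L) + of_bool (1 < i)) * q)"
  have "1 < real L ^ 2" using L by (simp add: one_less_power)
  then have \<delta>: "0 < \<delta>" by (simp add: \<delta>_def)
  have s: "0 < s" using V by (simp add: s_def)
  have S: "?S = c ` ?I"
  proof -
    have A: "{sqrt (3 / (2 * (real L ^ 2 - 1))) * (2 * real i - 1 - real L) |i. 1 \<le> i \<and> real i \<le> real L} = a ` {1..L}"
      by (auto simp: a_def \<delta>_def)
    have r: "sqrt (real (L ^ 2)) = real L" "real (L ^ 2) = real L ^ 2" by simp_all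
    have "?S = {Complex x y |x y. x \<in> a ` {1..L} \<and> y \<in> a ` {1..L}}"
      unfolding qam_def Let_def r(1) unfolding r(2) A ..
    also have "\<dots> = c ` ?I" by (force simp: c_def)
    finally show ?thesis .
  qed
  have diff: "a j - a i = 2 * \<delta> * (real j - real i)" for i j by (simp add: a_def algebra_simps)
  have aeq: "a i = a j \<longleftrightarrow> i = j" for i j
  proof -
    have "a i = a j \<longleftrightarrow> 2 * \<delta> * (real i - real j) = 0" unfolding diff[symmetric] by simp
    also have "\<dots> \<longleftrightarrow> i = j" using \<delta> by auto
    finally show ?thesis .
  qed
  have inj: "inj_on c ?I" by (auto simp: inj_on_def c_def aeq)
  interpret N: prob_space std_normal_distribution by (rule prob_space_std_normal)
  interpret NN: pair_prob_space std_normal_distribution std_normal_distribution ..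
  have compl: "measure std_normal_distribution (UNIV - {x. s * x \<in> line_error L \<delta> j}) = 1 - P j" for j
  proof -
    have "{x \<in> space borel. s * x \<in> line_error L \<delta> j} \<in> sets borel" by measurable
    then show ?thesis using N.prob_compl[of "{x. s * x \<in> line_error L \<delta> j}"]
      by (simp only: line_error_prob[OF \<delta> s] P_def q_def) simp
  qed
  have e: "measure (cgauss_measure V) (symbol_error ?S (c (i, k))) = 1 - (1 - P i) * (1 - P k)"
    if i: "i \<in> {1..L}" and k: "k \<in> {1..L}" for i k
  proof -
    have "w \<in> symbol_error ?S (c (i, k)) \<longleftrightarrow> Re w \<in> line_error L \<delta> i \<or> Im w \<in> line_error L \<delta> k" for w
    proof -
      have "w \<in> symbol_error ?S (c (i, k)) \<longleftrightarrow> (\<exists>j\<in>{1..L}. \<exists>l\<in>{1..L}. (j, l) \<noteq> (i, k) \<and>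
          (a j - a i)\<^sup>2 / 2 + (a l - a k)\<^sup>2 / 2 \<le> (a j - a i) * Re w + (a l - a k) * Im w)"
      proof -
        have 1: "(\<exists>c'\<in>c ` ?I - {c (i, k)}. R c') \<longleftrightarrow> (\<exists>j\<in>{1..L}. \<exists>l\<in>{1..L}. (j, l) \<noteq> (i, k) \<and> R (c (j, l)))" for R
          by (force simp: c_def aeq)
        have 2: "(cmod (c (j, l) - c (i, k)))\<^sup>2 / 2 = (a j - a i)\<^sup>2 / 2 + (a l - a k)\<^sup>2 / 2" for j l
          by (simp add: c_def cmod_power2 add_divide_distrib)
        have 3: "Re (cnj (c (j, l) - c (i, k)) * w) = (a j - a i) * Re w + (a l - a k) * Im w" for j l
          by (simp add: c_def algebra_simps)
        show ?thesis unfolding symbol_error_offset S 1 2 3 ..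
      qed
      also have "\<dots> \<longleftrightarrow> (\<exists>j\<in>{1..L}. j \<noteq> i \<and> (a j - a i)\<^sup>2 / 2 \<le> (a j - a i) * Re w) \<or>
          (\<exists>l\<in>{1..L}. l \<noteq> k \<and> (a l - a k)\<^sup>2 / 2 \<le> (a l - a k) * Im w)" (is "?l = ?r")
      proof
        assume ?l
        then obtain j l where jl: "j \<in> {1..L}" "l \<in> {1..L}" "(j, l) \<noteq> (i, k)"
          and le: "(a j - a i)\<^sup>2 / 2 + (a l - a k)\<^sup>2 / 2 \<le> (a j - a i) * Re w + (a l - a k) * Im w" by blast
        show ?r
        proof (rule ccontr)
          \<comment> \<open>An index that coincides with that of the sent symbol contributes 0 to
            both sides, so adding the strict inequalities for the others contradicts
            \<open>le\<close>.\<close>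
          assume n: "\<not> ?r"
          then have 1: "j \<noteq> i \<Longrightarrow> (a j - a i) * Re w < (a j - a i)\<^sup>2 / 2" and 2: "l \<noteq> k \<Longrightarrow> (a l - a k) * Im w < (a l - a k)\<^sup>2 / 2"
            using jl by (auto simp: not_le)
          show False using 1 2 le jl(3) by (cases "j = i"; cases "l = k") auto
        qed
      next
        assume ?r
        then show ?l
        proof
          assume "\<exists>j\<in>{1..L}. j \<noteq> i \<and> (a j - a i)\<^sup>2 / 2 \<le> (a j - a i) * Re w"
          then obtain j where "j \<in> {1..L}" "j \<noteq> i" "(a j - a i)\<^sup>2 / 2 \<le> (a j - a i) * Re w" by blast
          then show ?l using k by (intro bexI[of _ j] bexI[of _ k]) auto
        next
          assume "\<exists>l\<in>{1..L}. l \<noteq> k \<and> (a l - a k)\<^sup>2 / 2 \<le> (a l - a k) * Im w"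
          then obtain l where "l \<in> {1..L}" "l \<noteq> k" "(a l - a k)\<^sup>2 / 2 \<le> (a l - a k) * Im w" by blast
          then show ?l using i by (intro bexI[of _ i] bexI[of _ l]) auto
        qed
      qed
      also have "\<dots> \<longleftrightarrow> Re w \<in> line_error L \<delta> i \<or> Im w \<in> line_error L \<delta> k"
        unfolding line_error_iff[OF \<delta> i] line_error_iff[OF \<delta> k] diff ..
      finally show ?thesis .
    qed
    then have "measure (cgauss_measure V) (symbol_error ?S (c (i, k))) =
        measure (cgauss_measure V) {z. Re z \<in> line_error L \<delta> i \<or> Im z \<in> line_error L \<delta> k}"
      by (intro arg_cong[where f="measure _"]) auto
    also have "\<dots> = measure (std_normal_distribution \<Otimes>\<^sub>M std_normal_distribution)
        {p. s * fst p \<in> line_error L \<delta> i \<or> s * snd p \<in> line_error L \<delta> k}"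
      unfolding s_def
    proof (rule cgauss_measure_cartesian[OF V, where P="\<lambda>x y. x \<in> line_error L \<delta> i \<or> y \<in> line_error L \<delta> k"])
      have "{z \<in> space borel. Re z \<in> line_error L \<delta> i \<or> Im z \<in> line_error L \<delta> k} \<in> sets borel" by measurable
      then show "{z. Re z \<in> line_error L \<delta> i \<or> Im z \<in> line_error L \<delta> k} \<in> sets borel" by simp
    qed
    also have "{p. s * fst p \<in> line_error L \<delta> i \<or> s * snd p \<in> line_error L \<delta> k} =
        space (std_normal_distribution \<Otimes>\<^sub>M std_normal_distribution) - (UNIV - {x. s * x \<in> line_error L \<delta> i}) \<times> (UNIV - {x. s * x \<in> line_error L \<delta> k})"
      by (auto simp: space_pair_measure)
    also have "measure (std_normal_distribution \<Otimes>\<^sub>M std_normal_distribution) \<dots> =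
       1 - measure (std_normal_distribution \<Otimes>\<^sub>M std_normal_distribution) ((UNIV - {x. s * x \<in> line_error L \<delta> i}) \<times> (UNIV - {x. s * x \<in> line_error L \<delta> k}))"
    proof (rule NN.prob_compl)
      have "{x \<in> space borel. s * x \<in> line_error L \<delta> j} \<in> sets borel" for j by measurable
      then show "(UNIV - {x. s * x \<in> line_error L \<delta> i}) \<times> (UNIV - {x. s * x \<in> line_error L \<delta> k}) \<in>
         sets (std_normal_distribution \<Otimes>\<^sub>M std_normal_distribution)"
        by (intro pair_measureI) auto
    qed
    also have "measure (std_normal_distribution \<Otimes>\<^sub>M std_normal_distribution) ((UNIV - {x. s * x \<in> line_error L \<delta> i}) \<times> (UNIV - {x. s * x \<in> line_error L \<delta> k})) =
       measure std_normal_distribution (UNIV - {x. s * x \<in> line_error L \<delta> i}) * measure std_normal_distribution (UNIV - {x. s * x \<in> line_error L \<delta> k})"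
    proof (rule pair_prob_rectangle)
      have "{x \<in> space borel. s * x \<in> line_error L \<delta> j} \<in> sets borel" for j by measurable
      then show "UNIV - {x. s * x \<in> line_error L \<delta> i} \<in> sets std_normal_distribution"
        "UNIV - {x. s * x \<in> line_error L \<delta> k} \<in> sets std_normal_distribution" by auto
    qed (auto simp: prob_space_std_normal)
    also have "measure std_normal_distribution (UNIV - {x. s * x \<in> line_error L \<delta> i}) = 1 - P i" by (rule compl)
    also have "measure std_normal_distribution (UNIV - {x. s * x \<in> line_error L \<delta> k}) = 1 - P k" by (rule compl)
    finally show ?thesis .
  qed
  have sP: "(\<Sum>i\<in>{1..L}. P i) = 2 * (real L - 1) * q" unfolding P_def by (rule sum_line_error) (use L in simp)
  have "(\<Sum>p\<in>?I. measure (cgauss_measure V) (symbol_error ?S (c p))) = (\<Sum>p\<in>?I. 1 - (1 - P (fst p)) * (1 - P (snd p)))"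
    using e by (intro sum.cong) auto
  also have "\<dots> = real L ^ 2 - (\<Sum>i\<in>{1..L}. 1 - P i) * (\<Sum>k\<in>{1..L}. 1 - P k)"
  proof -
    have "(\<Sum>p\<in>?I. (1 - P (fst p)) * (1 - P (snd p))) = (\<Sum>i\<in>{1..L}. 1 - P i) * (\<Sum>k\<in>{1..L}. 1 - P k)"
      unfolding sum_product sum.cartesian_product' fst_conv snd_conv ..
    then show ?thesis unfolding sum_subtractf[of "\<lambda>_. 1" _ ?I] by (simp add: power2_eq_square)
  qed
  also have "\<dots> = real L ^ 2 - (real L - 2 * (real L - 1) * q)\<^sup>2"
    unfolding sum_subtractf sP by (simp add: power2_eq_square)
  finally have tot: "(\<Sum>p\<in>?I. measure (cgauss_measure V) (symbol_error ?S (c p))) = real L ^ 2 - (real L - 2 * (real L - 1) * q)\<^sup>2" .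
  have "sep ?S V = (\<Sum>p\<in>?I. measure (cgauss_measure V) (symbol_error ?S (c p))) / real (L ^ 2)"
    unfolding sep_def S sum.reindex[OF inj] card_image[OF inj] by (simp add: power2_eq_square)
  also have "\<dots> = 4 * (real L - 1) / real L * q - 4 * (real L - 1)\<^sup>2 / real L ^ 2 * q\<^sup>2"
    unfolding tot using L by (simp add: field_simps power2_eq_square)
  finally show ?thesis unfolding q_def \<delta>_def s_def .
qed

section \<open>Gaussian measure of a wedge\<close>

lemma tail_integral:
  fixes c d :: real
  assumes "0 < c" "0 \<le> d"
  shows "(\<integral>\<^sup>+y. ennreal (y * exp (- (c * y\<^sup>2 / 2))) * indicator {d..} y \<partial>lborel) = ennreal (exp (- (c * d\<^sup>2 / 2)) / c)"
proof -
  have "(\<integral>\<^sup>+y. ennreal (y * exp (- (c * y\<^sup>2 / 2))) * indicator {d..} y \<partial>lborel) = ennreal (0 - (- exp (- (c * d\<^sup>2 / 2)) / c))"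
  proof (rule nn_integral_FTC_atLeast)
    show "((\<lambda>y. - exp (- (c * y\<^sup>2 / 2)) / c) has_real_derivative y * exp (- (c * y\<^sup>2 / 2))) (at y)" for y
      using assms by (auto intro!: derivative_eq_intros simp: field_simps)
    have "LIM y at_top. - (c * y\<^sup>2 / 2) :> at_bot"
    proof -
      have "LIM y at_top. (c / 2) * (y\<^sup>2) :> at_top"
        using assms by (intro filterlim_tendsto_pos_mult_at_top[OF tendsto_const] filterlim_pow_at_top filterlim_ident) auto
      then show ?thesis by (simp add: filterlim_uminus_at_bot)
    qed
    then have "((\<lambda>y. exp (- (c * y\<^sup>2 / 2))) \<longlongrightarrow> 0) at_top" by (rule filterlim_compose[OF exp_at_bot])
    then have "((\<lambda>y. - exp (- (c * y\<^sup>2 / 2)) / c) \<longlongrightarrow> - 0 / c) at_top" using assms by (intro tendsto_intros) auto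
    then show "((\<lambda>y. - exp (- (c * y\<^sup>2 / 2)) / c) \<longlongrightarrow> 0) at_top" by simp
    show "0 \<le> y * exp (- (c * y\<^sup>2 / 2))" if "d \<le> y" for y using that \<open>0 \<le> d\<close> by simp
  qed measurable
  then show ?thesis by simp
qed

text \<open>The angular form of a Gaussian integral over a wedge, via the substitutions \<open>x = - y v\<close> and
  \<open>v = - cot \<theta>\<close>.\<close>

lemma wedge_cot_substitution:
  fixes d \<alpha> :: real
  assumes \<alpha>: "0 < \<alpha>" "\<alpha> < pi"
  defines "f \<equiv> \<lambda>v. exp (- ((1 + v\<^sup>2) * d\<^sup>2 / 2)) / (2 * pi * (1 + v\<^sup>2))"
  shows "set_integrable lborel {..<cos \<alpha> / sin \<alpha>} f"
    and "(LBINT v:{..<cos \<alpha> / sin \<alpha>}. f v) = 1 / (2 * pi) * (LBINT \<theta>:{0..pi - \<alpha>}. exp (- (d\<^sup>2 / (2 * (sin \<theta>)\<^sup>2))))"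
proof -
  let ?b = "pi - \<alpha>" and ?g = "\<lambda>\<theta>::real. - (cos \<theta> / sin \<theta>)" and ?g' = "\<lambda>\<theta>::real. 1 / (sin \<theta>)\<^sup>2"
  let ?h = "\<lambda>\<theta>::real. 1 / (2 * pi) * exp (- (d\<^sup>2 / (2 * (sin \<theta>)\<^sup>2)))"
  have sp: "0 < sin \<theta>" if "0 < \<theta>" "\<theta> < ?b" for \<theta> using that \<alpha> by (intro sin_gt_zero) auto
  have fg: "f (?g \<theta>) * ?g' \<theta> = ?h \<theta>" if "0 < sin \<theta>" for \<theta>
  proof -
    have "(sin \<theta>)\<^sup>2 + (cos \<theta>)\<^sup>2 = 1" by simp
    then have c: "1 + (?g \<theta>)\<^sup>2 = 1 / (sin \<theta>)\<^sup>2" using that by (simp add: power_divide field_simps)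
    show ?thesis unfolding f_def c using that by simp
  qed
  \<comment> \<open>The exponential is at most 1, so the transformed integrand is dominated by a
    constant on a bounded interval.\<close>
  have ih: "integrable lborel (\<lambda>\<theta>. indicator {0<..<?b} \<theta> *\<^sub>R ?h \<theta>)"
  proof (rule Bochner_Integration.integrable_bound)
    show "integrable lborel (\<lambda>\<theta>. 1 / (2 * pi) * indicator {0<..<?b} \<theta> :: real)" using \<alpha> by (intro integrable_mult_right integrable_real_indicator) auto
    show "AE \<theta> in lborel. norm (indicator {0<..<?b} \<theta> *\<^sub>R ?h \<theta>) \<le> norm (1 / (2 * pi) * indicator {0<..<?b} \<theta> :: real)"
      by (auto split: split_indicator intro!: divide_right_mono)
  qed measurable
  have ih': "set_integrable lborel {0<..<?b} (\<lambda>\<theta>. f (?g \<theta>) * ?g' \<theta>)"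
    unfolding set_integrable_def
  proof (subst Bochner_Integration.integrable_cong[OF refl])
    show "indicator {0<..<?b} \<theta> *\<^sub>R (f (?g \<theta>) * ?g' \<theta>) = indicator {0<..<?b} \<theta> *\<^sub>R ?h \<theta>" for \<theta>
      using fg[OF sp[of \<theta>]] by (auto split: split_indicator)
  qed (rule ih)
  have pos: "0 < 2 * pi * (1 + v\<^sup>2)" for v :: real by (intro mult_pos_pos add_pos_nonneg) auto
  have fc: "isCont f v" for v
    unfolding f_def using pos[of v] by (intro continuous_intros) auto
  have f0: "0 \<le> f v" for v using pos[of v] by (simp add: f_def)
  have lim0: "((ereal \<circ> ?g \<circ> real_of_ereal) \<longlongrightarrow> -\<infinity>) (at_right (ereal 0))"
  proof -
    have "LIM \<theta> at_right 0. cos \<theta> / sin \<theta> :: real :> at_top"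
    proof (rule LIM_at_top_divide)
      show "(cos \<longlongrightarrow> (1::real)) (at_right 0)" "(sin \<longlongrightarrow> (0::real)) (at_right 0)"
        using tendsto_cos[OF tendsto_ident_at, of "0::real" "{0<..}"] tendsto_sin[OF tendsto_ident_at, of "0::real" "{0<..}"] by auto
      show "\<forall>\<^sub>F \<theta>::real in at_right 0. 0 < sin \<theta>"
      proof -
        have "0 < ?b" using \<alpha> by simp
        from eventually_at_right_real[OF this] show ?thesis by eventually_elim (use sp in auto)
      qed
    qed simp
    then have "LIM \<theta> at_right 0. ?g \<theta> :> at_bot" by (simp add: filterlim_uminus_at_bot)
    then show ?thesis by (simp only: ereal_tendsto_simps comp_assoc[symmetric])
  qed
  have sa: "0 < sin \<alpha>" using \<alpha> by (intro sin_gt_zero)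
  have lim1: "((ereal \<circ> ?g \<circ> real_of_ereal) \<longlongrightarrow> ereal (cos \<alpha> / sin \<alpha>)) (at_left (ereal ?b))"
  proof -
    have "isCont ?g ?b" using sa by (intro continuous_intros) auto
    then have "(?g \<longlongrightarrow> ?g ?b) (at_left ?b)" unfolding isCont_def by (rule tendsto_mono[OF at_le[OF subset_UNIV]])
    then have "(?g \<longlongrightarrow> cos \<alpha> / sin \<alpha>) (at_left ?b)" by simp
    then show ?thesis by (simp only: ereal_tendsto_simps comp_assoc[symmetric])
  qed
  note sub = interval_integral_substitution_nonneg[where a="ereal 0" and b="ereal ?b" and A="-\<infinity>" and B="ereal (cos \<alpha> / sin \<alpha>)" and f=f and g="?g" and g'="?g'"]
  have pre: "ereal 0 < ereal ?b" using \<alpha> by simp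
  have der: "DERIV ?g \<theta> :> ?g' \<theta>" if "ereal 0 < ereal \<theta>" "ereal \<theta> < ereal ?b" for \<theta>
  proof -
    have s: "sin \<theta> \<noteq> 0" using sp[of \<theta>] that by simp
    have "DERIV ?g \<theta> :> - ((- sin \<theta> * sin \<theta> - cos \<theta> * cos \<theta>) / (sin \<theta> * sin \<theta>))"
      using s by (auto intro!: derivative_eq_intros)
    also have "- ((- sin \<theta> * sin \<theta> - cos \<theta> * cos \<theta>) / (sin \<theta> * sin \<theta>)) = ?g' \<theta>"
    proof -
      have n: "- (- sin \<theta> * sin \<theta> - cos \<theta> * cos \<theta>) = 1"
        using sin_cos_squared_add[of \<theta>] by (simp add: power2_eq_square)
      show ?thesis unfolding minus_divide_left n power2_eq_square ..
    qed
    finally show ?thesis .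
  qed
  have cg: "isCont ?g' \<theta>" if "ereal 0 < ereal \<theta>" "ereal \<theta> < ereal ?b" for \<theta>
    using sp[of \<theta>] that by (intro continuous_intros) auto
  have ii: "set_integrable lborel (einterval (ereal 0) (ereal ?b)) (\<lambda>\<theta>. f (?g \<theta>) * ?g' \<theta>)"
    using ih' by simp
  note res = sub[OF pre der fc cg f0 _ lim0 lim1 ii]
  show si: "set_integrable lborel {..<cos \<alpha> / sin \<alpha>} f"
    using res(1) by simp
  have "(LBINT v:{..<cos \<alpha> / sin \<alpha>}. f v) = (LBINT v=-\<infinity>..ereal (cos \<alpha> / sin \<alpha>). f v)"
    by (simp add: interval_lebesgue_integral_def)
  also have "\<dots> = (LBINT \<theta>=ereal 0..ereal ?b. f (?g \<theta>) * ?g' \<theta>)" by (rule res(2)) simp_all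
  also have "\<dots> = (LBINT \<theta>:{0<..<?b}. f (?g \<theta>) * ?g' \<theta>)"
    using pre by (simp add: interval_lebesgue_integral_def)
  also have "\<dots> = (LBINT \<theta>:{0<..<?b}. ?h \<theta>)"
    by (rule set_lebesgue_integral_cong) (use fg sp in auto)
  \<comment> \<open>The two endpoints are null; at \<open>\<theta> = 0\<close> the quotient has its
    default value.\<close>
  also have "\<dots> = (LBINT \<theta>:{0..?b}. ?h \<theta>)"
    unfolding set_lebesgue_integral_def
  proof (rule integral_cong_AE)
    show "AE \<theta> in lborel. indicator {0<..<?b} \<theta> *\<^sub>R ?h \<theta> = indicator {0..?b} \<theta> *\<^sub>R ?h \<theta>"
      using AE_lborel_singleton[of 0] AE_lborel_singleton[of ?b] by eventually_elim (auto split: split_indicator)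
  qed measurable
  also have "\<dots> = 1 / (2 * pi) * (LBINT \<theta>:{0..?b}. exp (- (d\<^sup>2 / (2 * (sin \<theta>)\<^sup>2))))"
    by (rule set_integral_mult_right)
  finally show "(LBINT v:{..<cos \<alpha> / sin \<alpha>}. f v) = 1 / (2 * pi) * (LBINT \<theta>:{0..pi - \<alpha>}. exp (- (d\<^sup>2 / (2 * (sin \<theta>)\<^sup>2))))" .
qed

text \<open>For fixed \<open>y \<ge> d\<close>, the substitution \<open>x = - y * v\<close> turns
  the slanted side into \<open>v < cos \<alpha> / sin \<alpha>\<close>, a condition free of
  \<open>y\<close>, and produces the factor \<open>y\<close> that gives the Gaussian tail an
  elementary antiderivative. Hence the order of integration is exchanged and \<open>y\<close> is
  integrated first.\<close>

lemma wedge_probability: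
  fixes d \<alpha> :: real
  assumes d: "0 < d" and \<alpha>: "0 < \<alpha>" "\<alpha> < pi"
  shows "measure (std_normal_distribution \<Otimes>\<^sub>M std_normal_distribution) {p. d \<le> snd p \<and> 0 < fst p * sin \<alpha> + snd p * cos \<alpha>} =
    1 / (2 * pi) * (LBINT \<theta>:{0..pi - \<alpha>}. exp (- (d\<^sup>2 / (2 * (sin \<theta>)\<^sup>2))))"
proof -
  let ?N = std_normal_distribution and ?k = "cos \<alpha> / sin \<alpha>" and ?\<phi> = std_normal_density
  let ?A = "{p. d \<le> snd p \<and> 0 < fst p * sin \<alpha> + snd p * cos \<alpha>}"
  define f where "f = (\<lambda>v. exp (- ((1 + v\<^sup>2) * d\<^sup>2 / 2)) / (2 * pi * (1 + v\<^sup>2)))"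
  interpret N: prob_space ?N by (rule prob_space_std_normal)
  interpret P: pair_prob_space ?N ?N ..
  have sa: "0 < sin \<alpha>" using \<alpha> by (intro sin_gt_zero)
  have A: "?A \<in> sets (?N \<Otimes>\<^sub>M ?N)"
  proof -
    have "{p \<in> space (?N \<Otimes>\<^sub>M ?N). d \<le> snd p \<and> 0 < fst p * sin \<alpha> + snd p * cos \<alpha>} \<in> sets (?N \<Otimes>\<^sub>M ?N)" by measurable
    then show ?thesis by (simp add: space_pair_measure)
  qed
  \<comment> \<open>The joint density in the new coordinates. The region has become a product, so
    both constraints are indicators of one variable each.\<close>
  define F where "F = (\<lambda>y v. ennreal (1 / (2 * pi)) * (indicator {..<?k} v * (ennreal (y * exp (- ((1 + v\<^sup>2) * y\<^sup>2 / 2))) * indicator {d..} y)))"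
  have [measurable]: "(\<lambda>p. F (fst p) (snd p)) \<in> borel_measurable (lborel \<Otimes>\<^sub>M lborel)"
    unfolding F_def by measurable
  have inner: "ennreal (?\<phi> y) * emeasure ?N ((\<lambda>x. (x, y)) -` ?A) = (\<integral>\<^sup>+v. F y v \<partial>lborel)" for y
  proof (cases "d \<le> y")
    case False
    then show ?thesis by (simp add: F_def)
  next
    case True
    then have y: "0 < y" using d by simp
    have S: "{x. 0 < x * sin \<alpha> + y * cos \<alpha>} \<in> sets borel"
    proof -
      have "{x \<in> space borel. 0 < x * sin \<alpha> + y * cos \<alpha>} \<in> sets borel" by measurable
      then show ?thesis by simp
    qed
    have vs: "(\<lambda>x. (x, y)) -` ?A = {x. 0 < x * sin \<alpha> + y * cos \<alpha>}" using True by auto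
    have "emeasure ?N ((\<lambda>x. (x, y)) -` ?A) = (\<integral>\<^sup>+x. ennreal (?\<phi> x) * indicator {x. 0 < x * sin \<alpha> + y * cos \<alpha>} x \<partial>lborel)"
      unfolding vs using S by (subst emeasure_density) auto
    also have "\<dots> = ennreal \<bar>- y\<bar> * (\<integral>\<^sup>+v. ennreal (?\<phi> (0 + (- y) * v)) * indicator {x. 0 < x * sin \<alpha> + y * cos \<alpha>} (0 + (- y) * v) \<partial>lborel)"
      using S y by (intro nn_integral_real_affine) auto
    finally have "ennreal (?\<phi> y) * emeasure ?N ((\<lambda>x. (x, y)) -` ?A) =
       ennreal (?\<phi> y) * (ennreal \<bar>- y\<bar> * (\<integral>\<^sup>+v. ennreal (?\<phi> (0 + (- y) * v)) * indicator {x. 0 < x * sin \<alpha> + y * cos \<alpha>} (0 + (- y) * v) \<partial>lborel))"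
      by (rule arg_cong)
    also have "\<dots> = (\<integral>\<^sup>+v. ennreal (?\<phi> y) * (ennreal \<bar>- y\<bar> * (ennreal (?\<phi> (0 + (- y) * v)) * indicator {x. 0 < x * sin \<alpha> + y * cos \<alpha>} (0 + (- y) * v))) \<partial>lborel)"
      using S by (simp add: nn_integral_cmult)
    also have "\<dots> = (\<integral>\<^sup>+v. F y v \<partial>lborel)"
    proof (rule nn_integral_cong)
      fix v :: real
      have iff: "0 < (- y * v) * sin \<alpha> + y * cos \<alpha> \<longleftrightarrow> v < ?k"
      proof -
        have "(- y * v) * sin \<alpha> + y * cos \<alpha> = y * (cos \<alpha> - v * sin \<alpha>)" by (simp add: algebra_simps)
        then show ?thesis using y sa by (simp add: zero_less_mult_iff field_simps)
      qed
      have dens: "?\<phi> y * (y * ?\<phi> (- y * v)) = 1 / (2 * pi) * (y * exp (- ((1 + v\<^sup>2) * y\<^sup>2 / 2)))"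
        unfolding std_normal_density_def by (simp add: exp_add[symmetric] real_sqrt_mult[symmetric] power_mult_distrib algebra_simps add_divide_distrib)
      have "ennreal (?\<phi> y) * (ennreal y * ennreal (?\<phi> (- y * v))) = ennreal (1 / (2 * pi)) * ennreal (y * exp (- ((1 + v\<^sup>2) * y\<^sup>2 / 2)))"
        using y by (simp only: ennreal_mult[symmetric] dens normal_density_nonneg mult_nonneg_nonneg less_imp_le)
          (subst ennreal_mult[symmetric], auto)
      then show "ennreal (?\<phi> y) * (ennreal \<bar>- y\<bar> * (ennreal (?\<phi> (0 + (- y) * v)) * indicator {x. 0 < x * sin \<alpha> + y * cos \<alpha>} (0 + (- y) * v))) = F y v"
        using iff y True by (auto simp: F_def indicator_def)
    qed
    finally show ?thesis .
  qed
  have "emeasure (?N \<Otimes>\<^sub>M ?N) ?A = (\<integral>\<^sup>+y. emeasure ?N ((\<lambda>x. (x, y)) -` ?A) \<partial>?N)"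
    by (rule P.emeasure_pair_measure_alt2[OF A])
  also have "\<dots> = (\<integral>\<^sup>+y. ennreal (?\<phi> y) * emeasure ?N ((\<lambda>x. (x, y)) -` ?A) \<partial>lborel)"
  proof (rule nn_integral_density)
    have "(\<lambda>y. emeasure ?N ((\<lambda>x. (x, y)) -` ?A)) \<in> borel_measurable ?N"
      by (rule P.measurable_emeasure_Pair2[OF A])
    then show "(\<lambda>y. emeasure ?N ((\<lambda>x. (x, y)) -` ?A)) \<in> borel_measurable lborel" by simp
  qed simp
  also have "\<dots> = (\<integral>\<^sup>+y. (\<integral>\<^sup>+v. F y v \<partial>lborel) \<partial>lborel)" unfolding inner ..
  also have "\<dots> = (\<integral>\<^sup>+v. (\<integral>\<^sup>+y. F y v \<partial>lborel) \<partial>lborel)"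
    using lborel_pair.Fubini'[of "\<lambda>y v. F y v"] by (simp add: split_beta')
  also have "\<dots> = (\<integral>\<^sup>+v. ennreal (indicator {..<?k} v * f v) \<partial>lborel)"
  proof (rule nn_integral_cong)
    fix v :: real
    have c: "0 < 1 + v\<^sup>2" by (rule add_pos_nonneg) auto
    have "(\<integral>\<^sup>+y. F y v \<partial>lborel) = ennreal (1 / (2 * pi)) * (indicator {..<?k} v * (\<integral>\<^sup>+y. ennreal (y * exp (- ((1 + v\<^sup>2) * y\<^sup>2 / 2))) * indicator {d..} y \<partial>lborel))"
      unfolding F_def by (subst nn_integral_cmult, simp, subst nn_integral_cmult) auto
    also have "\<dots> = ennreal (1 / (2 * pi)) * (indicator {..<?k} v * ennreal (exp (- ((1 + v\<^sup>2) * d\<^sup>2 / 2)) / (1 + v\<^sup>2)))"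
      using tail_integral[OF c, of d] d by simp
    also have "\<dots> = ennreal (indicator {..<?k} v * f v)"
      using c by (auto simp: f_def indicator_def ennreal_mult[symmetric])
    finally show "(\<integral>\<^sup>+y. F y v \<partial>lborel) = ennreal (indicator {..<?k} v * f v)" .
  qed
  also have "\<dots> = ennreal (LBINT v:{..<?k}. f v)"
    using wedge_cot_substitution(1)[OF \<alpha>, of d] unfolding set_integrable_def set_lebesgue_integral_def f_def
    by (subst nn_integral_eq_integral) (auto intro!: AE_I2 mult_nonneg_nonneg divide_nonneg_nonneg)
  finally have "measure (?N \<Otimes>\<^sub>M ?N) ?A = (LBINT v:{..<?k}. f v)"
    unfolding measure_def set_lebesgue_integral_def
    by (simp add: integral_nonneg_AE f_def)
  then show ?thesis unfolding f_def wedge_cot_substitution(2)[OF \<alpha>] .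
qed

section \<open>Phase-shift keying\<close>

lemma cgauss_measure_rotate:
  assumes "cmod z = 1" "0 \<le> V"
  shows "distr (cgauss_measure V) borel (\<lambda>w. z * w) = cgauss_measure V"
  using cgauss_law[OF prob_space_cgauss_measure cgauss_scale[OF cgauss_cgauss_measure[OF assms(2)], of z]] assms(1) by simp

lemma cgauss_measure_cnj:
  assumes "0 \<le> V"
  shows "distr (cgauss_measure V) borel cnj = cgauss_measure V"
proof (rule cgauss_law[OF prob_space_cgauss_measure])
  have "(CLINT z|cgauss_measure V. iexp (Re (a * cnj z))) = complex_of_real (exp (- (V * (cmod a)\<^sup>2 / 4)))" for a
  proof -
    have "Re (a * cnj z) = Re (cnj a * z)" for z by simp
    then have "(CLINT z|cgauss_measure V. iexp (Re (a * cnj z))) = (CLINT z|cgauss_measure V. iexp (Re (cnj a * z)))" by presburger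
    also have "\<dots> = complex_of_real (exp (- (V * (cmod (cnj a))\<^sup>2 / 4)))"
      using cgauss_cgauss_measure[OF assms] unfolding cgauss_def by blast
    finally show ?thesis by simp
  qed
  then show "cgauss (cgauss_measure V) cnj V" using assms unfolding cgauss_def by simp
qed

lemma measure_cgauss_vimage:
  assumes "distr (cgauss_measure V) borel g = cgauss_measure V" "g \<in> borel_measurable borel" "A \<in> sets borel"
  shows "measure (cgauss_measure V) {w. g w \<in> A} = measure (cgauss_measure V) A"
proof -
  have "measure (cgauss_measure V) A = measure (distr (cgauss_measure V) borel g) A" by (simp only: assms(1))
  also have "\<dots> = measure (cgauss_measure V) (g -` A \<inter> space (cgauss_measure V))"
    by (rule measure_distr) (use assms in auto)
  finally show ?thesis by (simp add: vimage_def)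
qed

text \<open>The points 1 and \<open>cis (2 * \<beta>)\<close> have as bisector the line through the
  origin in direction \<open>\<beta>\<close>, unless they coincide. The side on which
  \<open>z\<close> lies is read off after turning by \<open>- \<beta>\<close>.\<close>

lemma cmod_diff_cis:
  "(cmod (z - 1))\<^sup>2 - (cmod (z - cis (2 * \<beta>)))\<^sup>2 = 4 * sin \<beta> * Im (z * cis (- \<beta>))"
proof -
  have "(cmod (z - 1))\<^sup>2 - (cmod (z - cis (2 * \<beta>)))\<^sup>2 = 2 * (Re z * cos (2 * \<beta>) + Im z * sin (2 * \<beta>)) + 1 - (cos (2 * \<beta>))\<^sup>2 - (sin (2 * \<beta>))\<^sup>2 - 2 * Re z"
    unfolding cmod_power2 by (simp add: power2_eq_square algebra_simps)
  also have "\<dots> = 2 * (Re z * cos (2 * \<beta>) + Im z * sin (2 * \<beta>)) - 2 * Re z"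
    using sin_cos_squared_add[of "2 * \<beta>"] by linarith
  also have "\<dots> = 4 * sin \<beta> * Im (z * cis (- \<beta>))"
  proof -
    have c: "cos (2 * \<beta>) = 1 - 2 * sin \<beta> * sin \<beta>" by (simp add: cos_double_sin power2_eq_square)
    show ?thesis unfolding c sin_double by (simp add: algebra_simps)
  qed
  finally show ?thesis .
qed

text \<open>The bisectors have directions \<open>i * \<alpha>\<close> between
  \<open>\<alpha>\<close> and \<open>pi - \<alpha>\<close>, so the half-planes of the two adjacent
  symbols cover all the others. The adjacent symbol below the real axis is the one with index
  \<open>M - 1\<close>, whose bisector is the line of direction \<open>- \<alpha>\<close>.\<close>

lemma psk_error_unit:
  assumes M: "2 \<le> M"
  defines "\<alpha> \<equiv> pi / real M"
  shows "w \<in> symbol_error (psk M) 1 \<longleftrightarrow> 0 \<le> Im ((1 + w) * cis (- \<alpha>)) \<or> Im ((1 + w) * cis \<alpha>) \<le> 0"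
proof -
  have \<alpha>: "0 < \<alpha>" "\<alpha> \<le> pi / 2" using M by (auto simp: \<alpha>_def field_simps)
  have M\<alpha>: "real M * \<alpha> = pi" using M by (simp add: \<alpha>_def)
  have pt: "cis (2 * pi * real i / real M) = cis (2 * (real i * \<alpha>))" for i
    by (rule arg_cong[where f=cis]) (simp add: \<alpha>_def)
  have closer: "cmod (w + 1 - cis (2 * \<beta>)) \<le> cmod w \<longleftrightarrow> 0 \<le> Im ((1 + w) * cis (- \<beta>))" if "0 < sin \<beta>" for \<beta>
  proof -
    have "cmod (w + 1 - cis (2 * \<beta>)) \<le> cmod w \<longleftrightarrow> (cmod (w + 1 - cis (2 * \<beta>)))\<^sup>2 \<le> (cmod w)\<^sup>2"
      by (simp add: abs_le_square_iff[symmetric])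
    also have "\<dots> \<longleftrightarrow> 0 \<le> 4 * sin \<beta> * Im ((1 + w) * cis (- \<beta>))"
    proof -
      have "(cmod w)\<^sup>2 - (cmod (w + 1 - cis (2 * \<beta>)))\<^sup>2 = 4 * sin \<beta> * Im ((1 + w) * cis (- \<beta>))"
        using cmod_diff_cis[of "w + 1" \<beta>] by (simp only: add_diff_cancel_right' add_diff_cancel_left' add.commute[of w 1])
      then show ?thesis by (intro iffI) linarith+
    qed
    also have "\<dots> \<longleftrightarrow> 0 \<le> Im ((1 + w) * cis (- \<beta>))" using that by (simp add: zero_le_mult_iff)
    finally show ?thesis .
  qed
  have sin_pos: "0 < sin (real i * \<alpha>)" if "i \<in> {1..<M}" for i
  proof (rule sin_gt_zero)
    show "0 < real i * \<alpha>" using that \<alpha> by simp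
    have "real i * \<alpha> < real M * \<alpha>" using that \<alpha> by simp
    then show "real i * \<alpha> < pi" using M\<alpha> by simp
  qed
  have ne: "cis (2 * (real i * \<alpha>)) \<noteq> 1" if "i \<in> {1..<M}" for i
  proof
    assume "cis (2 * (real i * \<alpha>)) = 1"
    then have "cos (2 * (real i * \<alpha>)) = 1" by (metis cis.sel(1) one_complex.sel(1))
    then have "(sin (real i * \<alpha>))\<^sup>2 = 0" by (simp add: cos_double_sin)
    then show False using sin_pos[OF that] by simp
  qed
  have S: "psk M - {1} = (\<lambda>i. cis (2 * (real i * \<alpha>))) ` {1..<M}"
  proof -
    have "psk M = insert 1 ((\<lambda>i. cis (2 * (real i * \<alpha>))) ` {1..<M})"
    proof -
      have "{0..<M} = insert 0 {1..<M}" using M by auto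
      moreover have "psk M = (\<lambda>i. cis (2 * (real i * \<alpha>))) ` {0..<M}" unfolding psk_def pt by blast
      ultimately show ?thesis by simp
    qed
    then show ?thesis using ne by auto
  qed
  have "w \<in> symbol_error (psk M) 1 \<longleftrightarrow> (\<exists>i\<in>{1..<M}. 0 \<le> Im ((1 + w) * cis (- (real i * \<alpha>))))"
    unfolding symbol_error_def S using closer[OF sin_pos] by auto
  also have "\<dots> \<longleftrightarrow> 0 \<le> Im ((1 + w) * cis (- \<alpha>)) \<or> Im ((1 + w) * cis \<alpha>) \<le> 0"
  proof
    assume "0 \<le> Im ((1 + w) * cis (- \<alpha>)) \<or> Im ((1 + w) * cis \<alpha>) \<le> 0"
    then show "\<exists>i\<in>{1..<M}. 0 \<le> Im ((1 + w) * cis (- (real i * \<alpha>)))"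
    proof
      assume "0 \<le> Im ((1 + w) * cis (- \<alpha>))"
      then show ?thesis using M by (intro bexI[of _ 1]) auto
    next
      assume a: "Im ((1 + w) * cis \<alpha>) \<le> 0"
      have "real (M - 1) * \<alpha> = pi - \<alpha>" using M M\<alpha> by (simp add: of_nat_diff algebra_simps)
      then have "cis (- (real (M - 1) * \<alpha>)) = - cis \<alpha>"
        by (simp add: complex_eq_iff cos_diff sin_diff)
      then have "Im ((1 + w) * cis (- (real (M - 1) * \<alpha>))) = - Im ((1 + w) * cis \<alpha>)" by simp
      then show ?thesis using a M by (intro bexI[of _ "M - 1"]) auto
    qed
  next
    assume "\<exists>i\<in>{1..<M}. 0 \<le> Im ((1 + w) * cis (- (real i * \<alpha>)))"
    then obtain i where i: "i \<in> {1..<M}" and ge: "0 \<le> Im ((1 + w) * cis (- (real i * \<alpha>)))" by blast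
    define \<beta> where "\<beta> = real i * \<alpha>"
    have b: "\<alpha> \<le> \<beta>" "\<beta> \<le> pi - \<alpha>"
    proof -
      show "\<alpha> \<le> \<beta>" using i \<alpha> by (simp add: \<beta>_def)
      have "real (Suc i) * \<alpha> \<le> real M * \<alpha>" using i \<alpha> by (intro mult_right_mono) auto
      then show "\<beta> \<le> pi - \<alpha>" using M\<alpha> by (simp add: \<beta>_def algebra_simps)
    qed
    show "0 \<le> Im ((1 + w) * cis (- \<alpha>)) \<or> Im ((1 + w) * cis \<alpha>) \<le> 0"
    proof (rule ccontr)
      assume n: "\<not> ?thesis"
      \<comment> \<open>The functional for \<open>\<beta>\<close> as a combination of the two
        adjacent ones. Both sines on the right are nonnegative, so it is at most 0 when neither
        adjacent symbol wins.\<close>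
      have id: "sin (2 * \<alpha>) * Im (z * cis (- \<beta>)) = sin (\<alpha> + \<beta>) * Im (z * cis (- \<alpha>)) - sin (\<beta> - \<alpha>) * Im (z * cis \<alpha>)" for z
      proof -
        show ?thesis unfolding sin_double sin_add sin_diff by (simp add: algebra_simps)
      qed
      show False
      \<comment> \<open>For \<open>M = 2\<close> both adjacent symbols coincide and
        \<open>sin (2 * \<alpha>) = 0\<close>, so the identity carries no information.\<close>
      proof (cases "M = 2")
        case True
        then have "i = 1" using i by simp
        then have one: "real i * \<alpha> = \<alpha>" by simp
        show False using n ge unfolding one by simp
      next
        case False
        then have "3 * \<alpha> \<le> real M * \<alpha>" using M \<alpha> by (intro mult_right_mono) auto
        then have a3: "3 * \<alpha> \<le> pi" using M\<alpha> by simp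
        have p: "0 < sin (2 * \<alpha>)" using \<alpha> a3 by (intro sin_gt_zero) auto
        have q1: "0 \<le> sin (\<alpha> + \<beta>)" using b \<alpha> by (intro sin_ge_zero) auto
        have q2: "0 \<le> sin (\<beta> - \<alpha>)" using b \<alpha> by (intro sin_ge_zero) auto
        let ?z = "1 + w"
        have le: "0 \<le> sin (2 * \<alpha>) * Im (?z * cis (- \<beta>))" using p ge by (simp add: \<beta>_def)
        have 1: "sin (\<alpha> + \<beta>) * Im (?z * cis (- \<alpha>)) \<le> 0" using q1 n by (intro mult_nonneg_nonpos) auto
        have 2: "0 \<le> sin (\<beta> - \<alpha>) * Im (?z * cis \<alpha>)" using q2 n by (intro mult_nonneg_nonneg) auto
        have "sin (\<alpha> + \<beta>) * Im (?z * cis (- \<alpha>)) = 0" "sin (\<beta> - \<alpha>) * Im (?z * cis \<alpha>) = 0"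
          using le 1 2 id[of ?z] by linarith+
        \<comment> \<open>The functionals at \<open>\<alpha>\<close> and \<open>- \<alpha>\<close>
          are nonzero by \<open>n\<close>, so only vanishing sines are left; these would force
          \<open>sin (2 * \<alpha>) = 0\<close>.\<close>
        then have "sin (\<alpha> + \<beta>) = 0" "sin (\<beta> - \<alpha>) = 0" using n by auto
        moreover have "sin (2 * \<alpha>) = sin (\<alpha> + \<beta>) * cos (\<beta> - \<alpha>) - cos (\<alpha> + \<beta>) * sin (\<beta> - \<alpha>)"
          using sin_diff[of "\<alpha> + \<beta>" "\<beta> - \<alpha>"] by simp
        ultimately show False using p by simp
      qed
    qed
  qed
  finally show ?thesis .
qed

text \<open>The constellation is the group of \<open>M\<close>-th roots of unity: multiplication by
  \<open>cnj c\<close> permutes it, preserves distances and carries \<open>c\<close> to 1.\<close>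

lemma symbol_error_psk_rotate:
  assumes "c \<in> psk M"
  shows "w \<in> symbol_error (psk M) c \<longleftrightarrow> cnj c * w \<in> symbol_error (psk M) 1"
proof -
  obtain i where i: "i < M" "c = cis (2 * pi * real i / real M)" using assms by (auto simp: psk_def)
  have c1: "c * cnj c = 1" "cmod c = 1" using i by (simp_all add: cis_cnj cis_mult)
  have M: "0 < M" using i by simp
  have red: "cis (2 * pi * real k / real M) = cis (2 * pi * real (k mod M) / real M)" for k
  proof -
    have "real k = real M * real (k div M) + real (k mod M)" by (metis mult_div_mod_eq of_nat_add of_nat_mult)
    then have "2 * pi * real k / real M = 2 * pi * real (k div M) + 2 * pi * real (k mod M) / real M"
      using M by (simp add: field_simps)
    then have "cis (2 * pi * real k / real M) = cis (2 * pi * real (k div M)) * cis (2 * pi * real (k mod M) / real M)"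
      by (simp only: cis_mult)
    also have "cis (2 * pi * real (k div M)) = 1" by (intro cis_multiple_2pi) auto
    finally show ?thesis by simp
  qed
  have closed: "cis (2 * pi * real k / real M) \<in> psk M" for k
    unfolding red[of k] psk_def using M by auto
  have cc: "cnj c = cis (2 * pi * real (M - i) / real M)"
  proof -
    have "2 * pi * real (M - i) / real M = 2 * pi - 2 * pi * real i / real M"
      using i M by (simp add: of_nat_diff field_simps)
    then show ?thesis unfolding i(2) cis_cnj by (simp add: complex_eq_iff cos_diff sin_diff)
  qed
  have mult: "a * b \<in> psk M" if ab: "a \<in> psk M" "b \<in> psk M \<or> b = cnj c" for a b
  proof -
    obtain k where k: "a = cis (2 * pi * real k / real M)" using ab by (auto simp: psk_def)
    obtain l where l: "b = cis (2 * pi * real l / real M)" using ab cc by (auto simp: psk_def)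
    have "a * b = cis (2 * pi * real (k + l) / real M)"
      unfolding k l cis_mult by (simp add: add_divide_distrib distrib_left)
    then show ?thesis using closed[of "k + l"] by simp
  qed
  have eq: "cmod (cnj c * w + 1 - cnj c * c') = cmod (w + c - c')" "cmod (cnj c * w) = cmod w" for c'
  proof -
    have "cnj c * w + 1 - cnj c * c' = cnj c * (w + c - c')" using c1 by (simp add: algebra_simps)
    then show "cmod (cnj c * w + 1 - cnj c * c') = cmod (w + c - c')" using c1(2) by (simp add: norm_mult)
    show "cmod (cnj c * w) = cmod w" using c1(2) by (simp add: norm_mult)
  qed
  show ?thesis
  proof
    assume "w \<in> symbol_error (psk M) c"
    then obtain c' where c': "c' \<in> psk M" "c' \<noteq> c" "cmod (w + c - c') \<le> cmod w" by (auto simp: symbol_error_def)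
    have "cnj c * c' \<noteq> 1" using c'(2) c1 by (metis mult.assoc mult.left_neutral mult.right_neutral)
    moreover have "cnj c * c' \<in> psk M" using mult[of c' "cnj c"] c'(1) by (simp add: mult.commute)
    moreover have "cmod (cnj c * w + 1 - cnj c * c') \<le> cmod (cnj c * w)" using c'(3) by (simp only: eq)
    ultimately show "cnj c * w \<in> symbol_error (psk M) 1" unfolding symbol_error_def by blast
  next
    assume "cnj c * w \<in> symbol_error (psk M) 1"
    then obtain d where d: "d \<in> psk M" "d \<noteq> 1" "cmod (cnj c * w + 1 - d) \<le> cmod (cnj c * w)" by (auto simp: symbol_error_def)
    have dc: "d = cnj c * (c * d)" using c1(1) by (simp add: mult.assoc[symmetric] mult.commute[of "cnj c"])
    have "c * d \<noteq> c" using d(2) c1(2) by (auto simp: mult_cancel_left2)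
    moreover have "c * d \<in> psk M" using mult[of c d] assms d(1) by blast
    moreover have "cmod (w + c - c * d) \<le> cmod w" using d(3) eq(1)[of "c * d"] eq(2) dc by simp
    ultimately show "w \<in> symbol_error (psk M) c" unfolding symbol_error_def by blast
  qed
qed

lemma finite_psk: "finite (psk M)"
proof -
  have "psk M = (\<lambda>i. cis (2 * pi * real i / real M)) ` {0..<M}" by (auto simp: psk_def)
  then show ?thesis by simp
qed

text \<open>Up to the real axis, the error region of the symbol 1 consists of the mirror images
  \<open>U\<close> and \<open>L\<close>, and \<open>U\<close> turned by \<open>- \<alpha>\<close> is
  the wedge \<open>T\<close>. The cut works because \<open>cos \<alpha> \<ge> 0\<close>: above the
  axis, losing to the lower neighbour implies losing to the upper one, and conversely below. The two
  halves turn the \<open>1 / (2 * pi)\<close> of a wedge into \<open>1 / pi\<close>.\<close>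

lemma sep_psk:
  assumes M: "2 \<le> M" and V: "0 < V"
  shows "sep (psk M) V = 1 / pi * (LBINT \<theta>:{0..(real M - 1) * pi / real M}. exp (- ((sin (pi / real M))\<^sup>2 / (V * (sin \<theta>)\<^sup>2))))"
proof -
  define \<alpha> where "\<alpha> = pi / real M"
  let ?G = "cgauss_measure V"
  interpret G: prob_space ?G by (rule prob_space_cgauss_measure)
  have \<alpha>: "0 < \<alpha>" "\<alpha> \<le> pi / 2" "\<alpha> < pi" using M by (auto simp: \<alpha>_def field_simps)
  have sa: "0 < sin \<alpha>" and ca: "0 \<le> cos \<alpha>" using \<alpha> by (auto intro!: sin_gt_zero cos_ge_zero)
  define U where "U = {w. 0 < Im w \<and> 0 \<le> Im ((1 + w) * cis (- \<alpha>))}"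
  define L where "L = {w. Im w < 0 \<and> Im ((1 + w) * cis \<alpha>) \<le> 0}"
  define T where "T = {u. sin \<alpha> \<le> Im u \<and> 0 < Re u * sin \<alpha> + Im u * cos \<alpha>}"
  have ms: "U \<in> sets borel" "L \<in> sets borel" "T \<in> sets borel"
  proof -
    have "{w \<in> space borel. 0 < Im w \<and> 0 \<le> Im ((1 + w) * cis (- \<alpha>))} \<in> sets borel"
      "{w \<in> space borel. Im w < 0 \<and> Im ((1 + w) * cis \<alpha>) \<le> 0} \<in> sets borel"
      "{u \<in> space borel. sin \<alpha> \<le> Im u \<and> 0 < Re u * sin \<alpha> + Im u * cos \<alpha>} \<in> sets borel" by measurable
    then show "U \<in> sets borel" "L \<in> sets borel" "T \<in> sets borel" by (simp_all add: U_def L_def T_def)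
  qed
  have UT: "w \<in> U \<longleftrightarrow> cis (- \<alpha>) * w \<in> T" for w
  proof -
    have "Im w = Re (cis (- \<alpha>) * w) * sin \<alpha> + Im (cis (- \<alpha>) * w) * cos \<alpha>"
    proof -
      have sc: "sin \<alpha> * sin \<alpha> + cos \<alpha> * cos \<alpha> = 1" using sin_cos_squared_add[of \<alpha>] by (simp only: power2_eq_square)
      have "Re (cis (- \<alpha>) * w) * sin \<alpha> + Im (cis (- \<alpha>) * w) * cos \<alpha> = Im w * (sin \<alpha> * sin \<alpha>) + Im w * (cos \<alpha> * cos \<alpha>)"
        by (simp add: algebra_simps)
      then show ?thesis by (simp only: distrib_left[symmetric] sc mult_1_right)
    qed
    moreover have "Im ((1 + w) * cis (- \<alpha>)) = Im (cis (- \<alpha>) * w) - sin \<alpha>" by (simp add: algebra_simps)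
    ultimately show ?thesis unfolding U_def T_def mem_Collect_eq by (metis diff_ge_0_iff_ge)
  qed
  have mU: "measure ?G U = measure ?G T"
  proof -
    have "measure ?G {w. cis (- \<alpha>) * w \<in> T} = measure ?G T"
      by (rule measure_cgauss_vimage[OF cgauss_measure_rotate _ ms(3)]) (use V in auto)
    then show ?thesis unfolding UT[symmetric] by simp
  qed
  have mL: "measure ?G L = measure ?G U"
  proof -
    have "w \<in> L \<longleftrightarrow> cnj w \<in> U" for w
      by (auto simp: L_def U_def algebra_simps)
    then have "L = {w. cnj w \<in> U}" by auto
    then show ?thesis using measure_cgauss_vimage[OF cgauss_measure_cnj _ ms(1)] V by simp
  qed
  have err: "symbol_error (psk M) 1 \<in> sets borel" using finite_psk by (rule symbol_error_measurable)
  have "AE w in ?G. Re (- \<i> * w) \<noteq> 0" by (rule cgauss_line_null[OF V]) simp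
  then have "AE w in ?G. (w \<in> symbol_error (psk M) 1) = (w \<in> U \<union> L)"
  proof eventually_elim
    fix w assume "Re (- \<i> * w) \<noteq> 0"
    then have w: "Im w \<noteq> 0" by simp
    have A: "Im ((1 + w) * cis (- \<alpha>)) = Im w * cos \<alpha> - (1 + Re w) * sin \<alpha>" by (simp add: algebra_simps)
    have B: "Im ((1 + w) * cis \<alpha>) = Im w * cos \<alpha> + (1 + Re w) * sin \<alpha>" by (simp add: algebra_simps)
    have "(0 \<le> Im ((1 + w) * cis (- \<alpha>)) \<or> Im ((1 + w) * cis \<alpha>) \<le> 0) = (w \<in> U \<union> L)"
    proof (cases "0 < Im w")
      case True
      then have "0 \<le> Im w * cos \<alpha>" using ca by simp
      then show ?thesis using True unfolding U_def L_def Un_iff mem_Collect_eq A B by auto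
    next
      case False
      then have "Im w * cos \<alpha> \<le> 0" using ca by (simp add: mult_nonpos_nonneg)
      then show ?thesis using False w unfolding U_def L_def Un_iff mem_Collect_eq A B by auto
    qed
    then show "(w \<in> symbol_error (psk M) 1) = (w \<in> U \<union> L)" using psk_error_unit[OF M] by (simp add: \<alpha>_def)
  qed
  then have "measure ?G (symbol_error (psk M) 1) = measure ?G (U \<union> L)"
    by (rule measure_eq_AE) (use err ms in auto)
  also have "\<dots> = measure ?G U + measure ?G L"
    by (rule G.finite_measure_Union) (use ms in \<open>auto simp: U_def L_def\<close>)
  also have "\<dots> = 2 * measure ?G T" using mU mL by simp
  also have "measure ?G T = 1 / (2 * pi) * (LBINT \<theta>:{0..pi - \<alpha>}. exp (- ((sin \<alpha> / sqrt (V / 2))\<^sup>2 / (2 * (sin \<theta>)\<^sup>2))))"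
  proof -
    define s where "s = sqrt (V / 2)"
    have s: "0 < s" using V by (simp add: s_def)
    have "measure ?G T = measure (std_normal_distribution \<Otimes>\<^sub>M std_normal_distribution)
        {p. sin \<alpha> \<le> s * snd p \<and> 0 < (s * fst p) * sin \<alpha> + (s * snd p) * cos \<alpha>}"
      unfolding T_def s_def by (rule cgauss_measure_cartesian[OF V, where P="\<lambda>x y. sin \<alpha> \<le> y \<and> 0 < x * sin \<alpha> + y * cos \<alpha>"])
        (use ms(3) in \<open>simp add: T_def\<close>)
    also have "{p. sin \<alpha> \<le> s * snd p \<and> 0 < (s * fst p) * sin \<alpha> + (s * snd p) * cos \<alpha>} =
        {p. sin \<alpha> / s \<le> snd p \<and> 0 < fst p * sin \<alpha> + snd p * cos \<alpha>}"
    proof -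
      have "(0 < (s * x) * sin \<alpha> + (s * y) * cos \<alpha>) = (0 < x * sin \<alpha> + y * cos \<alpha>)" for x y
      proof -
        have "(s * x) * sin \<alpha> + (s * y) * cos \<alpha> = s * (x * sin \<alpha> + y * cos \<alpha>)" by (simp add: algebra_simps)
        then show ?thesis using s by (simp add: zero_less_mult_iff)
      qed
      moreover have "(sin \<alpha> \<le> s * y) = (sin \<alpha> / s \<le> y)" for y using s by (simp add: divide_le_eq mult.commute)
      ultimately show ?thesis by simp
    qed
    finally show ?thesis using wedge_probability[of "sin \<alpha> / s" \<alpha>] sa s \<alpha> unfolding s_def by simp
  qed
  also have "pi - \<alpha> = (real M - 1) * pi / real M" using M by (simp add: \<alpha>_def field_simps)
  also have "(\<lambda>\<theta>. exp (- ((sin \<alpha> / sqrt (V / 2))\<^sup>2 / (2 * (sin \<theta>)\<^sup>2)))) = (\<lambda>\<theta>. exp (- ((sin \<alpha>)\<^sup>2 / (V * (sin \<theta>)\<^sup>2))))"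
    using V by (simp add: power_divide fun_eq_iff)
  finally have one: "measure ?G (symbol_error (psk M) 1) = 1 / pi * (LBINT \<theta>:{0..(real M - 1) * pi / real M}. exp (- ((sin \<alpha>)\<^sup>2 / (V * (sin \<theta>)\<^sup>2))))"
    by simp
  have all: "measure ?G (symbol_error (psk M) c) = measure ?G (symbol_error (psk M) 1)" if "c \<in> psk M" for c
  proof -
    have "cmod (cnj c) = 1" using that by (auto simp: psk_def)
    then have "measure ?G {w. cnj c * w \<in> symbol_error (psk M) 1} = measure ?G (symbol_error (psk M) 1)"
      by (intro measure_cgauss_vimage cgauss_measure_rotate err) (use V in auto)
    then show ?thesis unfolding symbol_error_psk_rotate[OF that, symmetric] by simp
  qed
  have "cis (2 * pi * real 0 / real M) \<in> psk M" unfolding psk_def using M by (intro CollectI exI[of _ 0]) auto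
  then have "psk M \<noteq> {}" by blast
  then have "card (psk M) \<noteq> 0" using finite_psk by simp
  then have "sep (psk M) V = measure ?G (symbol_error (psk M) 1)" unfolding sep_def using all by simp
  then show ?thesis unfolding one \<alpha>_def .
qed

text \<open>The absolute value keeps the integrand at most 1 for every real \<open>c\<close>, so
  dominated convergence applies along arbitrary sequences. In the application
  \<open>c = 1 / V\<close> is positive.\<close>

lemma isCont_psk_integral:
  fixes a :: real assumes "0 \<le> a"
  shows "isCont (\<lambda>c. LBINT \<theta>:{0..b}. exp (- (\<bar>c\<bar> * a / (sin \<theta>)\<^sup>2))) c0"
  unfolding continuous_at_sequentially
proof (intro allI impI)
  fix c :: "nat \<Rightarrow> real" assume c: "c \<longlonglongrightarrow> c0"
  show "((\<lambda>c. LBINT \<theta>:{0..b}. exp (- (\<bar>c\<bar> * a / (sin \<theta>)\<^sup>2))) \<circ> c) \<longlonglongrightarrow> (LBINT \<theta>:{0..b}. exp (- (\<bar>c0\<bar> * a / (sin \<theta>)\<^sup>2)))"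
    unfolding comp_def set_lebesgue_integral_def
  proof (rule integral_dominated_convergence[where w="\<lambda>\<theta>. indicator {0..b} \<theta>"])
    show "integrable lborel (\<lambda>\<theta>. indicator {0..b} \<theta> :: real)" by (intro integrable_real_indicator) (auto simp: emeasure_lborel_Icc_eq)
    show "AE \<theta> in lborel. (\<lambda>i. indicator {0..b} \<theta> *\<^sub>R exp (- (\<bar>c i\<bar> * a / (sin \<theta>)\<^sup>2))) \<longlonglongrightarrow> indicator {0..b} \<theta> *\<^sub>R exp (- (\<bar>c0\<bar> * a / (sin \<theta>)\<^sup>2))"
    proof (intro AE_I2)
      fix \<theta> :: real
      have "(\<lambda>i. exp (- (\<bar>c i\<bar> * (a / (sin \<theta>)\<^sup>2)))) \<longlonglongrightarrow> exp (- (\<bar>c0\<bar> * (a / (sin \<theta>)\<^sup>2)))" by (intro tendsto_intros c)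
      then show "(\<lambda>i. indicator {0..b} \<theta> *\<^sub>R exp (- (\<bar>c i\<bar> * a / (sin \<theta>)\<^sup>2))) \<longlonglongrightarrow> indicator {0..b} \<theta> *\<^sub>R exp (- (\<bar>c0\<bar> * a / (sin \<theta>)\<^sup>2))"
        using tendsto_scaleR[OF tendsto_const] by (simp only: times_divide_eq_right)
    qed
    show "AE \<theta> in lborel. norm (indicator {0..b} \<theta> *\<^sub>R exp (- (\<bar>c i\<bar> * a / (sin \<theta>)\<^sup>2))) \<le> indicator {0..b} \<theta>" for i
      using assms by (auto split: split_indicator intro!: divide_nonneg_nonneg mult_nonneg_nonneg)
  qed measurable
qed

section \<open>Large-system limit\<close>

lemma uniform_precoder_mult:
  assumes "A \<in> carrier_mat r n"
  shows "A * uniform_precoder n = complex_of_real (1 / sqrt (real n)) \<cdot>\<^sub>m A"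
  unfolding uniform_precoder_def using assms by (subst mult_smult_distrib) auto

lemma independent_columns_scale:
  assumes "independent_columns r w n" "c \<noteq> 0"
  shows "independent_columns r (\<lambda>j m. c * w j m) n"
  unfolding independent_columns_def
proof (intro allI impI)
  fix x j assume x: "\<forall>m<r. (\<Sum>j<n. x j * (c * w j m)) = 0" and j: "j < n"
  define y where "y = (\<lambda>j. c * x j)"
  have "\<forall>m<r. (\<Sum>j<n. y j * w j m) = 0"
  proof (intro allI impI)
    fix m assume m: "m < r"
    have "(\<Sum>j<n. y j * w j m) = (\<Sum>j<n. x j * (c * w j m))"
      unfolding y_def by (intro sum.cong refl) (simp only: mult_ac)
    also have "\<dots> = 0" using x m by blast
    finally show "(\<Sum>j<n. y j * w j m) = 0" .
  qed
  then have "y j = 0" using assms(1) j unfolding independent_columns_def by blast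
  then have "c * x j = 0" by (simp only: y_def)
  then show "x j = 0" using assms(2) by simp
qed

text \<open>Row \<open>k\<close> of the pseudo-inverse is dual to the columns and its conjugate lies
  in their span, which is the situation of \<open>dual_row_norm\<close>. The factor \<open>n\<close>
  comes from the precoder scaling \<open>1 / sqrt n\<close>; it balances the linear growth of the
  squared residual, so that the noise variance of a stream stabilises.\<close>

lemma zf_row_norm:
  assumes A: "A \<in> carrier_mat r n" and ind: "independent_columns r (\<lambda>j m. A $$ (m, j)) n" and k: "k < n"
  defines "B \<equiv> A * uniform_precoder n"
  shows "det (mat_adjoint B * B) \<noteq> 0"
    and "nsq r (\<lambda>m. zf_pinv B $$ (k, m)) * nsq r (resid r (\<lambda>l m. A $$ (m, skip k l)) (n - 1) (\<lambda>m. A $$ (m, k))) = real n"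
proof -
  define c where "c = complex_of_real (1 / sqrt (real n))"
  have n: "0 < n" using k by simp
  have c0: "c \<noteq> 0" using n by (simp add: c_def)
  have B: "B \<in> carrier_mat r n" unfolding B_def uniform_precoder_mult[OF A] using A by simp
  have Bi: "B $$ (m, j) = c * A $$ (m, j)" if "m < r" "j < n" for m j
    unfolding B_def uniform_precoder_mult[OF A] c_def using A that by simp
  have "independent_columns r (\<lambda>j m. B $$ (m, j)) n"
    using independent_columns_scale[OF ind c0] unfolding independent_columns_def by (simp add: Bi)
  then show d: "det (mat_adjoint B * B) \<noteq> 0" by (rule det_gram_nonzero[OF B])
  \<comment> \<open>Span coefficients read off from \<open>zf_pinv_index\<close>; the factor
    \<open>c\<close> accounts for passing from the columns of \<open>B\<close> to those of
    \<open>A\<close>.\<close>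
  let ?x = "\<lambda>i. c * cnj (adj_mat (mat_adjoint B * B) $$ (k, i) / det (mat_adjoint B * B))"
  have "nsq r (\<lambda>m. zf_pinv B $$ (k, m)) * nsq r (resid r (\<lambda>l m. A $$ (m, skip k l)) (n - 1) (\<lambda>m. A $$ (m, k))) = (cmod (1 / c))\<^sup>2"
  proof (rule dual_row_norm[where h="\<lambda>j m. A $$ (m, j)" and x="?x", OF k])
    fix j assume j: "j < n"
    have "c * (\<Sum>m<r. zf_pinv B $$ (k, m) * A $$ (m, j)) = (\<Sum>m<r. zf_pinv B $$ (k, m) * B $$ (m, j))"
      unfolding sum_distrib_left by (intro sum.cong refl) (simp add: Bi j)
    also have "\<dots> = (if j = k then 1 else 0)" by (rule zf_pinv_left_inverse[OF B d k j])
    finally show "(\<Sum>m<r. zf_pinv B $$ (k, m) * A $$ (m, j)) = (if j = k then 1 / c else 0)"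
      using c0 by (auto simp: field_simps split: if_splits)
  next
    fix m assume m: "m < r"
    show "cnj (zf_pinv B $$ (k, m)) = (\<Sum>j<n. ?x j * A $$ (m, j))"
      unfolding zf_pinv_index[OF B k m] using d m by (simp add: cnj_sum Bi mult_ac)
  qed
  also have "\<dots> = real n" using n by (simp add: c_def norm_divide power_divide)
  finally show "nsq r (\<lambda>m. zf_pinv B $$ (k, m)) * nsq r (resid r (\<lambda>l m. A $$ (m, skip k l)) (n - 1) (\<lambda>m. A $$ (m, k))) = real n" .
qed

context mimo_system
begin

lemma noise_row_error:
  assumes S: "finite S" "c \<in> S" and V: "0 < \<sigma>\<^sup>2 * nsq Nr b"
  shows "measure (distr \<Omega> (vec_borel Nr) \<xi>) {x \<in> carrier_vec Nr. nearest_symbol S (c + (\<Sum>m<Nr. b m * x $ m)) \<noteq> c} =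
    measure (cgauss_measure (\<sigma>\<^sup>2 * nsq Nr b)) (symbol_error S c)"
proof -
  note [measurable] = nearest_symbol_measurable[OF S(1)]
  let ?Z = "\<lambda>\<omega>. \<Sum>m<Nr. b m * \<xi> \<omega> $ m"
  have Z: "cgauss \<Omega> ?Z (\<sigma>\<^sup>2 * nsq Nr b)" unfolding nsq_def by (rule noise_combination)
  have "{x \<in> space (vec_borel Nr). nearest_symbol S (c + (\<Sum>m<Nr. b m * x $ m)) \<noteq> c} \<in> sets (vec_borel Nr)" by measurable
  then have m: "{x \<in> carrier_vec Nr. nearest_symbol S (c + (\<Sum>m<Nr. b m * x $ m)) \<noteq> c} \<in> sets (vec_borel Nr)" by simp
  have carr: "\<omega> \<in> space \<Omega> \<Longrightarrow> \<xi> \<omega> \<in> carrier_vec Nr" for \<omega> using measurable_space[OF noise_measurable] by simp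
  have B: "{w. nearest_symbol S (c + w) \<noteq> c} \<in> sets borel"
  proof -
    have "{w \<in> space borel. nearest_symbol S (c + w) \<noteq> c} \<in> sets borel" by measurable
    then show ?thesis by simp
  qed
  have "measure (distr \<Omega> (vec_borel Nr) \<xi>) {x \<in> carrier_vec Nr. nearest_symbol S (c + (\<Sum>m<Nr. b m * x $ m)) \<noteq> c} =
     prob (\<xi> -` {x \<in> carrier_vec Nr. nearest_symbol S (c + (\<Sum>m<Nr. b m * x $ m)) \<noteq> c} \<inter> space \<Omega>)"
    by (rule measure_distr[OF noise_measurable m])
  also have "\<xi> -` {x \<in> carrier_vec Nr. nearest_symbol S (c + (\<Sum>m<Nr. b m * x $ m)) \<noteq> c} \<inter> space \<Omega> =
      ?Z -` {w. nearest_symbol S (c + w) \<noteq> c} \<inter> space \<Omega>" using carr by auto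
  also have "prob \<dots> = measure (distr \<Omega> borel ?Z) {w. nearest_symbol S (c + w) \<noteq> c}"
    by (rule measure_distr[symmetric]) (use Z B in \<open>auto simp: cgauss_def\<close>)
  also have "\<dots> = measure (cgauss_measure (\<sigma>\<^sup>2 * nsq Nr b)) (symbol_error S c)"
    unfolding cgauss_law[OF prob_space_axioms Z] by (rule nearest_symbol_error_prob[OF S V])
  finally show ?thesis .
qed

lemma symbol_component_measurable: "k < Nt \<Longrightarrow> (\<lambda>\<omega>. s \<omega> $ k) \<in> borel_measurable \<Omega>"
  using measurable_compose[OF symbols_measurable measurable_vec_index] .

lemma symbol_prob:
  assumes "finite S" "S \<noteq> {}" "k < Nt"
  shows "c \<in> S \<Longrightarrow> prob {\<omega> \<in> space \<Omega>. s \<omega> $ k = c} = 1 / real (card S)"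
    and "AE \<omega> in \<Omega>. s \<omega> $ k \<in> S"
proof -
  note [measurable] = symbol_component_measurable[OF assms(3)]
  have law: "prob {\<omega> \<in> space \<Omega>. s \<omega> $ k \<in> A} = measure (measure_pmf (pmf_of_set S)) A" if A: "A \<in> sets borel" for A
  proof -
    have "prob {\<omega> \<in> space \<Omega>. s \<omega> $ k \<in> A} = measure (distr \<Omega> borel (\<lambda>\<omega>. s \<omega> $ k)) A"
      using A by (subst measure_distr) (auto intro!: arg_cong[where f=prob])
    also have "\<dots> = measure (distr (measure_pmf (pmf_of_set S)) borel (\<lambda>c. c)) A" by (simp only: symbols_uniform[OF assms(3)])
    also have "\<dots> = measure (measure_pmf (pmf_of_set S)) A" using A by (subst measure_distr) auto
    finally show ?thesis .
  qed
  show "prob {\<omega> \<in> space \<Omega>. s \<omega> $ k = c} = 1 / real (card S)" if "c \<in> S"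
    using law[of "{c}"] that assms by (simp add: measure_pmf_single)
  have Sb: "S \<in> sets borel" using assms(1) by (rule finite_imp_closed[THEN borel_closed])
  have "measure (measure_pmf (pmf_of_set S)) S = 1"
    using measure_pmf.prob_eq_1[of S "pmf_of_set S"] assms by (simp add: AE_measure_pmf_iff)
  then have "prob {\<omega> \<in> space \<Omega>. s \<omega> $ k \<in> S} = 1" using law[OF Sb] by simp
  then have "AE \<omega> in \<Omega>. \<omega> \<in> {\<omega> \<in> space \<Omega>. s \<omega> $ k \<in> S}" using Sb by (subst prob_eq_1[symmetric]) auto
  then show "AE \<omega> in \<Omega>. s \<omega> $ k \<in> S" by eventually_elim simp
qed

text \<open>\<open>\<Phi>\<close> is the error probability conditional on the channel, obtained from
  the product law by Fubini. For a full-rank channel, stream \<open>k\<close> outputs its symbol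
  plus a combination of the noise whose weights form a row of the pseudo-inverse, so the conditional
  value is \<open>sep\<close> at \<open>\<sigma>\<^sup>2\<close> times the squared norm of that row.
  On the exceptional null set only \<open>0 \<le> \<Phi> \<le> 1\<close> is known.\<close>

lemma stream_error_probability:
  assumes S: "finite S" "S \<noteq> {}" and k: "k < Nt" and \<sigma>: "\<sigma> \<noteq> 0"
    and full: "AE \<omega> in \<Omega>. independent_columns Nr (column \<omega>) Nt"
  obtains \<Phi> :: "'w \<Rightarrow> real" where "\<Phi> \<in> borel_measurable \<Omega>" "\<And>\<omega>. 0 \<le> \<Phi> \<omega>" "\<And>\<omega>. \<Phi> \<omega> \<le> 1"
    "prob {\<omega> \<in> space \<Omega>. nearest_symbol S (zf_output (uniform_precoder Nt) (H \<omega>) (s \<omega>) (\<xi> \<omega>) $ k) \<noteq> s \<omega> $ k} = expectation \<Phi>"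
    "AE \<omega> in \<Omega>. \<Phi> \<omega> = sep S (\<sigma>\<^sup>2 * (real Nt / nsq Nr (resid Nr (\<lambda>l. column \<omega> (skip k l)) (Nt - 1) (column \<omega> k))))"
proof -
  let ?F = "uniform_precoder Nt"
  let ?MH = "mat_borel Nr Nt" and ?Ms = "vec_borel Nt" and ?Mx = "vec_borel Nr"
  let ?DH = "distr \<Omega> ?MH H" and ?Ds = "distr \<Omega> ?Ms s" and ?Dx = "distr \<Omega> ?Mx \<xi>"
  note [measurable] = nearest_symbol_measurable[OF S(1)] channel_measurable symbols_measurable noise_measurable
  interpret DH: prob_space ?DH by (rule prob_space_distr) measurable
  interpret Ds: prob_space ?Ds by (rule prob_space_distr) measurable
  interpret Dx: prob_space ?Dx by (rule prob_space_distr) measurable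
  interpret Dsx: pair_prob_space ?Ds ?Dx ..
  interpret Dall: pair_prob_space ?DH "?Ds \<Otimes>\<^sub>M ?Dx" ..
  define E where "E = {p \<in> space (?MH \<Otimes>\<^sub>M (?Ms \<Otimes>\<^sub>M ?Mx)).
      nearest_symbol S (zf_output ?F (fst p) (fst (snd p)) (snd (snd p)) $ k) \<noteq> fst (snd p) $ k}"
  have E: "E \<in> sets (?MH \<Otimes>\<^sub>M (?Ms \<Otimes>\<^sub>M ?Mx))"
  proof -
    let ?M = "?MH \<Otimes>\<^sub>M (?Ms \<Otimes>\<^sub>M ?Mx)"
    have carr: "fst p \<in> carrier_mat Nr Nt" "fst (snd p) \<in> carrier_vec Nt" "snd (snd p) \<in> carrier_vec Nr" if "p \<in> space ?M" for p
      using that by (auto simp: space_pair_measure)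
    have AF: "fst p * ?F \<in> carrier_mat Nr Nt" if "p \<in> space ?M" for p
      unfolding uniform_precoder_mult[OF carr(1)[OF that]] using carr(1)[OF that] by simp
    have AFm [measurable]: "(\<lambda>p. (fst p * ?F) $$ (m, j)) \<in> borel_measurable ?M" if "m < Nr" "j < Nt" for m j
    proof (subst measurable_cong)
      show "(fst p * ?F) $$ (m, j) = complex_of_real (1 / sqrt (real Nt)) * fst p $$ (m, j)" if "p \<in> space ?M" for p
        unfolding uniform_precoder_mult[OF carr(1)[OF that]] using carr(1)[OF that] \<open>m < Nr\<close> \<open>j < Nt\<close> by simp
      have [measurable]: "(\<lambda>p. fst p $$ (m, j)) \<in> borel_measurable ?M"
        by (rule measurable_compose[OF measurable_fst measurable_mat_index]) (use that in auto)
      show "(\<lambda>p. complex_of_real (1 / sqrt (real Nt)) * fst p $$ (m, j)) \<in> borel_measurable ?M" by measurable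
    qed
    have [measurable]: "(\<lambda>p. zf_pinv (fst p * ?F) $$ (k, m)) \<in> borel_measurable ?M" if "m < Nr" for m
      by (rule zf_pinv_measurable[OF AF AFm k that])
    have [measurable]: "(\<lambda>p. fst (snd p) $ j) \<in> borel_measurable ?M" if "j < Nt" for j
      by (rule measurable_compose[OF _ measurable_vec_index[OF that]]) measurable
    have [measurable]: "(\<lambda>p. snd (snd p) $ j) \<in> borel_measurable ?M" if "j < Nr" for j
      by (rule measurable_compose[OF _ measurable_vec_index[OF that]]) measurable
    have zm: "(\<lambda>p. zf_output ?F (fst p) (fst (snd p)) (snd (snd p)) $ k) \<in> borel_measurable ?M"
    proof (subst measurable_cong)
      show "zf_output ?F (fst p) (fst (snd p)) (snd (snd p)) $ k =
         (\<Sum>m<Nr. zf_pinv (fst p * ?F) $$ (k, m) * ((\<Sum>j<Nt. (fst p * ?F) $$ (m, j) * fst (snd p) $ j) + snd (snd p) $ m))"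
        if "p \<in> space ?M" for p
        by (rule zf_output_index[OF AF[OF that] carr(2,3)[OF that] k])
      show "(\<lambda>p. \<Sum>m<Nr. zf_pinv (fst p * ?F) $$ (k, m) * ((\<Sum>j<Nt. (fst p * ?F) $$ (m, j) * fst (snd p) $ j) + snd (snd p) $ m)) \<in> borel_measurable ?M"
        by measurable
    qed
    have nm: "(\<lambda>p. nearest_symbol S (zf_output ?F (fst p) (fst (snd p)) (snd (snd p)) $ k)) \<in> borel_measurable ?M"
      by (rule measurable_compose[OF zm nearest_symbol_measurable[OF S(1)]])
    have sm: "(\<lambda>p. fst (snd p) $ k) \<in> borel_measurable ?M" using k by measurable
    have "E = (\<lambda>p. nearest_symbol S (zf_output ?F (fst p) (fst (snd p)) (snd (snd p)) $ k) - fst (snd p) $ k) -` (- {0}) \<inter> space ?M"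
      by (auto simp: E_def)
    also have "\<dots> \<in> sets ?M" by (rule measurable_sets[OF borel_measurable_diff[OF nm sm]]) auto
    finally show ?thesis .
  qed
  have setsD: "sets (?DH \<Otimes>\<^sub>M (?Ds \<Otimes>\<^sub>M ?Dx)) = sets (?MH \<Otimes>\<^sub>M (?Ms \<Otimes>\<^sub>M ?Mx))"
    by (intro sets_pair_measure_cong) auto
  have E': "E \<in> sets (?DH \<Otimes>\<^sub>M (?Ds \<Otimes>\<^sub>M ?Dx))" using E unfolding setsD .
  define G where "G = (\<lambda>A. emeasure (?Ds \<Otimes>\<^sub>M ?Dx) (Pair A -` E))"
  have Gm: "G \<in> borel_measurable ?DH" unfolding G_def
    by (rule Dsx.measurable_emeasure_Pair[OF E'])
  then have Gm': "G \<in> borel_measurable ?MH" by simp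
  have GHm: "(\<lambda>\<omega>. G (H \<omega>)) \<in> borel_measurable \<Omega>" by (rule measurable_compose[OF channel_measurable Gm'])
  have G1: "G A \<le> 1" for A unfolding G_def by (rule Dsx.emeasure_le_1)
  have Gfin: "G A \<noteq> \<top>" for A using G1[of A] by (auto simp: top_unique)
  define \<Phi> where "\<Phi> = (\<lambda>\<omega>. enn2real (G (H \<omega>)))"
  have \<Phi>e: "ennreal (\<Phi> \<omega>) = G (H \<omega>)" for \<omega> unfolding \<Phi>_def using Gfin by (simp add: less_top)
  have \<Phi>m: "\<Phi> \<in> borel_measurable \<Omega>" unfolding \<Phi>_def using GHm by measurable
  have \<Phi>1: "\<Phi> \<omega> \<le> 1" for \<omega>
  proof -
    have "ennreal (\<Phi> \<omega>) \<le> ennreal 1" unfolding \<Phi>e using G1 by simp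
    then show ?thesis by (simp add: \<Phi>_def)
  qed
  have triple [measurable]: "(\<lambda>\<omega>. (H \<omega>, s \<omega>, \<xi> \<omega>)) \<in> measurable \<Omega> (?MH \<Otimes>\<^sub>M (?Ms \<Otimes>\<^sub>M ?Mx))" by measurable
  have i\<Phi>: "integrable \<Omega> \<Phi>"
    by (rule integrable_const_bound[where B=1]) (use \<Phi>m \<Phi>1 in \<open>auto simp: \<Phi>_def\<close>)
  have "emeasure \<Omega> {\<omega> \<in> space \<Omega>. nearest_symbol S (zf_output ?F (H \<omega>) (s \<omega>) (\<xi> \<omega>) $ k) \<noteq> s \<omega> $ k} =
     emeasure \<Omega> ((\<lambda>\<omega>. (H \<omega>, s \<omega>, \<xi> \<omega>)) -` E \<inter> space \<Omega>)"
    using measurable_space[OF triple] by (intro arg_cong[where f="emeasure \<Omega>"]) (auto simp: E_def)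
  also have "\<dots> = emeasure (distr \<Omega> (?MH \<Otimes>\<^sub>M (?Ms \<Otimes>\<^sub>M ?Mx)) (\<lambda>\<omega>. (H \<omega>, s \<omega>, \<xi> \<omega>))) E"
    by (rule emeasure_distr[OF triple E, symmetric])
  also have "\<dots> = emeasure (?DH \<Otimes>\<^sub>M (?Ds \<Otimes>\<^sub>M ?Dx)) E" unfolding independence ..
  also have "\<dots> = (\<integral>\<^sup>+A. G A \<partial>?DH)" unfolding G_def by (rule Dsx.emeasure_pair_measure_alt[OF E'])
  also have "\<dots> = (\<integral>\<^sup>+\<omega>. G (H \<omega>) \<partial>\<Omega>)" by (rule nn_integral_distr[OF channel_measurable Gm])
  also have "\<dots> = (\<integral>\<^sup>+\<omega>. ennreal (\<Phi> \<omega>) \<partial>\<Omega>)" unfolding \<Phi>e ..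
  also have "\<dots> = ennreal (expectation \<Phi>)" by (rule nn_integral_eq_integral[OF i\<Phi>]) (simp add: \<Phi>_def)
  finally have P: "prob {\<omega> \<in> space \<Omega>. nearest_symbol S (zf_output ?F (H \<omega>) (s \<omega>) (\<xi> \<omega>) $ k) \<noteq> s \<omega> $ k} = expectation \<Phi>"
    unfolding measure_def by (simp add: integral_nonneg_AE \<Phi>_def)
  have val: "\<Phi> \<omega> = sep S (\<sigma>\<^sup>2 * (real Nt / nsq Nr (resid Nr (\<lambda>l. column \<omega> (skip k l)) (Nt - 1) (column \<omega> k))))"
    if \<omega>: "\<omega> \<in> space \<Omega>" and ind: "independent_columns Nr (column \<omega>) Nt" for \<omega>
  proof -
    let ?A = "H \<omega>"
    define b where "b = (\<lambda>m. zf_pinv (?A * ?F) $$ (k, m))"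
    define R where "R = nsq Nr (resid Nr (\<lambda>l. column \<omega> (skip k l)) (Nt - 1) (column \<omega> k))"
    have A: "?A \<in> carrier_mat Nr Nt" by (rule H_carrier[OF \<omega>])
    have AF: "?A * ?F \<in> carrier_mat Nr Nt" unfolding uniform_precoder_mult[OF A] using A by simp
    have ind': "independent_columns Nr (\<lambda>j m. ?A $$ (m, j)) Nt" using ind by (simp add: column_def[abs_def])
    note zr = zf_row_norm[OF A ind' k]
    have bR: "nsq Nr b * R = real Nt" using zr(2) by (simp add: b_def R_def column_def[abs_def])
    have R: "R \<noteq> 0" "nsq Nr b \<noteq> 0" using bR k by auto
    have nb: "nsq Nr b = real Nt / R" using bR R by (simp add: field_simps)
    have V: "0 < \<sigma>\<^sup>2 * nsq Nr b" using \<sigma> R(2) nsq_nonneg[of Nr b] by (intro mult_pos_pos) (auto simp: less_le)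
    define e where "e = (\<lambda>c. measure (cgauss_measure (\<sigma>\<^sup>2 * nsq Nr b)) (symbol_error S c))"
    \<comment> \<open>Writing the slice probability as a sum of indicators over the symbols reduces
      the integral over \<open>s\<close> to point probabilities of \<open>s $ k\<close>.\<close>
    have slice: "emeasure ?Dx (Pair v -` (Pair ?A -` E)) = (\<Sum>c\<in>S. ennreal (e c) * indicator {c} (v $ k))"
      if v: "v \<in> carrier_vec Nt" "v $ k \<in> S" for v
    proof -
      have "Pair v -` (Pair ?A -` E) = {x \<in> carrier_vec Nr. nearest_symbol S (v $ k + (\<Sum>m<Nr. b m * x $ m)) \<noteq> v $ k}"
      proof (intro Set.set_eqI iffI)
        fix x assume "x \<in> Pair v -` (Pair ?A -` E)"
        then have x: "x \<in> carrier_vec Nr" and n: "nearest_symbol S (zf_output ?F ?A v x $ k) \<noteq> v $ k"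
          by (simp_all add: E_def space_pair_measure)
        then show "x \<in> {x \<in> carrier_vec Nr. nearest_symbol S (v $ k + (\<Sum>m<Nr. b m * x $ m)) \<noteq> v $ k}"
          unfolding zf_output_nonsingular[OF AF v(1) x k zr(1)] b_def by blast
      next
        fix x assume "x \<in> {x \<in> carrier_vec Nr. nearest_symbol S (v $ k + (\<Sum>m<Nr. b m * x $ m)) \<noteq> v $ k}"
        then have x: "x \<in> carrier_vec Nr" and n: "nearest_symbol S (v $ k + (\<Sum>m<Nr. zf_pinv (?A * ?F) $$ (k, m) * x $ m)) \<noteq> v $ k"
          by (simp_all add: b_def)
        then have "nearest_symbol S (zf_output ?F ?A v x $ k) \<noteq> v $ k"
          unfolding zf_output_nonsingular[OF AF v(1) x k zr(1)] by blast
        then show "x \<in> Pair v -` (Pair ?A -` E)" using x v(1) A by (simp add: E_def space_pair_measure)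
      qed
      then have "emeasure ?Dx (Pair v -` (Pair ?A -` E)) = ennreal (e (v $ k))"
        unfolding e_def noise_row_error[OF S(1) v(2) V, symmetric] by (simp only: Dx.emeasure_eq_measure)
      also have "\<dots> = (\<Sum>c\<in>S. if v $ k = c then ennreal (e c) else 0)" using S(1) v(2) by simp
      also have "\<dots> = (\<Sum>c\<in>S. ennreal (e c) * indicator {c} (v $ k))" by (intro sum.cong) (auto simp: indicator_def)
      finally show ?thesis .
    qed
    have AE_S: "AE v in ?Ds. v $ k \<in> S"
    proof (subst AE_distr_iff)
      have "S \<in> sets borel" using S(1) by (rule finite_imp_closed[THEN borel_closed])
      then show "{v \<in> space ?Ms. v $ k \<in> S} \<in> sets ?Ms" using k by measurable
      show "AE \<omega> in \<Omega>. s \<omega> $ k \<in> S" by (rule symbol_prob(2)[OF S k])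
    qed measurable
    have PE: "Pair ?A -` E \<in> sets (?Ds \<Otimes>\<^sub>M ?Dx)" by (rule sets_Pair1[OF E'])
    have "G ?A = (\<integral>\<^sup>+v. emeasure ?Dx (Pair v -` (Pair ?A -` E)) \<partial>?Ds)"
      unfolding G_def by (rule Dx.emeasure_pair_measure_alt[OF PE])
    also have "\<dots> = (\<integral>\<^sup>+v. (\<Sum>c\<in>S. ennreal (e c) * indicator {c} (v $ k)) \<partial>?Ds)"
    proof (rule nn_integral_cong_AE)
      show "AE v in ?Ds. emeasure ?Dx (Pair v -` (Pair ?A -` E)) = (\<Sum>c\<in>S. ennreal (e c) * indicator {c} (v $ k))"
        using AE_S AE_space by eventually_elim (rule slice, auto)
    qed
    also have "\<dots> = (\<integral>\<^sup>+\<omega>. (\<Sum>c\<in>S. ennreal (e c) * indicator {c} (s \<omega> $ k)) \<partial>\<Omega>)"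
      by (rule nn_integral_distr) (use k in measurable)
    also have "\<dots> = (\<Sum>c\<in>S. (\<integral>\<^sup>+\<omega>. ennreal (e c) * indicator {c} (s \<omega> $ k) \<partial>\<Omega>))"
      by (rule nn_integral_sum) (use symbol_component_measurable[OF k] in measurable)
    also have "\<dots> = (\<Sum>c\<in>S. ennreal (e c / real (card S)))"
    proof (intro sum.cong refl)
      fix c assume c: "c \<in> S"
      note [measurable] = symbol_component_measurable[OF k]
      have "(\<integral>\<^sup>+\<omega>. ennreal (e c) * indicator {c} (s \<omega> $ k) \<partial>\<Omega>) = ennreal (e c) * (\<integral>\<^sup>+\<omega>. indicator {\<omega> \<in> space \<Omega>. s \<omega> $ k = c} \<omega> \<partial>\<Omega>)"
        by (subst nn_integral_cmult[symmetric]) (auto intro!: nn_integral_cong simp: indicator_def)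
      also have "\<dots> = ennreal (e c) * ennreal (1 / real (card S))"
        using symbol_prob(1)[OF S k c] by (subst nn_integral_indicator) (auto simp: emeasure_eq_measure)
      also have "\<dots> = ennreal (e c / real (card S))" by (subst ennreal_mult[symmetric]) (auto simp: e_def)
      finally show "(\<integral>\<^sup>+\<omega>. ennreal (e c) * indicator {c} (s \<omega> $ k) \<partial>\<Omega>) = ennreal (e c / real (card S))" .
    qed
    also have "\<dots> = ennreal (\<Sum>c\<in>S. e c / real (card S))" by (rule sum_ennreal) (simp add: e_def)
    also have "(\<Sum>c\<in>S. e c / real (card S)) = sep S (\<sigma>\<^sup>2 * nsq Nr b)" by (simp add: sep_def e_def sum_divide_distrib)
    finally have "\<Phi> \<omega> = sep S (\<sigma>\<^sup>2 * nsq Nr b)" unfolding \<Phi>_def using sep_bounds[OF S(1)] by simp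
    then show ?thesis unfolding nb R_def .
  qed
  have "AE \<omega> in \<Omega>. \<Phi> \<omega> = sep S (\<sigma>\<^sup>2 * (real Nt / nsq Nr (resid Nr (\<lambda>l. column \<omega> (skip k l)) (Nt - 1) (column \<omega> k))))"
    using full AE_space by eventually_elim (rule val)
  then show thesis using that[OF \<Phi>m _ \<Phi>1 P] by (simp add: \<Phi>_def)
qed

text \<open>Outside the event \<open>B\<close> of a deviation by at least \<open>a\<close>, the
  conditional error is within \<open>e\<close> of \<open>g0\<close>; on \<open>B\<close> the two
  numbers from the unit interval differ by at most 1. Full rank replaces \<open>B\<close> by the
  event \<open>C\<close> of the concentration estimate up to a null set.\<close>

lemma interior_stream_error_bound:
  assumes \<Sigma>: "\<Sigma> = kms_matrix Nt \<rho>" and \<rho>: "cmod \<rho> < 1" and N: "Nt \<le> Nr" and k: "0 < k" "Suc k < Nt"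
    and S: "finite S" "S \<noteq> {}" and \<sigma>: "\<sigma> \<noteq> 0" and a: "0 < a" and e: "0 \<le> e" and g: "0 \<le> g0" "g0 \<le> 1"
  defines "t \<equiv> (1 - (cmod \<rho>)\<^sup>2) / (1 + (cmod \<rho>)\<^sup>2)"
  assumes close: "\<And>X. \<bar>X - (real Nr - real (Nt - 1)) * t\<bar> < a \<Longrightarrow> \<bar>sep S (\<sigma>\<^sup>2 * (real Nt / X)) - g0\<bar> \<le> e"
  shows "\<bar>prob {\<omega> \<in> space \<Omega>. nearest_symbol S (zf_output (uniform_precoder Nt) (H \<omega>) (s \<omega>) (\<xi> \<omega>) $ k) \<noteq> s \<omega> $ k} - g0\<bar>
    \<le> e + 2 * (real Nr + real (Nt - 1)) * t\<^sup>2 / a\<^sup>2"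
proof -
  have k': "k < Nt" using k by simp
  note full = full_rank_AE[OF \<Sigma> \<rho> N]
  obtain \<Phi> where \<Phi>: "\<Phi> \<in> borel_measurable \<Omega>" "\<And>\<omega>. 0 \<le> \<Phi> \<omega>" "\<And>\<omega>. \<Phi> \<omega> \<le> 1"
    and P: "prob {\<omega> \<in> space \<Omega>. nearest_symbol S (zf_output (uniform_precoder Nt) (H \<omega>) (s \<omega>) (\<xi> \<omega>) $ k) \<noteq> s \<omega> $ k} = expectation \<Phi>"
    and ae: "AE \<omega> in \<Omega>. \<Phi> \<omega> = sep S (\<sigma>\<^sup>2 * (real Nt / nsq Nr (resid Nr (\<lambda>l. column \<omega> (skip k l)) (Nt - 1) (column \<omega> k))))"
    using stream_error_probability[OF S k' \<sigma> full] by blast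
  let ?R = "\<lambda>\<omega>. nsq Nr (resid Nr (\<lambda>l. column \<omega> (skip k l)) (Nt - 1) (column \<omega> k))"
  have Rm [measurable]: "?R \<in> borel_measurable \<Omega>"
    by (intro nsq_measurable resid_measurable) (use k' skip_less[OF k'] in \<open>auto simp: column_def intro!: H_entry_measurable\<close>)
  have gm: "(\<lambda>\<omega>. nsq Nr (gs Nr (\<lambda>l. column \<omega> (skip k l)) j)) \<in> borel_measurable \<Omega>" if "j < Nt - 1" for j
    by (intro nsq_measurable resid_measurable) (use k' skip_less[OF k'] that in \<open>auto simp: column_def intro!: H_entry_measurable\<close>)
  define B where "B = {\<omega> \<in> space \<Omega>. a \<le> \<bar>?R \<omega> - (real Nr - real (Nt - 1)) * t\<bar>}"
  define C where "C = {\<omega> \<in> space \<Omega>. (\<forall>j<Nt - 1. nsq Nr (gs Nr (\<lambda>l. column \<omega> (skip k l)) j) \<noteq> 0) \<and>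
      a \<le> \<bar>?R \<omega> - (real Nr - real (Nt - 1)) * t\<bar>}"
  have B: "B \<in> events" unfolding B_def by measurable
  have C: "C \<in> events"
  proof -
    have "{\<omega> \<in> space \<Omega>. \<forall>j\<in>{..<Nt - 1}. nsq Nr (gs Nr (\<lambda>l. column \<omega> (skip k l)) j) \<noteq> 0} \<in> events"
      by (intro sets.sets_Collect_finite_All) (use gm in auto)
    moreover have "C = {\<omega> \<in> space \<Omega>. \<forall>j\<in>{..<Nt - 1}. nsq Nr (gs Nr (\<lambda>l. column \<omega> (skip k l)) j) \<noteq> 0} \<inter> B"
      by (auto simp: B_def C_def)
    ultimately show ?thesis using B by simp
  qed
  have "AE \<omega> in \<Omega>. \<omega> \<in> B \<longrightarrow> \<omega> \<in> C"
    using full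
  proof eventually_elim
    fix \<omega> assume "independent_columns Nr (column \<omega>) Nt"
    then have "independent_columns Nr (\<lambda>l. column \<omega> (skip k l)) (Nt - 1)" by (rule independent_columns_skip[OF _ k'])
    from gs_nonzero_if_independent[OF this] show "\<omega> \<in> B \<longrightarrow> \<omega> \<in> C" by (auto simp: B_def C_def)
  qed
  then have "prob B \<le> prob C" by (rule finite_measure_mono_AE[OF _ C])
  also have "prob C \<le> 2 * (real Nr + real (Nt - 1)) * t\<^sup>2 / a\<^sup>2"
    unfolding C_def t_def by (rule interior_concentration[OF \<Sigma> \<rho> k a])
  finally have pB: "prob B \<le> 2 * (real Nr + real (Nt - 1)) * t\<^sup>2 / a\<^sup>2" .
  have i\<Phi>: "integrable \<Omega> \<Phi>" by (rule integrable_const_bound[where B=1]) (use \<Phi> in auto)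
  have iB: "integrable \<Omega> (\<lambda>\<omega>. e + indicator B \<omega>)" using B by (intro Bochner_Integration.integrable_add integrable_const integrable_real_indicator) (auto simp: emeasure_eq_measure)
  have "\<bar>expectation \<Phi> - g0\<bar> = \<bar>expectation (\<lambda>\<omega>. \<Phi> \<omega> - g0)\<bar>" using i\<Phi> by (simp add: prob_space)
  also have "\<dots> \<le> expectation (\<lambda>\<omega>. \<bar>\<Phi> \<omega> - g0\<bar>)" by (rule integral_abs_bound)
  also have "\<dots> \<le> expectation (\<lambda>\<omega>. e + indicator B \<omega>)"
  proof (rule integral_mono_AE)
    show "integrable \<Omega> (\<lambda>\<omega>. \<bar>\<Phi> \<omega> - g0\<bar>)" using i\<Phi> by simp
    show "AE \<omega> in \<Omega>. \<bar>\<Phi> \<omega> - g0\<bar> \<le> e + indicator B \<omega>"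
      using ae AE_space
    proof eventually_elim
      fix \<omega> assume eq: "\<Phi> \<omega> = sep S (\<sigma>\<^sup>2 * (real Nt / ?R \<omega>))" and \<omega>: "\<omega> \<in> space \<Omega>"
      show "\<bar>\<Phi> \<omega> - g0\<bar> \<le> e + indicator B \<omega>"
      proof (cases "\<omega> \<in> B")
        case True
        then show ?thesis using \<Phi>(2,3)[of \<omega>] g e by (auto simp: abs_le_iff)
      next
        case False
        then have "\<bar>?R \<omega> - (real Nr - real (Nt - 1)) * t\<bar> < a" using \<omega> by (auto simp: B_def)
        from close[OF this] show ?thesis using False by (simp add: eq)
      qed
    qed
  qed (rule iB)
  also have "\<dots> = expectation (\<lambda>\<omega>. e) + expectation (indicator B)"
    using B by (intro Bochner_Integration.integral_add integrable_real_indicator) (auto simp: emeasure_eq_measure)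
  also have "\<dots> = e + prob B" using B by (simp add: prob_space)
  finally show ?thesis unfolding P using pB by simp
qed

end

text \<open>The constellation enters through a formula \<open>g\<close> that equals
  \<open>sep\<close> for positive variance and is continuous at the limiting variance. The estimate
  is uniform over the interior streams, and the two others contribute at most \<open>2 / Nt\<close>
  to the averaged deviation.\<close>

lemma sep_limit:
  fixes \<beta> \<sigma> :: real and \<rho> :: complex and S :: "complex set"
    and \<Omega> :: "nat \<Rightarrow> 'w measure" and H :: "nat \<Rightarrow> 'w \<Rightarrow> complex mat" and s \<xi> :: "nat \<Rightarrow> 'w \<Rightarrow> complex vec"
  assumes \<beta>: "1 < \<beta>" and \<sigma>: "\<sigma> \<noteq> 0" and \<rho>: "cmod \<rho> < 1"
    and sys: "\<And>Nt Nr. 0 < Nt \<Longrightarrow> real Nr = \<beta> * real Nt \<Longrightarrow>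
           mimo_system (\<Omega> Nt) Nt Nr (kms_matrix Nt \<rho>) \<sigma> S (H Nt) (s Nt) (\<xi> Nt)"
    and S: "finite S" "S \<noteq> {}"
  defines "t \<equiv> (1 - (cmod \<rho>)\<^sup>2) / (1 + (cmod \<rho>)\<^sup>2)"
  assumes g: "\<And>V. 0 < V \<Longrightarrow> sep S V = g V" and cont: "isCont g (\<sigma>\<^sup>2 / ((\<beta> - 1) * t))"
  shows "((\<lambda>Nt. average_sep (\<Omega> Nt) Nt S (uniform_precoder Nt) (H Nt) (s Nt) (\<xi> Nt)) \<longlongrightarrow> g (\<sigma>\<^sup>2 / ((\<beta> - 1) * t)))
     (integral_ratio_at_top \<beta>)"
proof (rule tendstoI)
  fix \<epsilon> :: real assume \<epsilon>: "0 < \<epsilon>"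
  define x0 where "x0 = (\<beta> - 1) * t"
  define g0 where "g0 = g (\<sigma>\<^sup>2 / x0)"
  have "(cmod \<rho>)\<^sup>2 < 1" using \<rho> by (simp add: power_less_one_iff abs_square_less_1)
  then have t: "0 < t" by (simp add: t_def add_pos_nonneg)
  have x0: "0 < x0" using \<beta> t by (simp add: x0_def)
  have V0: "0 < \<sigma>\<^sup>2 / x0" using \<sigma> x0 by simp
  have g01: "0 \<le> g0" "g0 \<le> 1" using sep_bounds[OF S(1), of "\<sigma>\<^sup>2 / x0"] g[OF V0] by (auto simp: g0_def)
  have "isCont (\<lambda>x. g (\<sigma>\<^sup>2 / x)) x0"
    by (rule isCont_o2[where g=g]) (use x0 cont in \<open>auto simp: x0_def[symmetric] intro!: continuous_intros\<close>)
  then obtain \<delta>1 where \<delta>1: "0 < \<delta>1" "\<And>x. \<bar>x - x0\<bar> < \<delta>1 \<Longrightarrow> \<bar>g (\<sigma>\<^sup>2 / x) - g0\<bar> < \<epsilon> / 3"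
    using \<epsilon> unfolding continuous_at_eps_delta g0_def dist_real_def by (metis divide_pos_pos zero_less_numeral)
  \<comment> \<open>The bound by \<open>x0\<close> keeps \<open>x\<close> positive, where
    \<open>g\<close> and \<open>sep\<close> agree.\<close>
  define \<delta> where "\<delta> = min \<delta>1 x0"
  have \<delta>: "0 < \<delta>" using \<delta>1 x0 by (simp add: \<delta>_def)
  have near: "\<bar>sep S (\<sigma>\<^sup>2 / x) - g0\<bar> < \<epsilon> / 3" if "\<bar>x - x0\<bar> < \<delta>" for x
  proof -
    have "0 < x" using that by (auto simp: \<delta>_def)
    then have "sep S (\<sigma>\<^sup>2 / x) = g (\<sigma>\<^sup>2 / x)" using \<sigma> by (intro g) simp
    then show ?thesis using \<delta>1(2)[of x] that by (simp add: \<delta>_def)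
  qed
  \<comment> \<open>Chebyshev's bound with \<open>a = n * \<delta> / 2\<close>: the quotient of
    \<open>2 * (\<beta> + 1) * n * t^2\<close> by \<open>n^2 * \<delta>^2 / 4\<close> is
    \<open>K / n\<close>.\<close>
  define K where "K = 8 * (\<beta> + 1) * t\<^sup>2 / \<delta>\<^sup>2"
  have K: "0 \<le> K" using \<beta> by (simp add: K_def)
  \<comment> \<open>The entry 3 keeps the two boundary indices distinct,
    \<open>2 * t / \<delta>\<close> ensures \<open>t < a\<close>, and the last entry brings the
    Chebyshev term and the two boundary streams together below
    \<open>\<epsilon> / 6\<close>.\<close>
  define N0 where "N0 = nat \<lceil>max 3 (max (2 * t / \<delta>) (6 * (K + 2) / \<epsilon>))\<rceil> + 1"
  have main: "dist (average_sep (\<Omega> n) n S (uniform_precoder n) (H n) (s n) (\<xi> n)) (g (\<sigma>\<^sup>2 / ((\<beta> - 1) * t))) < \<epsilon>"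
    if n: "N0 \<le> n" and r: "\<beta> * real n \<in> \<nat>" for n
  proof -
    have big: "max 3 (max (2 * t / \<delta>) (6 * (K + 2) / \<epsilon>)) < real n"
    proof -
      have "max 3 (max (2 * t / \<delta>) (6 * (K + 2) / \<epsilon>)) < real N0" unfolding N0_def by linarith
      then show ?thesis using n by linarith
    qed
    then have n3: "3 < n" and nt: "2 * t / \<delta> < real n" and nK: "6 * (K + 2) / \<epsilon> < real n" by auto
    have n0: "0 < real n" using n3 by simp
    obtain R where R: "real R = \<beta> * real n" using r by (metis Nats_cases)
    interpret mimo_system "\<Omega> n" n R "kms_matrix n \<rho>" \<sigma> S "H n" "s n" "\<xi> n"
      by (rule sys) (use n3 R in auto)
    have nR: "n \<le> R"
    proof -
      have "real n \<le> real R" unfolding R using \<beta> n0 by simp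
      then show ?thesis by simp
    qed
    define p where "p = (\<lambda>k. prob {\<omega> \<in> space (\<Omega> n). nearest_symbol S (zf_output (uniform_precoder n) (H n \<omega>) (s n \<omega>) (\<xi> n \<omega>) $ k) \<noteq> s n \<omega> $ k})"
    \<comment> \<open>Only \<open>n - 1\<close> columns are projected out, which moves the centre by
      \<open>t\<close> away from \<open>n * x0\<close>. Half of the tolerance
      \<open>n * \<delta>\<close> is reserved for this shift.\<close>
    have mean: "(real R - real (n - 1)) * t = real n * x0 + t"
      using n3 by (simp add: R x0_def of_nat_diff algebra_simps)
    define a where "a = real n * \<delta> / 2"
    have a: "0 < a" using n0 \<delta> by (simp add: a_def)
    have ta: "t < a" using nt \<delta> by (simp add: a_def field_simps)
    have inner: "\<bar>p k - g0\<bar> \<le> \<epsilon> / 3 + K / real n" if k: "0 < k" "Suc k < n" for k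
    proof -
      have "\<bar>p k - g0\<bar> \<le> \<epsilon> / 3 + 2 * (real R + real (n - 1)) * t\<^sup>2 / a\<^sup>2"
        unfolding p_def t_def
      proof (rule interior_stream_error_bound[OF refl \<rho> nR k S \<sigma> a _ g01], unfold t_def[symmetric] mean)
        fix X assume X: "\<bar>X - (real n * x0 + t)\<bar> < a"
        have "\<bar>X / real n - x0\<bar> < \<delta>"
        proof -
          have "\<bar>X - real n * x0\<bar> < real n * \<delta>"
          proof -
            have "\<bar>X - real n * x0\<bar> < a + t" using X t by linarith
            then show ?thesis using ta by (simp add: a_def)
          qed
          moreover have "X / real n - x0 = (X - real n * x0) / real n" using n0 by (simp add: field_simps)
          ultimately show ?thesis using n0 by (simp add: abs_divide divide_less_eq mult.commute)
        qed
        from near[OF this] have "\<bar>sep S (\<sigma>\<^sup>2 / (X / real n)) - g0\<bar> < \<epsilon> / 3" .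
        moreover have "\<sigma>\<^sup>2 / (X / real n) = \<sigma>\<^sup>2 * (real n / X)" by simp
        ultimately show "\<bar>sep S (\<sigma>\<^sup>2 * (real n / X)) - g0\<bar> \<le> \<epsilon> / 3" by simp
      qed (use \<epsilon> in simp)
      also have "2 * (real R + real (n - 1)) * t\<^sup>2 / a\<^sup>2 \<le> K / real n"
      proof -
        have "real R + real (n - 1) \<le> (\<beta> + 1) * real n" unfolding R distrib_right by simp
        then have "2 * (real R + real (n - 1)) * t\<^sup>2 / a\<^sup>2 \<le> 2 * ((\<beta> + 1) * real n) * t\<^sup>2 / a\<^sup>2"
          by (intro divide_right_mono mult_right_mono mult_left_mono) simp_all
        also have "\<dots> = K / real n"
        proof -
          have "a\<^sup>2 = real n * (real n * \<delta>\<^sup>2 / 4)" by (simp add: a_def power_mult_distrib power_divide power2_eq_square)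
          then show ?thesis using n0 \<delta> unfolding K_def by (simp only:) (simp add: divide_simps)
        qed
        finally show ?thesis .
      qed
      finally show ?thesis by simp
    qed
    have outer: "\<bar>p k - g0\<bar> \<le> 1" for k
    proof -
      have "0 \<le> p k" "p k \<le> 1" by (auto simp: p_def)
      then show ?thesis using g01 by (simp add: abs_le_iff)
    qed
    \<comment> \<open>The two indicator terms charge the trivial bound 1 to the boundary
      streams.\<close>
    have bnd: "\<bar>p k - g0\<bar> \<le> (\<epsilon> / 3 + K / real n) + ((if k = 0 then 1 else 0) + (if k = n - 1 then 1 else 0))" if "k < n" for k
    proof (cases "0 < k \<and> Suc k < n")
      case True
      then have "k \<noteq> 0" "k \<noteq> n - 1" by auto
      then show ?thesis using inner[of k] True by simp
    next
      case False
      then have "k = 0 \<or> k = n - 1" using that by auto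
      moreover have "0 \<le> \<epsilon> / 3 + K / real n" using \<epsilon> K by simp
      ultimately show ?thesis using outer[of k] by auto
    qed
    have av: "average_sep (\<Omega> n) n S (uniform_precoder n) (H n) (s n) (\<xi> n) = (\<Sum>k<n. p k) / real n"
      by (simp add: average_sep_def p_def)
    have "average_sep (\<Omega> n) n S (uniform_precoder n) (H n) (s n) (\<xi> n) - g0 = (\<Sum>k<n. p k - g0) / real n"
      unfolding av using n0 by (simp add: sum_subtractf field_simps)
    then have "\<bar>average_sep (\<Omega> n) n S (uniform_precoder n) (H n) (s n) (\<xi> n) - g0\<bar> \<le> (\<Sum>k<n. \<bar>p k - g0\<bar>) / real n"
      using n0 by (simp add: abs_divide divide_right_mono sum_abs)
    also have "\<dots> \<le> (\<Sum>k<n. (\<epsilon> / 3 + K / real n) + ((if k = 0 then 1 else 0) + (if k = n - 1 then 1 else 0))) / real n"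
      using n0 bnd by (intro divide_right_mono sum_mono) auto
    also have "(\<Sum>k<n. (\<epsilon> / 3 + K / real n) + ((if k = 0 then 1 else 0) + (if k = n - 1 then 1 else (0::real)))) = real n * (\<epsilon> / 3) + K + 2"
      using n3 by (simp add: sum.distrib distrib_left)
    also have "(real n * (\<epsilon> / 3) + K + 2) / real n = \<epsilon> / 3 + (K + 2) / real n" using n0 by (simp add: field_simps)
    also have "\<dots> < \<epsilon>"
    proof -
      have "(K + 2) / real n < \<epsilon> / 6" using nK n0 \<epsilon> by (simp add: field_simps)
      then show ?thesis using \<epsilon> by linarith
    qed
    finally show ?thesis by (simp add: dist_real_def g0_def x0_def)
  qed
  show "\<forall>\<^sub>F n in integral_ratio_at_top \<beta>. dist (average_sep (\<Omega> n) n S (uniform_precoder n) (H n) (s n) (\<xi> n)) (g (\<sigma>\<^sup>2 / ((\<beta> - 1) * t))) < \<epsilon>"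
    unfolding integral_ratio_at_top_def eventually_inf_principal
    by (rule eventually_mono[OF eventually_ge_at_top[of N0]]) (use main in auto)
qed

theorem theorem3:
  fixes \<beta> \<eta> \<sigma> :: real and \<rho> :: complex and M :: nat and S :: "complex set"
    and \<Omega> :: "nat \<Rightarrow> 'w measure"
    and H :: "nat \<Rightarrow> 'w \<Rightarrow> complex mat" and s \<xi> :: "nat \<Rightarrow> 'w \<Rightarrow> complex vec"
  assumes "1 < \<beta>" and "0 < \<eta>" and "\<eta> = 1 / \<sigma>\<^sup>2"
    and "0 < cmod \<rho>" and "cmod \<rho> < 1"
    and "\<And>Nt Nr. 0 < Nt \<Longrightarrow> real Nr = \<beta> * real Nt \<Longrightarrow>
           mimo_system (\<Omega> Nt) Nt Nr (kms_matrix Nt \<rho>) \<sigma> S (H Nt) (s Nt) (\<xi> Nt)"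
  shows "(2 \<le> M \<and> S = pam M \<longrightarrow>
      ((\<lambda>Nt. average_sep (\<Omega> Nt) Nt S (uniform_precoder Nt) (H Nt) (s Nt) (\<xi> Nt)) \<longlongrightarrow>
        2 * (real M - 1) / real M *
          gaussian_Q (sqrt (6 * \<eta> * (\<beta> - 1) * (1 - (cmod \<rho>)\<^sup>2) /
            (((real M)\<^sup>2 - 1) * (1 + (cmod \<rho>)\<^sup>2)))))
      (integral_ratio_at_top \<beta>)) \<and>
    (2 \<le> M \<and> S = psk M \<longrightarrow>
      ((\<lambda>Nt. average_sep (\<Omega> Nt) Nt S (uniform_precoder Nt) (H Nt) (s Nt) (\<xi> Nt)) \<longlongrightarrow>
        1 / pi * (LBINT \<theta>:{0..(real M - 1) * pi / real M}.
          exp (- (\<eta> * (\<beta> - 1) * (1 - (cmod \<rho>)\<^sup>2) * (sin (pi / real M))\<^sup>2 /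
            ((1 + (cmod \<rho>)\<^sup>2) * (sin \<theta>)\<^sup>2)))))
      (integral_ratio_at_top \<beta>)) \<and>
    (sqrt (real M) \<in> \<nat> \<and> 2 \<le> sqrt (real M) \<and> S = qam M \<longrightarrow>
      ((\<lambda>Nt. average_sep (\<Omega> Nt) Nt S (uniform_precoder Nt) (H Nt) (s Nt) (\<xi> Nt)) \<longlongrightarrow>
        4 * (sqrt (real M) - 1) / sqrt (real M) *
          gaussian_Q (sqrt (3 * \<eta> * (\<beta> - 1) * (1 - (cmod \<rho>)\<^sup>2) /
            ((real M - 1) * (1 + (cmod \<rho>)\<^sup>2)))) -
        4 * (sqrt (real M) - 1)\<^sup>2 / real M *
          (gaussian_Q (sqrt (3 * \<eta> * (\<beta> - 1) * (1 - (cmod \<rho>)\<^sup>2) /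
            ((real M - 1) * (1 + (cmod \<rho>)\<^sup>2)))))\<^sup>2)
      (integral_ratio_at_top \<beta>))"
proof -
  define t where "t = (1 - (cmod \<rho>)\<^sup>2) / (1 + (cmod \<rho>)\<^sup>2)"
  define V0 where "V0 = \<sigma>\<^sup>2 / ((\<beta> - 1) * t)"
  have \<sigma>: "\<sigma> \<noteq> 0" using assms(2,3) by auto
  have "(cmod \<rho>)\<^sup>2 < 1" using assms(5) by (simp add: power_less_one_iff abs_square_less_1)
  then have t: "0 < t" by (simp add: t_def add_pos_nonneg)
  have V0: "0 < V0" using \<sigma> t assms(1) by (simp add: V0_def)
  have pp: "0 < 1 + (cmod \<rho>)\<^sup>2" by (rule add_pos_nonneg) auto
  have inv: "1 / V0 = \<eta> * (\<beta> - 1) * (1 - (cmod \<rho>)\<^sup>2) / (1 + (cmod \<rho>)\<^sup>2)"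
    using \<sigma> by (simp add: V0_def t_def assms(3))
  have lim: "((\<lambda>Nt. average_sep (\<Omega> Nt) Nt S (uniform_precoder Nt) (H Nt) (s Nt) (\<xi> Nt)) \<longlongrightarrow> g V0) (integral_ratio_at_top \<beta>)"
    if "finite S" "S \<noteq> {}" "\<And>V. 0 < V \<Longrightarrow> sep S V = g V" "isCont g V0" for g
    using sep_limit[OF assms(1) \<sigma> assms(5,6) that(1,2)] that(3,4) unfolding V0_def t_def by blast
  have Qc: "isCont (\<lambda>V. gaussian_Q (sqrt d / sqrt (V / 2))) V0" for d
    by (rule isCont_o2[OF _ isCont_gaussian_Q]) (use V0 in \<open>auto intro!: continuous_intros\<close>)
  \<comment> \<open>\<open>d\<close> is the squared half-spacing of the constellation,
    \<open>3 / (M^2 - 1)\<close> for PAM and \<open>3 / (2 * (M - 1))\<close> for QAM; doubling it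
    gives the constants 6 and 3 of the claim.\<close>
  have arg: "sqrt d / sqrt (V0 / 2) = sqrt (2 * d * \<eta> * (\<beta> - 1) * (1 - (cmod \<rho>)\<^sup>2) / (1 + (cmod \<rho>)\<^sup>2))" for d
  proof -
    have "sqrt d / sqrt (V0 / 2) = sqrt (2 * d * (1 / V0))" by (simp add: real_sqrt_divide[symmetric])
    then show ?thesis unfolding inv by simp
  qed
  have pam: "((\<lambda>Nt. average_sep (\<Omega> Nt) Nt S (uniform_precoder Nt) (H Nt) (s Nt) (\<xi> Nt)) \<longlongrightarrow>
        2 * (real M - 1) / real M *
          gaussian_Q (sqrt (6 * \<eta> * (\<beta> - 1) * (1 - (cmod \<rho>)\<^sup>2) /
            (((real M)\<^sup>2 - 1) * (1 + (cmod \<rho>)\<^sup>2)))))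
      (integral_ratio_at_top \<beta>)" if M: "2 \<le> M" and S: "S = pam M"
  proof -
    let ?d = "3 / ((real M)\<^sup>2 - 1)"
    have img: "pam M = (\<lambda>i. complex_of_real (sqrt (3 / (real M ^ 2 - 1)) * (2 * real i - 1 - real M))) ` {1..M}"
      by (auto simp: pam_def)
    have fin: "finite S" "S \<noteq> {}" unfolding S img using M by auto
    let ?g = "\<lambda>V. 2 * (real M - 1) / real M * gaussian_Q (sqrt ?d / sqrt (V / 2))"
    have "((\<lambda>Nt. average_sep (\<Omega> Nt) Nt S (uniform_precoder Nt) (H Nt) (s Nt) (\<xi> Nt)) \<longlongrightarrow> ?g V0) (integral_ratio_at_top \<beta>)"
    proof (rule lim[OF fin])
      show "sep S V = ?g V" if "0 < V" for V unfolding S by (rule sep_pam[OF M that])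
      show "isCont ?g V0" by (intro continuous_intros Qc)
    qed
    moreover have "2 * ?d * \<eta> * (\<beta> - 1) * (1 - (cmod \<rho>)\<^sup>2) / (1 + (cmod \<rho>)\<^sup>2) =
       6 * \<eta> * (\<beta> - 1) * (1 - (cmod \<rho>)\<^sup>2) / (((real M)\<^sup>2 - 1) * (1 + (cmod \<rho>)\<^sup>2))" by simp
    ultimately show ?thesis unfolding arg by (simp only:)
  qed
  have psk: "((\<lambda>Nt. average_sep (\<Omega> Nt) Nt S (uniform_precoder Nt) (H Nt) (s Nt) (\<xi> Nt)) \<longlongrightarrow>
        1 / pi * (LBINT \<theta>:{0..(real M - 1) * pi / real M}.
          exp (- (\<eta> * (\<beta> - 1) * (1 - (cmod \<rho>)\<^sup>2) * (sin (pi / real M))\<^sup>2 /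
            ((1 + (cmod \<rho>)\<^sup>2) * (sin \<theta>)\<^sup>2)))))
      (integral_ratio_at_top \<beta>)" if M: "2 \<le> M" and S: "S = psk M"
  proof -
    let ?b = "(real M - 1) * pi / real M" and ?a = "(sin (pi / real M))\<^sup>2"
    \<comment> \<open>For \<open>V > 0\<close> the absolute value changes nothing; it brings the
      formula into the form whose continuity in \<open>1 / V\<close> is known on the whole
      line.\<close>
    define g where "g = (\<lambda>V. 1 / pi * (LBINT \<theta>:{0..?b}. exp (- (\<bar>1 / V\<bar> * ?a / (sin \<theta>)\<^sup>2))))"
    have "cis (2 * pi * real 0 / real M) \<in> psk M" unfolding psk_def using M by (intro CollectI exI[of _ 0]) auto
    then have fin: "finite S" "S \<noteq> {}" unfolding S using finite_psk by blast+
    have eq: "sep S V = g V" if "0 < V" for V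
      unfolding S sep_psk[OF M that] g_def using that by (simp add: mult.commute)
    have "isCont g V0" unfolding g_def
      by (intro continuous_intros isCont_o2[OF _ isCont_psk_integral]) (use V0 in auto)
    then have "((\<lambda>Nt. average_sep (\<Omega> Nt) Nt S (uniform_precoder Nt) (H Nt) (s Nt) (\<xi> Nt)) \<longlongrightarrow> g V0) (integral_ratio_at_top \<beta>)"
      using lim[OF fin eq] by blast
    moreover have "\<bar>1 / V0\<bar> * ?a / (sin \<theta>)\<^sup>2 = \<eta> * (\<beta> - 1) * (1 - (cmod \<rho>)\<^sup>2) * ?a / ((1 + (cmod \<rho>)\<^sup>2) * (sin \<theta>)\<^sup>2)" for \<theta>
    proof -
      have a: "\<bar>1 / V0\<bar> = 1 / V0" using V0 by simp
      show ?thesis unfolding a unfolding inv by simp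
    qed
    ultimately show ?thesis unfolding g_def by (simp only:)
  qed
  have qam: "((\<lambda>Nt. average_sep (\<Omega> Nt) Nt S (uniform_precoder Nt) (H Nt) (s Nt) (\<xi> Nt)) \<longlongrightarrow>
        4 * (sqrt (real M) - 1) / sqrt (real M) *
          gaussian_Q (sqrt (3 * \<eta> * (\<beta> - 1) * (1 - (cmod \<rho>)\<^sup>2) /
            ((real M - 1) * (1 + (cmod \<rho>)\<^sup>2)))) -
        4 * (sqrt (real M) - 1)\<^sup>2 / real M *
          (gaussian_Q (sqrt (3 * \<eta> * (\<beta> - 1) * (1 - (cmod \<rho>)\<^sup>2) /
            ((real M - 1) * (1 + (cmod \<rho>)\<^sup>2)))))\<^sup>2)
      (integral_ratio_at_top \<beta>)" if sq: "sqrt (real M) \<in> \<nat>" and two: "2 \<le> sqrt (real M)" and S: "S = qam M"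
  proof -
    obtain L where L: "sqrt (real M) = real L" using sq by (metis Nats_cases)
    have M2: "real M = (real L)\<^sup>2" using L by (metis of_nat_0_le_iff real_sqrt_pow2)
    then have M_L: "M = L ^ 2" by (metis of_nat_eq_iff of_nat_power)
    have L2: "2 \<le> L" using two L by simp
    let ?d = "3 / (2 * ((real L)\<^sup>2 - 1))"
    have fin: "finite S" "S \<noteq> {}"
    proof -
      let ?f = "\<lambda>i. sqrt (3 / (2 * (real M - 1))) * (2 * real i - 1 - sqrt (real M))"
      have "{?f i | i. 1 \<le> i \<and> real i \<le> sqrt (real M)} = ?f ` {1..L}" unfolding L by auto
      then have "S = (\<lambda>p. Complex (fst p) (snd p)) ` ((?f ` {1..L}) \<times> (?f ` {1..L}))"
        unfolding S qam_def Let_def by (force simp: image_iff)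
      then show "finite S" "S \<noteq> {}" using L2 by auto
    qed
    have two_d: "2 * (3 / (2 * X)) = 3 / X" for X :: real by simp
    let ?g = "\<lambda>V. 4 * (real L - 1) / real L * gaussian_Q (sqrt ?d / sqrt (V / 2)) -
        4 * (real L - 1)\<^sup>2 / (real L)\<^sup>2 * (gaussian_Q (sqrt ?d / sqrt (V / 2)))\<^sup>2"
    have "((\<lambda>Nt. average_sep (\<Omega> Nt) Nt S (uniform_precoder Nt) (H Nt) (s Nt) (\<xi> Nt)) \<longlongrightarrow> ?g V0) (integral_ratio_at_top \<beta>)"
    proof (rule lim[OF fin])
      show "sep S V = ?g V" if "0 < V" for V unfolding S M_L by (rule sep_qam[OF L2 that])
      show "isCont ?g V0" by (intro continuous_intros Qc)
    qed
    moreover have "2 * ?d * \<eta> * (\<beta> - 1) * (1 - (cmod \<rho>)\<^sup>2) / (1 + (cmod \<rho>)\<^sup>2) =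
       3 * \<eta> * (\<beta> - 1) * (1 - (cmod \<rho>)\<^sup>2) / (((real L)\<^sup>2 - 1) * (1 + (cmod \<rho>)\<^sup>2))"
      unfolding two_d by simp
    ultimately show ?thesis unfolding arg L unfolding M2 by (simp only:)
  qed
  show ?thesis using pam psk qam by blast
qed

end
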